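(* Let $t\ge0$ and \[ 1<R<\min\left\{R^*,\ 1+\frac{\pi}{\sqrt6}\right\}, \] where $R^*>1$ is such that for every $R'\in(1,R^*]$, $\eta_{R'}(r)\ge\frac23$ for all $r\in[1,R']$. Then the radial-hedgehog solution $\mathbf H$ is a locally stable equilibrium of $I$ in $\mathcal A$, i.e. $\delta^2I[\mathbf H](\mathbf V)>0$ for every nonzero $\mathbf V\in W^{1,2}_0(\Omega;S_0)$.
   Context: Let $S_0$ be the real symmetric traceless $3\times3$ matrices, $|\mathbf Q|^2=Q_{ij}Q_{ij}$, $\Omega=\{x\in\mathbb R^3:1\le|x|\le R\}$, $r=|x|$, $\hat x=x/r$, $h_+=\frac{3+\sqrt{9+8t}}{4}$, \[ I[\mathbf Q]=\int_\Omega \frac12|\nabla\mathbf Q|^2+\frac t8(1-|\mathbf Q|^2)^2+\frac{h_+}{8}(1+3|\mathbf Q|^4-4\sqrt6\,\mathrm{tr}\,\mathbf Q^3)\,dV, \] $\mathcal A=\{\mathbf Q\in W^{1,2}(\Omega;S_0):\mathbf Q=\sqrt{3/2}(\hat x\otimes\hat x-\mathbf I/3)\text{ on }r=1\text{ and }r=R\}$. Let $h$ minimize $E[h]=\int_1^R \frac{r^2}{2}(h')^2+3h^2+r^2[\frac t8(1-h^2)^2+\frac{h_+}{8}(1+3h^4-4h^3)]dr$ over $\{h: h\in L^2(1,R),\,h'\in L^2((1,R);r^2dr),\,h(1)=h(R)=1\}$; the radial-hedgehog solution is $\mathbf H=\sqrt{3/2}\,h(r)(\hat x\otimes\hat x-\mathbf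 I/3)$. The second variation is $\delta^2I[\mathbf H](\mathbf V)=\frac{d^2}{ds^2}\big|_{s=0}I[\mathbf H+s\mathbf V]$. For $R'>1$, $\eta_{R'}(r)=\frac{1}{R'^5-1}[(R'^3-1)r^2+(R'^2-1)(R'/r)^3]$. *)

theory Defs
  imports "HOL-Analysis.Analysis"
begin

type_synonym pt = "real^3"
type_synonym qmat = "real^3^3"
(* a gradient of a matrix field: G $ i $ j $ k = partial_k Q_ij *)
type_synonym qgrad = "real^3^3^3"

definition S0 :: "qmat set" where
  "S0 = {Q. transpose Q = Q \<and> trace Q = 0}"

definition sqn :: "qmat \<Rightarrow> real" where
  "sqn Q = (\<Sum>i\<in>UNIV. \<Sum>j\<in>UNIV. (Q $ i $ j)^2)"

definition sqg :: "qgrad \<Rightarrow> real" where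
  "sqg G = (\<Sum>i\<in>UNIV. \<Sum>j\<in>UNIV. \<Sum>k\<in>UNIV. (G $ i $ j $ k)^2)"

definition hplus :: "real \<Rightarrow> real" where
  "hplus t = (3 + sqrt (9 + 8 * t)) / 4"

definition Omega :: "real \<Rightarrow> pt set" where
  "Omega R = {x. 1 \<le> norm x \<and> norm x \<le> R}"

definition outer :: "pt \<Rightarrow> qmat" where
  "outer v = (\<chi> i j. v $ i * v $ j)"

definition bulk :: "real \<Rightarrow> qmat \<Rightarrow> real" where
  "bulk t Q = t / 8 * (1 - sqn Q)^2
     + hplus t / 8 * (1 + 3 * (sqn Q)^2 - 4 * sqrt 6 * trace (Q ** Q ** Q))"

definition C1c :: "pt set \<Rightarrow> (pt \<Rightarrow> real) \<Rightarrow> (pt \<Rightarrow> pt) \<Rightarrow> bool" where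
  "C1c U \<phi> d \<longleftrightarrow>
     (\<forall>x. (\<phi> has_derivative (\<lambda>v. d x \<bullet> v)) (at x)) \<and> continuous_on UNIV d \<and>
     (\<exists>K. compact K \<and> K \<subseteq> U \<and> (\<forall>x. x \<notin> K \<longrightarrow> \<phi> x = 0))"

definition weak_grad :: "pt set \<Rightarrow> (pt \<Rightarrow> qmat) \<Rightarrow> (pt \<Rightarrow> qgrad) \<Rightarrow> bool" where
  "weak_grad \<Omega> Q G \<longleftrightarrow>
     set_borel_measurable lebesgue \<Omega> Q \<and> set_borel_measurable lebesgue \<Omega> G \<and>
     set_integrable lebesgue \<Omega> (\<lambda>x. sqn (Q x)) \<and>
     set_integrable lebesgue \<Omega> (\<lambda>x. sqg (G x)) \<and>
     (\<forall>\<phi> d. C1c (interior \<Omega>) \<phi> d \<longrightarrow>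
        (\<forall>i j k. (LINT x:\<Omega>|lebesgue. Q x $ i $ j * d x $ k)
                 = - (LINT x:\<Omega>|lebesgue. G x $ i $ j $ k * \<phi> x)))"

text \<open>W^{1,2}_0(Omega; S0): S0-valued, limit in the W^{1,2} norm of C^1 functions with
  compact support in the interior of Omega (equivalently of C_c^infinity functions).\<close>
definition W12_0 :: "pt set \<Rightarrow> (pt \<Rightarrow> qmat) \<Rightarrow> bool" where
  "W12_0 \<Omega> V \<longleftrightarrow> (\<forall>x\<in>\<Omega>. V x \<in> S0) \<and>
     (\<exists>G. weak_grad \<Omega> V G \<and>
       (\<exists>(\<Phi>::nat \<Rightarrow> pt \<Rightarrow> qmat) (d\<Phi>::nat \<Rightarrow> pt \<Rightarrow> qgrad).
          (\<forall>n i j. C1c (interior \<Omega>) (\<lambda>x. \<Phi> n x $ i $ j) (\<lambda>x. d\<Phi> n x $ i $ j)) \<and>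
          (\<lambda>n. LINT x:\<Omega>|lebesgue. sqn (\<Phi> n x - V x)) \<longlonglongrightarrow> 0 \<and>
          (\<lambda>n. LINT x:\<Omega>|lebesgue. sqg (d\<Phi> n x - G x)) \<longlonglongrightarrow> 0))"

text \<open>The Landau-de Gennes energy I[Q] (for Q in W^{1,2}; the integral does not depend on
  which a.e.-representative of the weak gradient is chosen).\<close>
definition LdG :: "real \<Rightarrow> real \<Rightarrow> (pt \<Rightarrow> qmat) \<Rightarrow> real" where
  "LdG t R Q = (let G = (SOME G. weak_grad (Omega R) Q G) in
     LINT x:Omega R|lebesgue. (1/2 * sqg (G x) + bulk t (Q x)))"

definition second_variation_is :: "real \<Rightarrow> real \<Rightarrow> (pt \<Rightarrow> qmat) \<Rightarrow> (pt \<Rightarrow> qmat) \<Rightarrow> real \<Rightarrow> bool" where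
  "second_variation_is t R H V D2 \<longleftrightarrow>
     (\<exists>D1. (\<forall>s. ((\<lambda>s. LdG t R (\<lambda>x. H x + s *\<^sub>R V x)) has_real_derivative D1 s) (at s)) \<and>
           (D1 has_real_derivative D2) (at 0))"

text \<open>Admissible radial profiles: h in L^2(1,R), h' in L^2((1,R); r^2 dr), h(1) = h(R) = 1,
  with h' the (weak) derivative, i.e. h is the absolutely continuous representative.\<close>
definition adm_h :: "real \<Rightarrow> (real \<Rightarrow> real) \<Rightarrow> (real \<Rightarrow> real) \<Rightarrow> bool" where
  "adm_h R h h' \<longleftrightarrow>
     set_borel_measurable lborel {1..R} h \<and> set_borel_measurable lborel {1..R} h' \<and>
     set_integrable lborel {1..R} (\<lambda>r. (h r)^2) \<and>
     set_integrable lborel {1..R} (\<lambda>r. r^2 * (h' r)^2) \<and>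
     set_integrable lborel {1..R} h' \<and>
     (\<forall>r\<in>{1..R}. h r = h 1 + (LBINT s=1..r. h' s)) \<and>
     h 1 = 1 \<and> h R = 1"

definition Erad :: "real \<Rightarrow> real \<Rightarrow> (real \<Rightarrow> real) \<Rightarrow> (real \<Rightarrow> real) \<Rightarrow> real" where
  "Erad t R h h' = (LINT r:{1..R}|lborel.
      r^2 / 2 * (h' r)^2 + 3 * (h r)^2
      + r^2 * (t / 8 * (1 - (h r)^2)^2 + hplus t / 8 * (1 + 3 * (h r)^4 - 4 * (h r)^3)))"

definition radial_minimizer :: "real \<Rightarrow> real \<Rightarrow> (real \<Rightarrow> real) \<Rightarrow> bool" where
  "radial_minimizer t R h \<longleftrightarrow>
     (\<exists>h'. adm_h R h h' \<and> (\<forall>g g'. adm_h R g g' \<longrightarrow> Erad t R h h' \<le> Erad t R g g'))"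

definition hedgehog :: "(real \<Rightarrow> real) \<Rightarrow> pt \<Rightarrow> qmat" where
  "hedgehog h x = sqrt (3/2) *\<^sub>R (h (norm x) *\<^sub>R (outer (x /\<^sub>R norm x) - (1/3) *\<^sub>R mat 1))"

definition eta :: "real \<Rightarrow> real \<Rightarrow> real" where
  "eta R' r = 1 / (R'^5 - 1) * ((R'^3 - 1) * r^2 + (R'^2 - 1) * (R' / r)^3)"

end

(* The minimizing profile satisfies h'' + 2 h'/r = (6/r^2 + q(h)) h with
   q(h) = t/2 (h^2 - 1) + 3/2 h_+ (h^2 - h). Comparison with the solution eta_R of the equation with
   q = 0 gives h >= eta_R >= 2/3. At a minimum of h the equation yields q(h) >= -6/r^2 >= -6, and q is
   increasing on [1/2, oo), so q(h) >= -6 everywhere. For h >= 1/2 the bulk part of the second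
   variation is pointwise at least q(h) |V|^2, hence at least -6 |V|^2, and the first Dirichlet
   eigenvalue (pi/(R-1))^2 of the shell exceeds 6. That the energy is a quartic polynomial in s needs V
   in L^4, which follows from Ladyzhenskaya's inequality. *)

theory Submission
  imports Defs
begin

text \<open>The number 6 is the angular eigenvalue l(l+1) with l = 2. It enters as the zeroth-order
  term 6/r^2 of the profile equation and returns, since r >= 1, as the lower bound of q(h); R < 1 +
  pi / sqrt 6 says exactly that the Dirichlet eigenvalue exceeds it. The comparison with eta uses
  q(h) h <= 0, hence 0 <= h <= 1 beforehand. The upper bound is a maximum principle, but for h below
  0 the coefficient 6/r^2 + q(h) need not be positive, so nonnegativity is taken from the energy
  itself, by a reflection. The minimizer is given only as an absolutely continuous function, so its
  equation has to be extracted: testing with Green functions yields an integral equation, and with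
  it a classical solution up to the boundary. The eigenvalue bound needs no spectral theory. A
  vector field built from the explicit eigenfunction proves it for test functions, and density
  carries it to V. The energy refers to an arbitrarily chosen weak gradient; the fundamental lemma
  of the calculus of variations makes it computable along H + sV.\<close>

lemma borel_measurable_vec_nth [measurable (raw)]:
  fixes f :: "'b \<Rightarrow> 'a::euclidean_space ^ 'n"
  assumes "f \<in> borel_measurable M"
  shows "(\<lambda>x. f x $ k) \<in> borel_measurable M"
  by (rule measurable_compose[OF assms borel_measurable_continuous_onI]) (intro continuous_intros)

section \<open>Calculus of C^1 functions with compact support\<close>

definition C1 :: "(pt \<Rightarrow> real) \<Rightarrow> (pt \<Rightarrow> pt) \<Rightarrow> bool" where
  "C1 f d \<longleftrightarrow> (\<forall>x. (f has_derivative (\<lambda>v. d x \<bullet> v)) (at x)) \<and> continuous_on UNIV d"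

lemma C1c_iff_C1: "C1c U f d \<longleftrightarrow> C1 f d \<and> (\<exists>K. compact K \<and> K \<subseteq> U \<and> (\<forall>x. x \<notin> K \<longrightarrow> f x = 0))"
  by (auto simp: C1c_def C1_def)

lemma C1_has_derivative: "C1 f d \<Longrightarrow> (f has_derivative (\<lambda>v. d x \<bullet> v)) (at x)"
  by (simp add: C1_def)

lemma C1_continuous: "C1 f d \<Longrightarrow> continuous_on UNIV f"
  by (meson C1_def continuous_at_imp_continuous_on has_derivative_continuous)

lemma C1_continuous_grad: "C1 f d \<Longrightarrow> continuous_on UNIV d"
  by (simp add: C1_def)

lemma C1_mult:
  assumes "C1 f d" "C1 g e"
  shows "C1 (\<lambda>x. f x * g x) (\<lambda>x. f x *\<^sub>R e x + g x *\<^sub>R d x)"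
proof -
  have "((\<lambda>x. f x * g x) has_derivative (\<lambda>v. (f x *\<^sub>R e x + g x *\<^sub>R d x) \<bullet> v)) (at x)" for x
    by (rule has_derivative_eq_rhs[OF has_derivative_mult[OF assms(1)[THEN C1_has_derivative] assms(2)[THEN C1_has_derivative]]])
       (simp add: fun_eq_iff inner_add_left algebra_simps)
  then show ?thesis
    unfolding C1_def by (intro conjI continuous_intros allI)
      (auto intro: assms[THEN C1_continuous] assms[THEN C1_continuous_grad])
qed

lemma C1_comp:
  assumes "C1 f d" "\<And>x. (g has_real_derivative g' (f x)) (at (f x))" "continuous_on (range f) g'"
  shows "C1 (\<lambda>x. g (f x)) (\<lambda>x. g' (f x) *\<^sub>R d x)"
proof -
  have "((\<lambda>x. g (f x)) has_derivative (\<lambda>v. (g' (f x) *\<^sub>R d x) \<bullet> v)) (at x)" for x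
    by (rule has_derivative_eq_rhs[OF has_derivative_compose[OF C1_has_derivative[OF assms(1)]
          assms(2)[unfolded has_field_derivative_def]]])
       (simp add: fun_eq_iff)
  moreover have "continuous_on UNIV (\<lambda>x. g' (f x))"
    using continuous_on_compose2[OF assms(3) C1_continuous[OF assms(1)]] by auto
  then have "continuous_on UNIV (\<lambda>x. g' (f x) *\<^sub>R d x)"
    by (rule continuous_on_scaleR[OF _ C1_continuous_grad[OF assms(1)]])
  ultimately show ?thesis
    unfolding C1_def by blast
qed

lemma C1_component: "C1 (\<lambda>x. x $ k) (\<lambda>x. axis k 1)"
  unfolding C1_def
  by (auto intro!: has_derivative_eq_rhs[OF bounded_linear_imp_has_derivative[OF bounded_linear_vec_nth]]
      simp: inner_axis' )

lemma C1c_C1: "C1c U f d \<Longrightarrow> C1 f d"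
  by (simp add: C1c_iff_C1)

text \<open>The complement of \<open>K\<close> is open and \<open>f\<close> vanishes on it, so the
  gradient vanishes there as well: one compact set serves both.\<close>

lemma C1c_support:
  assumes "C1c U f d"
  obtains K where "compact K" "K \<subseteq> U" "\<And>x. x \<notin> K \<Longrightarrow> f x = 0" "\<And>x. x \<notin> K \<Longrightarrow> d x = 0"
proof -
  obtain K where K: "compact K" "K \<subseteq> U" "\<And>x. x \<notin> K \<Longrightarrow> f x = 0"
    using assms by (auto simp: C1c_def)
  have "d x = 0" if "x \<notin> K" for x
  proof -
    have "open (- K)" using K(1) by (simp add: compact_imp_closed open_Compl)
    then have "(f has_derivative (\<lambda>v. 0)) (at x)"
      by (rule has_derivative_transform_within_open[OF has_derivative_const[of 0]])
         (use that K(3) in auto)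
    then have "(\<lambda>v. d x \<bullet> v) = (\<lambda>v. 0)"
      using C1_has_derivative[OF C1c_C1[OF assms]] has_derivative_unique by blast
    then show "d x = 0" by (metis inner_eq_zero_iff)
  qed
  with K that show ?thesis by blast
qed

text \<open>\<open>U\<close> and the complement of the support are two open sets covering the space,
  and on the second the product is zero. Hence \<open>g\<close> may behave arbitrarily outside
  \<open>U\<close>; this admits the field \<open>hardyG\<close>, singular at the boundary of the
  shell, and hedgehog entries, known to be differentiable only inside it.\<close>

lemma C1c_mult_local:
  assumes "C1c U f d" "open U" "\<And>x. x \<in> U \<Longrightarrow> (g has_derivative (\<lambda>v. e x \<bullet> v)) (at x)" "continuous_on U e"
  shows "C1c U (\<lambda>x. g x * f x) (\<lambda>x. g x *\<^sub>R d x + f x *\<^sub>R e x)"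
proof -
  obtain K where K: "compact K" "K \<subseteq> U" "\<And>x. x \<notin> K \<Longrightarrow> f x = 0" "\<And>x. x \<notin> K \<Longrightarrow> d x = 0"
    using C1c_support[OF assms(1)] by metis
  have oK: "open (- K)" using K(1) by (simp add: compact_imp_closed open_Compl)
  let ?D = "\<lambda>x. g x *\<^sub>R d x + f x *\<^sub>R e x"
  have D: "((\<lambda>x. g x * f x) has_derivative (\<lambda>v. ?D x \<bullet> v)) (at x)" for x
  proof (cases "x \<in> U")
    case True
    show ?thesis
      by (rule has_derivative_eq_rhs[OF has_derivative_mult[OF assms(3)[OF True] assms(1)[THEN C1c_C1, THEN C1_has_derivative]]])
       (simp add: fun_eq_iff inner_add_left algebra_simps)
  next
    case False
    then have x: "x \<in> - K" using K by auto
    have "((\<lambda>x. g x * f x) has_derivative (\<lambda>v. 0)) (at x)"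
      by (rule has_derivative_transform_within_open[OF has_derivative_const[of 0] oK x]) (simp add: K)
    then show ?thesis using x by (simp add: K)
  qed
  have "continuous_on (U \<union> - K) ?D"
  proof (rule continuous_on_open_Un[OF assms(2) oK])
    have "continuous_on U g"
      using assms(3) by (meson continuous_at_imp_continuous_on has_derivative_continuous)
    then show "continuous_on U ?D"
      using C1_continuous[OF C1c_C1[OF assms(1)]] C1_continuous_grad[OF C1c_C1[OF assms(1)]]
      by (intro continuous_intros assms(4)) (auto intro: continuous_on_subset)
    show "continuous_on (- K) ?D"
      by (rule continuous_on_eq[of _ "\<lambda>_. 0"]) (auto simp: K)
  qed
  moreover have "U \<union> - K = UNIV" using K by auto
  ultimately show ?thesis
    unfolding C1c_def using D K by (metis mult_zero_right)
qed

lemma continuous_compact_support_integrable: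
  fixes g :: "pt \<Rightarrow> real"
  assumes "continuous_on UNIV g" "compact K" "\<And>x. x \<notin> K \<Longrightarrow> g x = 0"
  shows "integrable lborel g"
proof -
  have "set_integrable lborel K g"
    unfolding set_integrable_def
    by (rule borel_integrable_compact[OF assms(2)]) (use assms(1) continuous_on_subset in blast)
  moreover have "(\<lambda>x. indicator K x *\<^sub>R g x) = g"
    using assms(3) by (auto simp: fun_eq_iff indicator_def)
  ultimately show ?thesis by (simp add: set_integrable_def)
qed

lemma C1c_grad_integrable:
  assumes "C1c U f d" shows "integrable lborel (\<lambda>x. d x $ k)"
proof -
  obtain K where K: "compact K" "K \<subseteq> U" "\<And>x. x \<notin> K \<Longrightarrow> f x = 0" "\<And>x. x \<notin> K \<Longrightarrow> d x = 0"
    using C1c_support[OF assms(1)] by metis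
  show ?thesis
    by (rule continuous_compact_support_integrable[OF _ K(1)])
       (auto intro!: continuous_on_component C1_continuous_grad[OF C1c_C1[OF assms]] simp: K)
qed

text \<open>Difference quotients have integral zero by translation invariance of Lebesgue measure,
  and dominated convergence passes this to the partial derivative. This takes the place of the
  divergence theorem.\<close>

lemma C1c_grad_integral_zero:
  assumes "C1c U f d" shows "(\<integral>x. d x $ k \<partial>lborel) = 0"
proof -
  obtain K where K: "compact K" "K \<subseteq> U" "\<And>x. x \<notin> K \<Longrightarrow> f x = 0" "\<And>x. x \<notin> K \<Longrightarrow> d x = 0"
    using C1c_support[OF assms(1)] by metis
  note C = C1c_C1[OF assms]
  obtain \<rho> where rho: "K \<subseteq> cball 0 \<rho>"
    using compact_imp_bounded[OF K(1)] by (auto simp: bounded_iff subset_eq)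
  have "bounded (d ` K)"
    by (intro compact_imp_bounded compact_continuous_image K(1) continuous_on_subset[OF C1_continuous_grad[OF C]]) simp
  then obtain B where B: "\<And>x. x \<in> K \<Longrightarrow> norm (d x) \<le> B" "B > 0"
    unfolding bounded_pos by auto
  have dB: "norm (d x) \<le> B" for x using B K(4) by (cases "x \<in> K") auto
  have lip: "\<bar>f x - f y\<bar> \<le> B * norm (x - y)" for x y
  proof -
    have "norm (f x - f y) \<le> B * norm (x - y)"
    proof (rule differentiable_bound[of UNIV f "\<lambda>x v. d x \<bullet> v"])
      show "onorm ((\<bullet>) (d x)) \<le> B" for x
      proof (rule onorm_bound)
        show "norm (d x \<bullet> v) \<le> B * norm v" for v
          using Cauchy_Schwarz_ineq2[of "d x" v] mult_right_mono[OF dB, of "norm v" x] by simp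
      qed (use B in simp)
    qed (auto intro: C1_has_derivative[OF C])
    then show ?thesis by simp
  qed
  define e :: pt where "e = axis k 1"
  have ne: "norm e = 1" by (simp add: e_def)
  define F where "F n x = real (Suc n) * (f (inverse (real (Suc n)) *\<^sub>R e + x) - f x)" for n x
  have fi: "integrable lborel f"
    by (rule continuous_compact_support_integrable[OF C1_continuous[OF C] K(1,3)])
  have cf[measurable]: "f \<in> borel_measurable borel" "d \<in> borel_measurable borel"
    using C1_continuous[OF C] C1_continuous_grad[OF C] by (auto intro: borel_measurable_continuous_onI)
  have shift: "integrable lborel (\<lambda>x. f (c + x)) \<and> (\<integral>x. f (c + x) \<partial>lborel) = (\<integral>x. f x \<partial>lborel)" for c
  proof -
    have "integrable (distr lborel borel ((+) c)) f" by (simp add: lborel_distr_plus fi)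
    moreover have "(\<integral>x. f x \<partial>distr lborel borel ((+) c)) = (\<integral>x. f (c + x) \<partial>lborel)"
      by (rule integral_distr) auto
    ultimately show ?thesis by (subst (asm) integrable_distr_eq) (auto simp: lborel_distr_plus)
  qed
  have F0: "(\<integral>x. F n x \<partial>lborel) = 0" for n
    unfolding F_def using shift fi by simp
  \<comment> \<open>The quotients are bounded by the Lipschitz constant \<open>B\<close>; since the
    steps have length at most 1, they vanish outside the ball of radius
    \<open>\<rho> + 1\<close>.\<close>
  have "(\<lambda>n. \<integral>x. F n x \<partial>lborel) \<longlonglongrightarrow> (\<integral>x. d x $ k \<partial>lborel)"
  proof (rule integral_dominated_convergence[where w="\<lambda>x. B * indicator (cball 0 (\<rho> + 1)) x"])
    show "(\<lambda>x. d x $ k) \<in> borel_measurable lborel" "\<And>n. F n \<in> borel_measurable lborel"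
      unfolding F_def by simp_all
    show "integrable lborel (\<lambda>x::pt. B * indicator (cball 0 (\<rho> + 1)) x)"
      by (intro integrable_mult_right integrable_real_indicator) (use emeasure_bounded_finite[OF bounded_cball] in auto)
    show "AE x in lborel. norm (F n x) \<le> B * indicator (cball 0 (\<rho> + 1)) x" for n
    proof (rule AE_I2)
      fix x
      show "norm (F n x) \<le> B * indicator (cball 0 (\<rho> + 1)) x"
      proof (cases "x \<in> cball 0 (\<rho> + 1)")
        case True
        have "\<bar>f (inverse (real (Suc n)) *\<^sub>R e + x) - f x\<bar> \<le> B * inverse (real (Suc n))"
          using lip[of "inverse (real (Suc n)) *\<^sub>R e + x" x] ne by simp
        then have "real (Suc n) * \<bar>f (inverse (real (Suc n)) *\<^sub>R e + x) - f x\<bar> \<le> real (Suc n) * (B * inverse (real (Suc n)))"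
          by (intro mult_left_mono) auto
        also have "\<dots> = B" by (simp add: field_simps)
        finally show ?thesis using True unfolding F_def abs_mult real_norm_def by simp
      next
        case False
        have "x \<notin> K" using rho False by auto
        moreover have "inverse (real (Suc n)) *\<^sub>R e + x \<notin> K"
        proof
          assume "inverse (real (Suc n)) *\<^sub>R e + x \<in> K"
          then have "norm (inverse (real (Suc n)) *\<^sub>R e + x) \<le> \<rho>" using rho by auto
          then have "norm x \<le> \<rho> + norm (inverse (real (Suc n)) *\<^sub>R e)"
            using norm_triangle_ineq4[of "inverse (real (Suc n)) *\<^sub>R e + x" "inverse (real (Suc n)) *\<^sub>R e"] by simp
          also have "norm (inverse (real (Suc n)) *\<^sub>R e) \<le> 1" using ne by (simp add: inverse_eq_divide)
          finally show False using False by simp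
        qed
        ultimately show ?thesis using False by (simp add: F_def K(3))
      qed
    qed
    show "AE x in lborel. (\<lambda>n. F n x) \<longlonglongrightarrow> d x $ k"
    proof (rule AE_I2)
      fix x
      have "((\<lambda>s. f (s *\<^sub>R e + x)) has_derivative (\<lambda>s. d (0 *\<^sub>R e + x) \<bullet> (s *\<^sub>R e))) (at 0)"
        by (rule has_derivative_compose[of "\<lambda>s. s *\<^sub>R e + x" _ 0 UNIV f, OF _ C1_has_derivative[OF C]])
           (auto intro!: derivative_eq_intros)
      then have "((\<lambda>s. f (s *\<^sub>R e + x)) has_real_derivative (d x $ k)) (at 0)"
        unfolding has_field_derivative_def by (simp add: e_def inner_axis mult.commute[of _ "d x $ k"] cong: )
      then have "((\<lambda>s. (f (s *\<^sub>R e + x) - f x) / s) \<longlongrightarrow> d x $ k) (at 0)"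
        by (simp add: DERIV_def)
      moreover have "filterlim (\<lambda>n. inverse (real (Suc n))) (at 0) sequentially"
        unfolding filterlim_at using LIMSEQ_inverse_real_of_nat by auto
      ultimately have "(\<lambda>n. (f (inverse (real (Suc n)) *\<^sub>R e + x) - f x) / inverse (real (Suc n))) \<longlonglongrightarrow> d x $ k"
        by (rule filterlim_compose)
      then show "(\<lambda>n. F n x) \<longlonglongrightarrow> d x $ k" by (simp add: F_def field_simps)
    qed
  qed
  then show ?thesis by (simp add: F0 LIMSEQ_const_iff)
qed

section \<open>The Poincare inequality on the shell with its sharp constant\<close>

definition shell :: "real \<Rightarrow> pt set" where
  "shell R = {x. 1 < norm x \<and> norm x < R}"

lemma open_shell: "open (shell R)"
  unfolding shell_def by (intro open_Collect_conj open_Collect_less continuous_intros)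

lemma has_derivative_radial:
  fixes x :: pt
  assumes "(g has_real_derivative g') (at (norm x))" "x \<noteq> 0"
  shows "((\<lambda>x. g (norm x)) has_derivative (\<lambda>v. ((g' / norm x) *\<^sub>R x) \<bullet> v)) (at x)"
proof -
  have "(norm has_derivative (\<lambda>v. v \<bullet> sgn x)) (at x)"
    using has_derivative_norm[OF assms(2)] .
  from has_derivative_compose[OF this assms(1)[unfolded has_field_derivative_def]]
  show ?thesis by (rule has_derivative_eq_rhs) (simp add: fun_eq_iff sgn_div_norm inner_commute divide_simps)
qed

lemma has_derivative_radial_component:
  fixes x :: pt
  assumes "(g has_real_derivative g') (at (norm x))" "x \<noteq> 0"
  shows "((\<lambda>x. g (norm x) * x $ k) has_derivative
     (\<lambda>v. (g (norm x) *\<^sub>R axis k 1 + (x $ k * g' / norm x) *\<^sub>R x) \<bullet> v)) (at x)"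
  by (rule has_derivative_eq_rhs[OF has_derivative_mult[OF has_derivative_radial[OF assms] C1_has_derivative[OF C1_component]]])
     (simp add: fun_eq_iff inner_add_left inner_axis' algebra_simps)

context
  fixes R \<mu> :: real
  assumes R: "1 < R" and mu: "\<mu> = pi / (R - 1)"
begin

text \<open>The field \<open>hardyG |x| x\<close> is \<open>\<nabla>\<psi> / \<psi>\<close> for the first Dirichlet eigenfunction
  \<open>\<psi> x = sin (\<mu> (|x| - 1)) / |x|\<close> of the shell.\<close>

definition hardyG :: "real \<Rightarrow> real" where
  "hardyG r = \<mu> * cot (\<mu> * (r - 1)) / r - 1 / r^2"

definition hardyG' :: "real \<Rightarrow> real" where
  "hardyG' r = (- (\<mu>^2) - (\<mu> * cot (\<mu> * (r - 1)))^2) / r - \<mu> * cot (\<mu> * (r - 1)) / r^2 + 2 / r^3"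

lemma sin_shell_pos: "1 < r \<Longrightarrow> r < R \<Longrightarrow> sin (\<mu> * (r - 1)) > 0"
proof (rule sin_gt_zero)
  assume r: "1 < r" "r < R"
  then show "0 < \<mu> * (r - 1)" using R by (simp add: mu)
  have "(r - 1) * pi < (R - 1) * pi" using r by simp
  then show "\<mu> * (r - 1) < pi" using R by (simp add: mu field_simps)
qed

lemma hardyG_deriv:
  assumes "1 < r" "r < R"
  shows "(hardyG has_real_derivative hardyG' r) (at r)"
proof -
  have s: "sin (\<mu> * (r - 1)) \<noteq> 0" using sin_shell_pos[OF assms] by simp
  have c: "inverse ((sin (\<mu> * (r - 1)))\<^sup>2) = 1 + (cot (\<mu> * (r - 1)))\<^sup>2"
    using s sin_cos_squared_add[of "\<mu> * (r - 1)"] by (simp add: cot_def field_simps)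
  have dc: "((\<lambda>r. cot (\<mu> * (r - 1))) has_real_derivative - (1 + (cot (\<mu> * (r - 1)))\<^sup>2) * \<mu>) (at r)"
    by (rule DERIV_cong[OF DERIV_chain2[where f=cot and g="\<lambda>r. \<mu> * (r - 1)", OF DERIV_cot[OF s]]]) (auto intro!: derivative_eq_intros simp: c)
  show ?thesis
    unfolding hardyG_def hardyG'_def
    using assms by (auto intro!: derivative_eq_intros dc)
      (simp add: field_simps power2_eq_square power3_eq_cube power4_eq_xxxx)
qed

text \<open>For the field X = \<open>hardyG\<close> |x| x the left side is div X + |X|^2, which for
  X = \<nabla>\<psi> / \<psi> equals the Laplacian of \<psi> divided by \<psi>. As r \<psi> = sin
  (\<mu> (r - 1)), this is -\<mu>^2. In terms of \<open>cot\<close> the identity is pure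
  algebra.\<close>

lemma hardyG_div:
  assumes "r > 0"
  shows "3 * hardyG r + r * hardyG' r + (r * hardyG r)^2 = - (\<mu>^2)"
  using assms unfolding hardyG_def hardyG'_def
  by (simp add: field_simps power2_eq_square power3_eq_cube)

lemma continuous_on_hardyG: "continuous_on {1<..<R} hardyG"
  by (intro continuous_at_imp_continuous_on ballI DERIV_isCont[OF hardyG_deriv]) auto

lemma continuous_on_hardyG': "continuous_on {1<..<R} hardyG'"
proof -
  have "continuous_on {1<..<R} (\<lambda>r. cot (\<mu> * (r - 1)))"
    unfolding cot_def using sin_shell_pos by (intro continuous_intros) (metis greaterThanLessThan_iff less_irrefl)
  then show ?thesis unfolding hardyG'_def by (auto intro!: continuous_intros)
qed

text \<open>With X the field of \<open>hardyG\<close>, expanding 0 <= |\<nabla>u - u X|^2 and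
  inserting div X = -\<mu>^2 - |X|^2 gives \<mu>^2 u^2 + div (u^2 X) <= |\<nabla>u|^2 pointwise. The
  divergence integrates to zero because u^2 X has compact support inside the shell, away from the
  singularities of X.\<close>

lemma poincare_shell:
  assumes u: "C1c (shell R) u d"
  shows "\<mu>^2 * (\<integral>x. (u x)^2 \<partial>lborel) \<le> (\<integral>x. (norm (d x))^2 \<partial>lborel)"
proof -
  obtain K where K: "compact K" "K \<subseteq> shell R" "\<And>x. x \<notin> K \<Longrightarrow> u x = 0" "\<And>x. x \<notin> K \<Longrightarrow> d x = 0"
    using C1c_support[OF u] by metis
  note C = C1c_C1[OF u]
  have u2: "C1c (shell R) (\<lambda>x. u x * u x) (\<lambda>x. u x *\<^sub>R d x + u x *\<^sub>R d x)"
    by (rule C1c_mult_local[OF u open_shell C1_has_derivative[OF C]])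
       (rule continuous_on_subset[OF C1_continuous_grad[OF C]], simp)
  \<comment> \<open>\<open>e k\<close> is the gradient of the \<open>k\<close>-th component of X;
    \<open>F\<close> below is then the \<open>k\<close>-th component of u^2 X together with its
    gradient.\<close>
  define e where "e k x = hardyG (norm x) *\<^sub>R axis k 1 + (x $ k * hardyG' (norm x) / norm x) *\<^sub>R x" for k :: 3 and x :: pt
  have nz: "x \<noteq> 0" if "x \<in> shell R" for x using that by (auto simp: shell_def)
  have F: "C1c (shell R) (\<lambda>x. (hardyG (norm x) * x $ k) * (u x * u x))
      (\<lambda>x. (hardyG (norm x) * x $ k) *\<^sub>R (u x *\<^sub>R d x + u x *\<^sub>R d x) + (u x * u x) *\<^sub>R e k x)" for k
  proof (rule C1c_mult_local[OF u2 open_shell])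
    show "((\<lambda>x. hardyG (norm x) * x $ k) has_derivative (\<bullet>) (e k x)) (at x)" if "x \<in> shell R" for x
      unfolding e_def using that nz[OF that]
      by (intro has_derivative_radial_component hardyG_deriv) (auto simp: shell_def)
    have "continuous_on (shell R) (\<lambda>x. hardyG (norm x))" "continuous_on (shell R) (\<lambda>x. hardyG' (norm x))"
      by (rule continuous_on_compose2[OF continuous_on_hardyG continuous_on_norm_id], force simp: shell_def)
         (rule continuous_on_compose2[OF continuous_on_hardyG' continuous_on_norm_id], force simp: shell_def)
    then show "continuous_on (shell R) (e k)"
      unfolding e_def using nz by (intro continuous_intros) auto
  qed
  let ?G = "\<lambda>k x. (hardyG (norm x) * x $ k) *\<^sub>R (u x *\<^sub>R d x + u x *\<^sub>R d x) + (u x * u x) *\<^sub>R e k x"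
  have int: "integrable lborel (\<lambda>x. \<Sum>k\<in>UNIV. ?G k x $ k)"
    by (rule Bochner_Integration.integrable_sum[OF C1c_grad_integrable[OF F]])
  have "(\<integral>x. (\<Sum>k\<in>UNIV. ?G k x $ k) \<partial>lborel) = (\<Sum>k\<in>UNIV. (\<integral>x. ?G k x $ k \<partial>lborel))"
    by (rule Bochner_Integration.integral_sum[OF C1c_grad_integrable[OF F]])
  then have zero: "(\<integral>x. (\<Sum>k\<in>UNIV. ?G k x $ k) \<partial>lborel) = 0"
    by (simp only: C1c_grad_integral_zero[OF F] sum.neutral_const)
  have iu: "integrable lborel (\<lambda>x. (u x)^2)" "integrable lborel (\<lambda>x. (norm (d x))^2)"
    by (rule continuous_compact_support_integrable[OF _ K(1)];
        auto intro!: continuous_intros C1_continuous[OF C] C1_continuous_grad[OF C] simp: K)+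
  have pw: "\<mu>^2 * (u x)^2 + (\<Sum>k\<in>UNIV. ?G k x $ k) \<le> (norm (d x))^2" for x
  proof (cases "x \<in> shell R")
    case False
    then have "x \<notin> K" using K by auto
    then show ?thesis by (simp add: K)
  next
    case True
    define r g where "r = norm x" and "g = hardyG r"
    have r: "r > 0" using True by (auto simp: shell_def r_def)
    have "(\<Sum>k\<in>UNIV. ?G k x $ k) = 2 * u x * g * (\<Sum>k\<in>UNIV. x $ k * d x $ k)
      + (u x)^2 * (3 * g + hardyG' r / r * (\<Sum>k\<in>UNIV. x $ k * x $ k))"
      by (simp add: e_def r_def[symmetric] g_def[symmetric] sum_3 axis_def power2_eq_square algebra_simps add_divide_distrib)
    also have "(\<Sum>k\<in>UNIV. x $ k * x $ k) = r^2"
      unfolding r_def power2_norm_eq_inner inner_vec_def by simp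
    also have "(\<Sum>k\<in>UNIV. x $ k * d x $ k) = x \<bullet> d x"
      by (simp add: inner_vec_def)
    finally have S: "(\<Sum>k\<in>UNIV. ?G k x $ k) = 2 * u x * g * (x \<bullet> d x) + (u x)^2 * (3 * g + r * hardyG' r)"
      using r by (simp add: power2_eq_square)
    \<comment> \<open>The square |\<nabla>u - u X|^2, with X = \<open>g *\<^sub>R x\<close> at this
      point.\<close>
    have "0 \<le> (d x - (u x * g) *\<^sub>R x) \<bullet> (d x - (u x * g) *\<^sub>R x)" by simp
    also have "\<dots> = (norm (d x))^2 - 2 * u x * g * (x \<bullet> d x) + (u x)^2 * (r * g)^2"
      by (simp add: inner_diff_left inner_diff_right r_def power2_norm_eq_inner power_mult_distrib inner_commute)
         (simp add: power2_eq_square algebra_simps inner_commute)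
    finally have "2 * u x * g * (x \<bullet> d x) - (u x)^2 * (r * g)^2 \<le> (norm (d x))^2" by simp
    moreover have "3 * g + r * hardyG' r = - (\<mu>^2) - (r * g)^2"
      using hardyG_div[OF r] by (simp add: g_def)
    then have "(u x)^2 * (3 * g + r * hardyG' r) = - (\<mu>^2 * (u x)^2) - (u x)^2 * (r * g)^2"
      by (simp add: right_diff_distrib)
    ultimately show ?thesis unfolding S by linarith
  qed
  have "(\<integral>x. \<mu>^2 * (u x)^2 + (\<Sum>k\<in>UNIV. ?G k x $ k) \<partial>lborel) \<le> (\<integral>x. (norm (d x))^2 \<partial>lborel)"
    by (rule integral_mono[OF Bochner_Integration.integrable_add[OF integrable_mult_right[OF iu(1)] int] iu(2) pw])
  also have "(\<integral>x. \<mu>^2 * (u x)^2 + (\<Sum>k\<in>UNIV. ?G k x $ k) \<partial>lborel)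
      = (\<integral>x. \<mu>^2 * (u x)^2 \<partial>lborel) + (\<integral>x. (\<Sum>k\<in>UNIV. ?G k x $ k) \<partial>lborel)"
    by (rule Bochner_Integration.integral_add[OF integrable_mult_right[OF iu(1)] int])
  also have "\<dots> = \<mu>^2 * (\<integral>x. (u x)^2 \<partial>lborel)"
    unfolding zero by simp
  finally show ?thesis .
qed

end

section \<open>Ladyzhenskaya's inequality in three dimensions\<close>

lemma abs_le_nn_integral_deriv:
  fixes f f' :: "real \<Rightarrow> real"
  assumes "\<And>x. (f has_real_derivative f' x) (at x)" "continuous_on UNIV f'" "f c = 0" "c \<le> a"
  shows "ennreal \<bar>f a\<bar> \<le> (\<integral>\<^sup>+x. ennreal \<bar>f' x\<bar> \<partial>lborel)"
proof -
  have "has_bochner_integral lborel (\<lambda>x. f' x * indicator {c .. a} x) (f a - f c)"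
    by (rule has_bochner_integral_FTC_Icc_real[OF assms(4) assms(1)])
       (use assms(2) in \<open>simp add: continuous_on_eq_continuous_at\<close>)
  then have i: "integrable lborel (\<lambda>x. f' x * indicator {c .. a} x)"
    and e: "(\<integral>x. f' x * indicator {c .. a} x \<partial>lborel) = f a"
    using assms(3) by (auto simp: has_bochner_integral_iff)
  have "ennreal \<bar>f a\<bar> \<le> (\<integral>\<^sup>+x. norm (f' x * indicator {c .. a} x) \<partial>lborel)"
    using integral_norm_bound_ennreal[OF i] by (simp add: e)
  also have "\<dots> \<le> (\<integral>\<^sup>+x. ennreal \<bar>f' x\<bar> \<partial>lborel)"
    by (intro nn_integral_mono ennreal_leI) (auto simp: indicator_def)
  finally show ?thesis .
qed

definition pt3 :: "real \<Rightarrow> real \<Rightarrow> real \<Rightarrow> pt" where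
  "pt3 a b c = a *\<^sub>R axis 1 1 + b *\<^sub>R axis 2 1 + c *\<^sub>R axis 3 1"

lemma pt3_nth [simp]: "pt3 a b c $ 1 = a" "pt3 a b c $ 2 = b" "pt3 a b c $ 3 = c"
  by (simp_all add: pt3_def axis_def)

lemma measurable_pt3 [measurable (raw)]:
  assumes "f \<in> borel_measurable M" "g \<in> borel_measurable M" "h \<in> borel_measurable M"
  shows "(\<lambda>x. pt3 (f x) (g x) (h x)) \<in> borel_measurable M"
  using assms unfolding pt3_def by measurable

lemma prod_Basis_pt: "(\<Prod>b\<in>Basis. (v::pt) \<bullet> b) = v $ 1 * v $ 2 * v $ 3"
proof -
  have B: "(Basis :: pt set) = (\<lambda>k. axis k 1) ` UNIV"
    by (auto simp: Basis_vec_def)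
  have inj: "inj (\<lambda>k::3. axis k (1::real))"
    by (intro injI) (metis axis_eq_axis zero_neq_one)
  have "(\<Prod>b\<in>Basis. v \<bullet> b) = (\<Prod>k\<in>UNIV. v $ k)"
    unfolding B prod.reindex[OF inj] by (simp add: inner_axis)
  also have "\<dots> = v $ 1 * v $ 2 * v $ 3"
    unfolding UNIV_3 by (simp add: ac_simps)
  finally show ?thesis .
qed

text \<open>Lebesgue measure is determined by its values on boxes. The third coordinate is split off
  as the outer variable and the pair is stored as (x2, x1), so that slices at constant x3 become
  inner integrals.\<close>

lemma distr_pt3: "distr (lborel \<Otimes>\<^sub>M lborel) borel (\<lambda>(c, p). pt3 (snd p) (fst p) c) = (lborel :: pt measure)"
proof (rule lborel_eqI[symmetric])
  fix l u :: pt
  assume lu: "\<And>b. b \<in> Basis \<Longrightarrow> l \<bullet> b \<le> u \<bullet> b"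
  have le: "l $ k \<le> u $ k" for k
    using lu[of "axis k 1"] by (simp add: inner_axis)
  have m: "(\<lambda>(c, p). pt3 (snd p) (fst p) c) \<in> borel_measurable (lborel \<Otimes>\<^sub>M (lborel :: (real \<times> real) measure))"
    unfolding borel_prod[symmetric] lborel_prod[symmetric] by measurable
  have "(\<lambda>(c, p). pt3 (snd p) (fst p) c) -` box l u \<inter> space (lborel \<Otimes>\<^sub>M (lborel :: (real \<times> real) measure))
      = {l $ 3 <..< u $ 3} \<times> ({l $ 2 <..< u $ 2} \<times> {l $ 1 <..< u $ 1})"
    by (auto simp: mem_box_cart forall_3 space_pair_measure)
  then have "emeasure (distr (lborel \<Otimes>\<^sub>M lborel) borel (\<lambda>(c, p). pt3 (snd p) (fst p) c)) (box l u)
      = emeasure (lborel \<Otimes>\<^sub>M (lborel :: (real \<times> real) measure)) ({l $ 3 <..< u $ 3} \<times> ({l $ 2 <..< u $ 2} \<times> {l $ 1 <..< u $ 1}))"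
    by (subst emeasure_distr[OF m]) auto
  also have "\<dots> = emeasure lborel {l $ 3 <..< u $ 3} * emeasure (lborel \<Otimes>\<^sub>M lborel) ({l $ 2 <..< u $ 2} \<times> {l $ 1 <..< u $ 1})"
    unfolding lborel_prod by (subst lborel.emeasure_pair_measure_Times[symmetric]) (auto simp: lborel_prod intro!: borel_open open_Times)
  also have "\<dots> = ennreal (u $ 3 - l $ 3) * (ennreal (u $ 2 - l $ 2) * ennreal (u $ 1 - l $ 1))"
    by (subst lborel.emeasure_pair_measure_Times) (auto simp: le)
  also have "\<dots> = ennreal (\<Prod>b\<in>Basis. (u - l) \<bullet> b)"
    unfolding prod_Basis_pt using le by (simp add: ennreal_mult[symmetric] mult_ac)
  finally show "emeasure (distr (lborel \<Otimes>\<^sub>M lborel) borel (\<lambda>(c, p). pt3 (snd p) (fst p) c)) (box l u)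
      = ennreal (\<Prod>b\<in>Basis. (u - l) \<bullet> b)" .
qed simp

lemma measurable_pt3_slice [measurable]:
  "(\<lambda>p. pt3 (snd p) (fst p) c) \<in> borel_measurable borel"
  unfolding borel_prod[symmetric] by measurable

lemma measurable_pt3_pair [measurable]:
  "(\<lambda>(c, p). pt3 (snd p) (fst p) c) \<in> borel_measurable (borel \<Otimes>\<^sub>M borel)"
  unfolding borel_prod[symmetric] by measurable

lemma nn_integral_pt3:
  assumes [measurable]: "f \<in> borel_measurable borel"
  shows "(\<integral>\<^sup>+x. f x \<partial>lborel) = (\<integral>\<^sup>+c. \<integral>\<^sup>+p. f (pt3 (snd p) (fst p) c) \<partial>lborel \<partial>lborel)"
proof -
  have m: "(\<lambda>(c, p). pt3 (snd p) (fst p) c) \<in> borel_measurable (lborel \<Otimes>\<^sub>M (lborel :: (real \<times> real) measure))"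
    using measurable_pt3_pair by (simp cong: measurable_cong_sets)
  have "(\<integral>\<^sup>+x. f x \<partial>lborel) = (\<integral>\<^sup>+z. f ((\<lambda>(c, p). pt3 (snd p) (fst p) c) z) \<partial>(lborel \<Otimes>\<^sub>M lborel))"
    unfolding distr_pt3[symmetric] by (rule nn_integral_distr[OF m]) simp
  also have "\<dots> = (\<integral>\<^sup>+c. \<integral>\<^sup>+p. f ((\<lambda>(c, p). pt3 (snd p) (fst p) c) (c, p)) \<partial>lborel \<partial>lborel)"
    by (rule lborel.nn_integral_fst[symmetric]) (rule measurable_compose[OF m assms])
  finally show ?thesis by simp
qed

lemma nn_integral_prod_fst:
  fixes f :: "real \<times> real \<Rightarrow> ennreal"
  assumes "f \<in> borel_measurable borel"
  shows "(\<integral>\<^sup>+p. f p \<partial>lborel) = (\<integral>\<^sup>+b. \<integral>\<^sup>+a. f (b, a) \<partial>lborel \<partial>lborel)"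
  unfolding lborel_prod[symmetric]
  by (rule lborel.nn_integral_fst[symmetric]) (use assms in \<open>simp add: lborel_prod\<close>)

lemma nn_integral_prod_snd:
  fixes f :: "real \<times> real \<Rightarrow> ennreal"
  assumes "f \<in> borel_measurable borel"
  shows "(\<integral>\<^sup>+p. f p \<partial>lborel) = (\<integral>\<^sup>+a. \<integral>\<^sup>+b. f (b, a) \<partial>lborel \<partial>lborel)"
  unfolding lborel_prod[symmetric]
  by (rule lborel_pair.nn_integral_snd[symmetric]) (use assms in \<open>simp add: lborel_prod\<close>)

lemma power2_nth_le: "((x::real^'n) $ k)\<^sup>2 \<le> (norm x)\<^sup>2"
  using power_mono[OF component_le_norm_cart abs_ge_zero, of x k 2] by simp

text \<open>The product is at most the square of the larger factor. This avoids square roots of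
  extended nonnegative reals after Cauchy-Schwarz.\<close>

lemma mult_le_if_squares_le:
  fixes a b X :: ennreal
  assumes "a\<^sup>2 \<le> X" "b\<^sup>2 \<le> X"
  shows "a * b \<le> X"
proof (cases "a \<le> b")
  case True
  then have "a * b \<le> b * b" by (intro mult_right_mono) auto
  then show ?thesis using assms by (simp add: power2_eq_square)
next
  case False
  then have "a * b \<le> a * a" by (intro mult_left_mono) auto
  then show ?thesis using assms by (simp add: power2_eq_square)
qed

text \<open>On a slice \<open>x\<^sub>3 = c\<close>, \<open>u\<^sup>4\<close> is at most a function of \<open>x\<^sub>2\<close> times a function of \<open>x\<^sub>1\<close>;
  the slice integrals of \<open>u\<^sup>2\<close> are controlled uniformly by integrating in the third direction.\<close>

lemma ladyzhenskaya:
  assumes u: "C1c U u d"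
  shows "(\<integral>\<^sup>+x. ennreal ((u x)^4) \<partial>lborel) \<le>
    4 * (\<integral>\<^sup>+x. ennreal ((u x)^2 + (norm (d x))^2) \<partial>lborel) * (\<integral>\<^sup>+x. ennreal ((norm (d x))^2) \<partial>lborel)"
proof -
  obtain K where K: "compact K" "K \<subseteq> U" "\<And>x. x \<notin> K \<Longrightarrow> u x = 0" "\<And>x. x \<notin> K \<Longrightarrow> d x = 0"
    using C1c_support[OF u] by metis
  note C = C1c_C1[OF u]
  obtain \<rho> where rho: "K \<subseteq> cball 0 \<rho>"
    using compact_imp_bounded[OF K(1)] by (auto simp: bounded_iff subset_eq)
  have [measurable]: "u \<in> borel_measurable borel" "d \<in> borel_measurable borel"
    using C1_continuous[OF C] C1_continuous_grad[OF C] by (auto intro: borel_measurable_continuous_onI)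
  \<comment> \<open>\<open>N k\<close> is the absolute value of the \<open>k\<close>-th partial
    derivative of u^2.\<close>
  define N where "N k x = ennreal \<bar>2 * u x * d x $ k\<bar>" for k x
  have [measurable]: "N k \<in> borel_measurable borel" for k unfolding N_def by measurable
  have line: "ennreal ((u (y + a *\<^sub>R axis k 1))^2) \<le> (\<integral>\<^sup>+t. N k (y + t *\<^sub>R axis k 1) \<partial>lborel)" for y a k
  proof -
    let ?e = "axis k 1 :: pt"
    have "((\<lambda>t. (u (y + t *\<^sub>R ?e))^2) has_real_derivative 2 * u (y + t *\<^sub>R ?e) * d (y + t *\<^sub>R ?e) $ k) (at t)" for t
    proof -
      have "((\<lambda>t. u (y + t *\<^sub>R ?e)) has_derivative (\<lambda>s. d (y + t *\<^sub>R ?e) \<bullet> (s *\<^sub>R ?e))) (at t)"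
        by (rule has_derivative_compose[of "\<lambda>t. y + t *\<^sub>R ?e" _ t UNIV u, OF _ C1_has_derivative[OF C]])
           (auto intro!: derivative_eq_intros)
      then have "((\<lambda>t. u (y + t *\<^sub>R ?e)) has_real_derivative d (y + t *\<^sub>R ?e) $ k) (at t)"
        unfolding has_field_derivative_def by (simp add: inner_axis mult.commute[of _ "d (y + t *\<^sub>R ?e) $ k"])
      then show ?thesis by (auto intro!: derivative_eq_intros)
    qed
    moreover have "continuous_on UNIV (\<lambda>t. 2 * u (y + t *\<^sub>R ?e) * d (y + t *\<^sub>R ?e) $ k)"
      by (intro continuous_intros continuous_on_compose2[OF C1_continuous[OF C]]
          continuous_on_compose2[OF C1_continuous_grad[OF C]]) auto
    \<comment> \<open>The starting point of the integration along the line: the minimum with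
      \<open>a\<close> keeps it below \<open>a\<close>, and the second bound pushes its
      \<open>k\<close>-th coordinate beyond the ball of radius \<open>\<rho>\<close> that contains
      the support.\<close>
    moreover have "(u (y + min a (- \<bar>\<rho>\<bar> - \<bar>y $ k\<bar> - 1) *\<^sub>R ?e))^2 = 0"
    proof -
      let ?z = "y + min a (- \<bar>\<rho>\<bar> - \<bar>y $ k\<bar> - 1) *\<^sub>R ?e"
      have "\<rho> < \<bar>?z $ k\<bar>" by (auto simp: axis_def)
      then have "\<rho> < norm ?z" using component_le_norm_cart[of ?z k] by linarith
      then have "?z \<notin> K" using rho by auto
      then show ?thesis using K(3) by simp
    qed
    ultimately have "ennreal \<bar>(u (y + a *\<^sub>R ?e))^2\<bar> \<le> (\<integral>\<^sup>+t. ennreal \<bar>2 * u (y + t *\<^sub>R ?e) * d (y + t *\<^sub>R ?e) $ k\<bar> \<partial>lborel)"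
      by (rule abs_le_nn_integral_deriv) simp
    then show ?thesis by (simp add: N_def)
  qed
  have l1: "ennreal ((u (pt3 a b c))^2) \<le> (\<integral>\<^sup>+t. N 1 (pt3 t b c) \<partial>lborel)" for a b c
    using line[of "pt3 0 b c" a 1] by (simp add: pt3_def add_ac)
  have l2: "ennreal ((u (pt3 a b c))^2) \<le> (\<integral>\<^sup>+t. N 2 (pt3 a t c) \<partial>lborel)" for a b c
    using line[of "pt3 a 0 c" b 2] by (simp add: pt3_def add_ac)
  have l3: "ennreal ((u (pt3 a b c))^2) \<le> (\<integral>\<^sup>+t. N 3 (pt3 a b t) \<partial>lborel)" for a b c
    using line[of "pt3 a b 0" c 3] by (simp add: pt3_def add_ac)
  define Q where "Q c p = pt3 (snd p) (fst p) c" for c and p :: "real \<times> real"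
  have [measurable]: "Q c \<in> borel_measurable borel" for c
    unfolding Q_def by (rule measurable_pt3_slice)
  define S where "S c = (\<integral>\<^sup>+p. ennreal ((u (Q c p))^2) \<partial>lborel)" for c
  define D where "D c = (\<integral>\<^sup>+p. ennreal ((norm (d (Q c p)))^2) \<partial>lborel)" for c
  define \<alpha> where "\<alpha> k c = (\<integral>\<^sup>+p. N k (Q c p) \<partial>lborel)" for k c
  \<comment> \<open>Cauchy-Schwarz on the slice with the factors 2|u| and |d $ k|; the constant 4 is
    the square of 2.\<close>
  have alpha: "(\<alpha> k c)\<^sup>2 \<le> 4 * S c * D c" for k c
  proof -
    have "\<alpha> k c = (\<integral>\<^sup>+p. ennreal (2 * \<bar>u (Q c p)\<bar>) * ennreal \<bar>d (Q c p) $ k\<bar> \<partial>lborel)"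
      unfolding \<alpha>_def N_def by (intro nn_integral_cong) (simp add: ennreal_mult[symmetric] abs_mult)
    then have "(\<alpha> k c)\<^sup>2 \<le> (\<integral>\<^sup>+p. (ennreal (2 * \<bar>u (Q c p)\<bar>))\<^sup>2 \<partial>lborel) * (\<integral>\<^sup>+p. (ennreal \<bar>d (Q c p) $ k\<bar>)\<^sup>2 \<partial>lborel)"
      by (simp only:) (rule Cauchy_Schwarz_nn_integral; measurable)
    also have "(\<integral>\<^sup>+p. (ennreal (2 * \<bar>u (Q c p)\<bar>))\<^sup>2 \<partial>lborel) = (\<integral>\<^sup>+p. 4 * ennreal ((u (Q c p))\<^sup>2) \<partial>lborel)"
      by (intro nn_integral_cong) (simp add: ennreal_power power_mult_distrib ennreal_mult)
    also have "\<dots> = 4 * S c" unfolding S_def by (rule nn_integral_cmult) measurable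
    also have "(\<integral>\<^sup>+p. (ennreal \<bar>d (Q c p) $ k\<bar>)\<^sup>2 \<partial>lborel) \<le> D c"
      unfolding D_def
      by (intro nn_integral_mono) (simp add: ennreal_power power2_nth_le)
    finally show ?thesis by (simp add: mult_left_mono)
  qed
  have slice: "(\<integral>\<^sup>+p. ennreal ((u (Q c p))^4) \<partial>lborel) \<le> 4 * S c * D c" for c
  proof -
    have "(\<integral>\<^sup>+p. ennreal ((u (Q c p))^4) \<partial>lborel) = (\<integral>\<^sup>+b. \<integral>\<^sup>+a. ennreal ((u (pt3 a b c))^4) \<partial>lborel \<partial>lborel)"
      by (subst nn_integral_prod_fst) (auto simp: Q_def)
    also have "\<dots> \<le> (\<integral>\<^sup>+b. \<integral>\<^sup>+a. (\<integral>\<^sup>+t. N 1 (pt3 t b c) \<partial>lborel) * (\<integral>\<^sup>+t. N 2 (pt3 a t c) \<partial>lborel) \<partial>lborel \<partial>lborel)"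
    proof (intro nn_integral_mono)
      fix a b
      have "ennreal ((u (pt3 a b c))^4) = ennreal ((u (pt3 a b c))^2) * ennreal ((u (pt3 a b c))^2)"
        by (simp add: ennreal_mult[symmetric] power4_eq_xxxx power2_eq_square mult.assoc)
      also have "\<dots> \<le> (\<integral>\<^sup>+t. N 1 (pt3 t b c) \<partial>lborel) * (\<integral>\<^sup>+t. N 2 (pt3 a t c) \<partial>lborel)"
        by (intro mult_mono l1 l2) auto
      finally show "ennreal ((u (pt3 a b c))^4) \<le> \<dots>" .
    qed
    \<comment> \<open>The first factor does not depend on \<open>a\<close> and the second does not
      depend on \<open>b\<close>, so the double integral is a product.\<close>
    also have "\<dots> = (\<integral>\<^sup>+b. \<integral>\<^sup>+t. N 1 (pt3 t b c) \<partial>lborel \<partial>lborel) * (\<integral>\<^sup>+a. \<integral>\<^sup>+t. N 2 (pt3 a t c) \<partial>lborel \<partial>lborel)"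
      by (simp add: nn_integral_cmult nn_integral_multc)
    also have "(\<integral>\<^sup>+b. \<integral>\<^sup>+t. N 1 (pt3 t b c) \<partial>lborel \<partial>lborel) = \<alpha> 1 c"
      unfolding \<alpha>_def by (subst nn_integral_prod_fst) (auto simp: Q_def)
    also have "(\<integral>\<^sup>+a. \<integral>\<^sup>+t. N 2 (pt3 a t c) \<partial>lborel \<partial>lborel) = \<alpha> 2 c"
      unfolding \<alpha>_def by (subst nn_integral_prod_snd) (auto simp: Q_def)
    also have "\<alpha> 1 c * \<alpha> 2 c \<le> 4 * S c * D c"
      by (rule mult_le_if_squares_le) (rule alpha)+
    finally show ?thesis .
  qed
  define \<kappa> where "\<kappa> = (\<integral>\<^sup>+x. ennreal ((u x)^2 + (norm (d x))^2) \<partial>lborel)"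
  have S: "S c \<le> \<kappa>" for c
  proof -
    have "S c \<le> (\<integral>\<^sup>+p. \<integral>\<^sup>+t. N 3 (Q t p) \<partial>lborel \<partial>lborel)"
      unfolding S_def Q_def by (intro nn_integral_mono l3)
    also have "\<dots> = (\<integral>\<^sup>+t. \<integral>\<^sup>+p. N 3 (Q t p) \<partial>lborel \<partial>lborel)"
    proof (rule lborel_pair.Fubini')
      have "(\<lambda>(x, y). N 3 (Q y x)) \<in> borel_measurable (borel \<Otimes>\<^sub>M borel)"
        unfolding Q_def borel_prod[symmetric] by measurable
      then show "(\<lambda>(x, y). N 3 (Q x y)) \<in> borel_measurable (lborel \<Otimes>\<^sub>M lborel)"
        unfolding Q_def borel_prod[symmetric] lborel_prod[symmetric] by measurable
    qed
    also have "\<dots> = (\<integral>\<^sup>+x. N 3 x \<partial>lborel)"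
      by (subst nn_integral_pt3) (auto simp: Q_def)
    also have "\<dots> \<le> \<kappa>"
      unfolding \<kappa>_def N_def
    proof (intro nn_integral_mono ennreal_leI)
      fix x
      have "0 \<le> (\<bar>u x\<bar> - \<bar>d x $ 3\<bar>)\<^sup>2" by simp
      also have "\<dots> = (u x)^2 + (d x $ 3)^2 - \<bar>2 * u x * d x $ 3\<bar>"
        by (simp add: power2_diff abs_mult)
      finally have "\<bar>2 * u x * d x $ 3\<bar> \<le> (u x)^2 + (d x $ 3)^2" by simp
      moreover have "(d x $ 3)^2 \<le> (norm (d x))^2"
        by (rule power2_nth_le)
      ultimately show "\<bar>2 * u x * d x $ 3\<bar> \<le> (u x)^2 + (norm (d x))^2" by simp
    qed
    finally show ?thesis .
  qed
  have "(\<integral>\<^sup>+x. ennreal ((u x)^4) \<partial>lborel) = (\<integral>\<^sup>+c. \<integral>\<^sup>+p. ennreal ((u (Q c p))^4) \<partial>lborel \<partial>lborel)"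
    by (subst nn_integral_pt3) (auto simp: Q_def)
  \<comment> \<open>\<open>S c\<close> is bounded by \<kappa> uniformly in \<open>c\<close>, so only
    \<open>D c\<close> remains to be integrated over the slices.\<close>
  also have "\<dots> \<le> (\<integral>\<^sup>+c. 4 * \<kappa> * D c \<partial>lborel)"
    by (intro nn_integral_mono order_trans[OF slice] mult_right_mono mult_left_mono S) auto
  also have "\<dots> = 4 * \<kappa> * (\<integral>\<^sup>+c. D c \<partial>lborel)"
    unfolding D_def Q_def by (intro nn_integral_cmult) (unfold borel_prod[symmetric] lborel_prod[symmetric], measurable)
  also have "(\<integral>\<^sup>+c. D c \<partial>lborel) = (\<integral>\<^sup>+x. ennreal ((norm (d x))^2) \<partial>lborel)"
    unfolding D_def by (subst nn_integral_pt3) (auto simp: Q_def)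
  finally show ?thesis by (simp add: \<kappa>_def)
qed

section \<open>The fundamental lemma of the calculus of variations\<close>

lemma DERIV_max0_square: "((\<lambda>y::real. (max 0 y)\<^sup>2) has_real_derivative 2 * max 0 y) (at y)"
proof -
  consider "y > 0" | "y < 0" | "y = 0" by linarith
  then show ?thesis
  proof cases
    case 1
    have "((\<lambda>y. y\<^sup>2) has_real_derivative 2 * max 0 y) (at y)"
      using 1 by (auto intro!: derivative_eq_intros)
    then show ?thesis
      by (rule has_field_derivative_transform_within_open[of _ _ _ "{0<..}"]) (use 1 in auto)
  next
    case 2
    have "((\<lambda>y. 0) has_real_derivative 2 * max 0 y) (at y)"
      using 2 by auto
    then show ?thesis
      by (rule has_field_derivative_transform_within_open[of _ _ _ "{..<0}"]) (use 2 in auto)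
  next
    case 3
    have "((\<lambda>h::real. (max 0 h)\<^sup>2 / h) \<longlongrightarrow> 0) (at 0)"
    proof (rule Lim_null_comparison)
      show "\<forall>\<^sub>F h in at 0. norm ((max 0 h)\<^sup>2 / h) \<le> \<bar>h\<bar>"
        by (rule always_eventually) (auto simp: max_def power2_eq_square)
      show "(abs \<longlongrightarrow> (0::real)) (at 0)"
        by (auto intro!: tendsto_eq_intros)
    qed
    then show ?thesis using 3 by (simp add: DERIV_def)
  qed
qed

text \<open>\<open>B\<close>, the product over the coordinates of the squared positive parts of (x_k
  - a_k)(c_k - x_k), is C^1 and positive exactly on the open box: squaring smooths the kink of the
  positive part just enough. Then B / (B + 1/(n+1)) takes values in [0, 1], vanishes outside the box
  and tends to the indicator.\<close>

lemma C1c_approx_box_indicator: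
  fixes a c :: pt
  assumes "\<And>k. a $ k \<le> c $ k" "cbox a c \<subseteq> U"
  obtains \<phi> d where "\<And>n::nat. C1c U (\<phi> n) (d n)" "\<And>n x. 0 \<le> \<phi> n x \<and> \<phi> n x \<le> 1"
    "\<And>x. (\<lambda>n. \<phi> n x) \<longlonglongrightarrow> indicator (box a c) x"
proof -
  define p where "p k x = (x $ k - a $ k) * (c $ k - x $ k)" for k :: 3 and x :: pt
  define b where "b k x = (max 0 (p k x))\<^sup>2" for k x
  have p: "\<exists>d. C1 (p k) d" for k
    unfolding p_def
    by (rule exI, rule C1_comp[OF C1_component, where g="\<lambda>s. (s - a $ k) * (c $ k - s)" and g'="\<lambda>s. a $ k + c $ k - 2 * s"])
       (auto intro!: derivative_eq_intros continuous_intros)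
  have b: "\<exists>d. C1 (b k) d" for k
  proof -
    obtain d where d: "C1 (p k) d" using p by blast
    have "C1 (\<lambda>x. (max 0 (p k x))\<^sup>2) (\<lambda>x. (2 * max 0 (p k x)) *\<^sub>R d x)"
      by (rule C1_comp[OF d DERIV_max0_square]) (auto intro!: continuous_intros)
    then show ?thesis unfolding b_def by blast
  qed
  define B where "B x = b 1 x * b 2 x * b 3 x" for x
  obtain d1 d2 d3 where "C1 (b 1) d1" "C1 (b 2) d2" "C1 (b 3) d3"
    using b by metis
  from C1_mult[OF C1_mult[OF this(1,2)] this(3)] obtain dB where dB: "C1 B dB"
    unfolding B_def by blast
  have B0: "B x \<ge> 0" for x by (simp add: B_def b_def)
  have Bpos: "B x > 0 \<longleftrightarrow> x \<in> box a c" for x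
  proof -
    have "p k x > 0 \<longleftrightarrow> a $ k < x $ k \<and> x $ k < c $ k" for k
      using assms(1)[of k] by (auto simp: p_def zero_less_mult_iff)
    moreover have "b k x > 0 \<longleftrightarrow> p k x > 0" for k by (auto simp: b_def)
    moreover have "B x > 0 \<longleftrightarrow> b 1 x > 0 \<and> b 2 x > 0 \<and> b 3 x > 0"
    proof -
      have "b k x \<ge> 0" for k by (simp add: b_def)
      then show ?thesis unfolding B_def by (metis less_eq_real_def mult_pos_pos mult_zero_left mult_zero_right less_irrefl)
    qed
    ultimately show ?thesis by (simp add: mem_box_cart forall_3)
  qed
  define \<phi> where "\<phi> n = (\<lambda>x. B x / (B x + 1 / real (Suc n)))" for n
  have "\<exists>d. C1c U (\<phi> n) d" for n
  proof -
    have e: "1 / real (Suc n) > 0" by simp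
    have nz: "B x + 1 / real (Suc n) \<noteq> 0" for x using B0[of x] e by linarith
    have "C1 (\<phi> n)
       (\<lambda>x. ((1 / real (Suc n)) / (B x + 1 / real (Suc n))\<^sup>2) *\<^sub>R dB x)"
      unfolding \<phi>_def
    proof (rule C1_comp[OF dB])
      show "((\<lambda>y. y / (y + 1 / real (Suc n))) has_real_derivative 1 / real (Suc n) / (B x + 1 / real (Suc n))\<^sup>2) (at (B x))" for x
        using nz[of x] by (auto intro!: derivative_eq_intros simp: power2_eq_square simp del: of_nat_Suc)
      show "continuous_on (range B) (\<lambda>y. 1 / real (Suc n) / (y + 1 / real (Suc n))\<^sup>2)"
        using nz by (intro continuous_intros) auto
    qed
    moreover have "\<phi> n x = 0" if "x \<notin> cbox a c" for x
    proof -
      have "x \<notin> box a c" using that box_subset_cbox by blast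
      then have "B x = 0" using Bpos[of x] B0[of x] by linarith
      then show ?thesis by (simp add: \<phi>_def)
    qed
    ultimately show ?thesis
      unfolding C1c_iff_C1 using assms(2) compact_cbox by blast
  qed
  then obtain d where d: "C1c U (\<phi> n) (d n)" for n by metis
  have "0 \<le> \<phi> n x \<and> \<phi> n x \<le> 1" for n x
    using B0[of x] unfolding \<phi>_def
    by (intro conjI divide_nonneg_nonneg add_nonneg_nonneg) (auto intro!: divide_le_eq_1[THEN iffD2] add_nonneg_pos)
  moreover have "(\<lambda>n. \<phi> n x) \<longlonglongrightarrow> indicator (box a c) x" for x
  proof (cases "x \<in> box a c")
    case True
    then have "B x > 0" using Bpos by simp
    then have "(\<lambda>n. B x / (B x + 1 / real (Suc n))) \<longlonglongrightarrow> B x / (B x + 0)"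
      by (intro tendsto_intros LIMSEQ_Suc[OF lim_1_over_n]) auto
    then show ?thesis using True \<open>B x > 0\<close> by (simp add: \<phi>_def del: of_nat_Suc)
  next
    case False
    then have "B x = 0" using Bpos[of x] B0[of x] by linarith
    then show ?thesis using False by (simp add: \<phi>_def)
  qed
  ultimately show ?thesis using that d by blast
qed

lemma integral_cbox_zero_if_C1c_orthogonal:
  fixes W :: "pt \<Rightarrow> real"
  assumes W: "integrable lebesgue W" and orth: "\<And>\<phi> d. C1c U \<phi> d \<Longrightarrow> (\<integral>x. W x * \<phi> x \<partial>lebesgue) = 0"
    and "\<And>k. a $ k \<le> c $ k" "cbox a c \<subseteq> U"
  shows "integral (cbox a c) W = 0"
proof -
  obtain \<phi> d where phi: "\<And>n::nat. C1c U (\<phi> n) (d n)" "\<And>n x. 0 \<le> \<phi> n x \<and> \<phi> n x \<le> 1"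
    "\<And>x. (\<lambda>n. \<phi> n x) \<longlonglongrightarrow> indicator (box a c) x"
    using C1c_approx_box_indicator[OF assms(3,4)] by metis
  have Wm: "W \<in> borel_measurable lebesgue" using W by simp
  have pm: "\<phi> n \<in> borel_measurable lebesgue" for n
    by (intro measurable_completion)
       (simp add: borel_measurable_continuous_onI[OF C1_continuous[OF C1c_C1[OF phi(1)]]])
  have "(\<lambda>n. \<integral>x. W x * \<phi> n x \<partial>lebesgue) \<longlonglongrightarrow> (\<integral>x. W x * indicator (box a c) x \<partial>lebesgue)"
  proof (rule integral_dominated_convergence[where w="\<lambda>x. \<bar>W x\<bar>"])
    show "AE x in lebesgue. norm (W x * \<phi> n x) \<le> \<bar>W x\<bar>" for n
      using phi(2) by (auto simp: abs_mult intro!: mult_left_le)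
    show "AE x in lebesgue. (\<lambda>n. W x * \<phi> n x) \<longlonglongrightarrow> W x * indicator (box a c) x"
      using phi(3) by (auto intro!: tendsto_mult)
    show "(\<lambda>x. W x * \<phi> n x) \<in> borel_measurable lebesgue" for n
      by (rule borel_measurable_times[OF Wm pm])
    show "(\<lambda>x. W x * indicator (box a c) x) \<in> borel_measurable lebesgue"
      by (rule borel_measurable_times[OF Wm]) (auto intro!: borel_measurable_indicator)
    show "integrable lebesgue (\<lambda>x. \<bar>W x\<bar>)" using W by simp
  qed
  then have 0: "(\<integral>x. W x * indicator (box a c) x \<partial>lebesgue) = 0"
    by (simp add: orth[OF phi(1)] LIMSEQ_const_iff)
  have si: "set_integrable lebesgue (box a c) W"
    unfolding set_integrable_def using integrable_mult_indicator[OF _ W] by simp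
  have "integral (box a c) W = (LINT x:box a c|lebesgue. W x)"
    using set_lebesgue_integral_eq_integral(2)[OF si] by simp
  also have "\<dots> = 0" using 0 by (simp add: set_lebesgue_integral_def mult.commute)
  finally show ?thesis by (simp add: integral_open_interval)
qed

text \<open>By the Lebesgue differentiation theorem, W x is almost everywhere the limit of averages
  over small cubes with corner x. Once such a cube lies in \<open>U\<close>, its average vanishes,
  by approximating the indicator of the cube with test functions.\<close>

lemma AE_zero_if_C1c_orthogonal:
  fixes W :: "pt \<Rightarrow> real"
  assumes "open U" and W: "integrable lebesgue W"
    and orth: "\<And>\<phi> d. C1c U \<phi> d \<Longrightarrow> (\<integral>x. W x * \<phi> x \<partial>lebesgue) = 0"
  shows "AE x in lebesgue. x \<in> U \<longrightarrow> W x = 0"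
proof -
  have "W integrable_on cbox a b" for a b
    using integrable_on_subcbox[OF integrable_on_lebesgue[OF W]] by simp
  then obtain N where N: "negligible N"
    "\<And>x e. \<lbrakk>x \<notin> N; 0 < e\<rbrakk> \<Longrightarrow> \<exists>d>0. \<forall>h. 0 < h \<and> h < d \<longrightarrow>
       norm (integral (cbox x (x + h *\<^sub>R One)) W /\<^sub>R h ^ DIM(pt) - W x) < e"
    using integrable_ccontinuous_explicit[of W] by metis
  have One: "(One :: pt) $ k = 1" for k
    using inner_sum_left_Basis[of "axis k 1 :: pt" "\<lambda>_. 1"] by (simp add: cart_eq_inner_axis del: sum_component)
  have zero: "W x = 0" if x: "x \<in> U" "x \<notin> N" for x
  proof (rule ccontr)
    assume "W x \<noteq> 0"
    then obtain d where d: "d > 0" "\<And>h. 0 < h \<Longrightarrow> h < d \<Longrightarrow>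
       norm (integral (cbox x (x + h *\<^sub>R One)) W /\<^sub>R h ^ DIM(pt) - W x) < \<bar>W x\<bar>"
      using N(2)[OF x(2), of "\<bar>W x\<bar>"] by auto
    obtain r where r: "r > 0" "cball x r \<subseteq> U"
      using \<open>open U\<close> x(1) open_contains_cball by blast
    \<comment> \<open>A point of the cube of side \<open>h\<close> has distance at most
      \<open>3 * h\<close> from the corner, by the l^1 norm; \<open>r / 3\<close> therefore keeps
      the cube in \<open>U\<close>, and \<open>d / 2\<close> makes \<open>h < d\<close>
      strict.\<close>
    define h where "h = min (d / 2) (r / 3)"
    have h: "0 < h" "h < d" "3 * h \<le> r" using d(1) r(1) by (auto simp: h_def)
    have "cbox x (x + h *\<^sub>R One) \<subseteq> cball x r"
    proof
      fix y assume "y \<in> cbox x (x + h *\<^sub>R One)"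
      then have "x $ k \<le> y $ k \<and> y $ k \<le> x $ k + h" for k
        by (simp add: mem_box_cart One del: sum_component)
      then have "\<bar>(y - x) $ k\<bar> \<le> h" for k by (simp add: abs_le_iff) (smt (verit))
      then have "norm (y - x) \<le> (\<Sum>k\<in>(UNIV::3 set). h)"
        by (intro order_trans[OF norm_le_l1_cart] sum_mono)
      then show "y \<in> cball x r" using h(3) by (simp add: dist_norm norm_minus_commute)
    qed
    then have "integral (cbox x (x + h *\<^sub>R One)) W = 0"
      using r(2) h(1) by (intro integral_cbox_zero_if_C1c_orthogonal[where U=U, OF W orth]) (auto simp: One simp del: sum_component)
    then show False using d(2)[OF h(1,2)] by simp
  qed
  have "AE x in lebesgue. x \<notin> N"
    using N(1) AE_not_in negligible_iff_null_sets by blast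
  then show ?thesis by eventually_elim (use zero in auto)
qed

section \<open>The radial profile: Euler-Lagrange equation, regularity and bounds\<close>

text \<open>The value of \<open>bulk t\<close> at sqrt (3/2) h (n n^T - I/3) with |n| = 1: there
  |Q|^2 = h^2 and sqrt 6 tr Q^3 = h^3. Its derivative in h is \<open>bulkq t h * h\<close>.\<close>

definition bulkF :: "real \<Rightarrow> real \<Rightarrow> real" where
  "bulkF t h = t / 8 * (1 - h^2)^2 + hplus t / 8 * (1 + 3 * h^4 - 4 * h^3)"

text \<open>The Euler-Lagrange equation of \<open>Erad\<close> reads \<open>h'' + 2 h' / r = (6 / r\<^sup>2 + bulkq t h) h\<close>.\<close>

definition bulkq :: "real \<Rightarrow> real \<Rightarrow> real" where
  "bulkq t h = t / 2 * (h^2 - 1) + 3 / 2 * hplus t * (h^2 - h)"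

lemma hplus_ge: "t \<ge> 0 \<Longrightarrow> hplus t \<ge> 3 / 2"
proof -
  assume "t \<ge> 0"
  then have "3 \<le> sqrt (9 + 8 * t)" by (intro real_le_rsqrt) simp
  then show ?thesis by (simp add: hplus_def)
qed

lemma set_borel_measurable_times:
  fixes f g :: "'a \<Rightarrow> real"
  assumes "set_borel_measurable M A f" "set_borel_measurable M A g"
  shows "set_borel_measurable M A (\<lambda>x. f x * g x)"
proof -
  have "(\<lambda>x. (indicator A x *\<^sub>R f x) * (indicator A x *\<^sub>R g x)) \<in> borel_measurable M"
    using assms unfolding set_borel_measurable_def by (rule borel_measurable_times)
  also have "(\<lambda>x. (indicator A x *\<^sub>R f x) * (indicator A x *\<^sub>R g x)) = (\<lambda>x. indicator A x *\<^sub>R (f x * g x))"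
    by (auto simp: indicator_def)
  finally show ?thesis by (simp add: set_borel_measurable_def)
qed

lemma set_borel_measurable_continuous_Icc:
  fixes f :: "real \<Rightarrow> real"
  assumes "continuous_on {a..b} f"
  shows "set_borel_measurable lborel {a..b} f"
  unfolding set_borel_measurable_def
  using borel_measurable_continuous_on_indicator[OF _ assms] by simp

lemma set_integrable_bounded_mult:
  fixes f k :: "real \<Rightarrow> real"
  assumes "set_integrable lborel {a..b} f" "set_borel_measurable lborel {a..b} k"
    and "\<And>x. x \<in> {a..b} \<Longrightarrow> \<bar>k x\<bar> \<le> B"
  shows "set_integrable lborel {a..b} (\<lambda>x. k x * f x)"
proof (rule set_integrable_bound)
  show "set_integrable lborel {a..b} (\<lambda>x. B * f x)" using assms(1) by simp
  have "set_borel_measurable lborel {a..b} f"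
    using assms(1) by (auto simp: set_borel_measurable_def set_integrable_def)
  then show "set_borel_measurable lborel {a..b} (\<lambda>x. k x * f x)"
    by (rule set_borel_measurable_times[OF assms(2)])
  show "AE x in lborel. x \<in> {a..b} \<longrightarrow> norm (k x * f x) \<le> norm (B * f x)"
  proof (intro AE_I2 impI)
    fix x assume "x \<in> {a..b}"
    then have "\<bar>k x\<bar> \<le> \<bar>B\<bar>" using assms(3)[of x] by linarith
    then show "norm (k x * f x) \<le> norm (B * f x)" by (simp add: abs_mult mult_right_mono)
  qed
qed

lemma set_integrable_continuous_Icc:
  fixes f :: "real \<Rightarrow> real"
  assumes "continuous_on {a..b} f"
  shows "set_integrable lborel {a..b} f"
  using borel_integrable_atLeastAtMost'[OF assms] by simp

lemma poly4_min_at_0: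
  fixes a0 a1 a2 a3 a4 :: real
  assumes "\<And>s. a0 \<le> a0 + s * a1 + s^2 * a2 + s^3 * a3 + s^4 * a4"
  shows "a1 = 0"
proof (rule DERIV_local_min[of _ _ 0 1])
  show "((\<lambda>s. a0 + s * a1 + s^2 * a2 + s^3 * a3 + s^4 * a4) has_real_derivative a1) (at 0)"
    by (auto intro!: derivative_eq_intros)
qed (use assms in auto)

lemma adm_h_has_integral:
  assumes "adm_h R h h'" "1 \<le> u" "u \<le> v" "v \<le> R"
  shows "(h' has_integral (h v - h u)) {u..v}"
proof -
  have i: "set_integrable lborel {1..R} h'" and h: "\<And>r. r \<in> {1..R} \<Longrightarrow> h r = h 1 + (LBINT s=1..r. h' s)"
    using assms(1) by (auto simp: adm_h_def)
  have sub: "set_integrable lborel {c..d} h'" if "1 \<le> c" "d \<le> R" for c d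
    by (rule set_integrable_subset[OF i]) (use that in auto)
  have io: "h' integrable_on {c..d}" if "1 \<le> c" "d \<le> R" for c d
    using set_borel_integral_eq_integral(1)[OF sub[OF that]] .
  have eq: "h r = h 1 + integral {1..r} h'" if "1 \<le> r" "r \<le> R" for r
    using h[of r] interval_integral_eq_integral[of 1 r h'] sub[of 1 r] that by (simp add: one_ereal_def)
  have "integral {1..u} h' + integral {u..v} h' = integral {1..v} h'"
    by (rule Henstock_Kurzweil_Integration.integral_combine[OF assms(2,3) io]) (use assms in auto)
  then have "integral {u..v} h' = h v - h u"
    using eq[of u] eq[of v] assms by simp
  then show ?thesis using io[of u v] assms by (metis integrable_integral)
qed

text \<open>The weak derivative condition is asked for with \<open>has_integral\<close>, because
  restriction to subintervals and the fundamental theorem with exceptional points are available in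
  that form.\<close>

lemma adm_hI:
  assumes "set_borel_measurable lborel {1..R} h'" "set_integrable lborel {1..R} h'"
    "set_integrable lborel {1..R} (\<lambda>r. r^2 * (h' r)^2)" "continuous_on {1..R} h"
    "\<And>r. 1 \<le> r \<Longrightarrow> r \<le> R \<Longrightarrow> (h' has_integral (h r - h 1)) {1..r}" "h 1 = 1" "h R = 1"
  shows "adm_h R h h'"
  unfolding adm_h_def
proof (intro conjI ballI)
  show "set_integrable lborel {1..R} (\<lambda>r. (h r)\<^sup>2)"
    by (intro set_integrable_continuous_Icc continuous_intros assms(4))
  fix r assume r: "r \<in> {1..R}"
  have "set_integrable lborel {1..r} h'"
    by (rule set_integrable_subset[OF assms(2)]) (use r in auto)
  then have "(LBINT s=1..r. h' s) = h r - h 1"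
    using interval_integral_eq_integral[of 1 r h'] integral_unique[OF assms(5)[of r]] r by (simp add: one_ereal_def)
  then show "h r = h 1 + (LBINT s=1..r. h' s)" by simp
qed (use assms set_borel_measurable_continuous_Icc in auto)

lemma adm_h_continuous:
  assumes "adm_h R h h'"
  shows "continuous_on {1..R} h"
proof (cases "1 \<le> R")
  case True
  have io: "h' integrable_on {1..R}"
    using adm_h_has_integral[OF assms, of 1 R] True by blast
  have "h 1 + integral {1..r} h' = h r" if "r \<in> {1..R}" for r
    using integral_unique[OF adm_h_has_integral[OF assms, of 1 r]] that by simp
  then show ?thesis
    using continuous_on_add[OF continuous_on_const[of _ "h 1"] indefinite_integral_continuous_1[OF io]]
    by (rule continuous_on_eq[rotated]) 
qed simp

text \<open>The energy along h + s \<phi> is a quartic polynomial in s with integrable coefficients,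
  so the first variation is its linear coefficient and vanishes at the minimum without
  differentiating under the integral. \<phi>' is only measurable and bounded, since the derivative
  of a Green function jumps at the pole.\<close>

lemma Erad_variation:
  assumes adm: "adm_h R h h'" and R: "1 < R"
    and phi: "continuous_on {1..R} \<phi>" "set_borel_measurable lborel {1..R} \<phi>'" "\<And>x. x \<in> {1..R} \<Longrightarrow> \<bar>\<phi>' x\<bar> \<le> B"
      "\<And>r. 1 \<le> r \<Longrightarrow> r \<le> R \<Longrightarrow> (\<phi>' has_integral \<phi> r) {1..r}" "\<phi> 1 = 0" "\<phi> R = 0"
    and min: "\<And>g g'. adm_h R g g' \<Longrightarrow> Erad t R h h' \<le> Erad t R g g'"
  shows "set_integrable lborel {1..R} (\<lambda>r. r^2 * h' r * \<phi>' r)"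
    "(LINT r:{1..R}|lborel. r^2 * h' r * \<phi>' r) + (LINT r:{1..R}|lborel. (6 + r^2 * bulkq t (h r)) * h r * \<phi> r) = 0"
proof -
  have h: "continuous_on {1..R} h" by (rule adm_h_continuous[OF adm])
  have ih: "set_integrable lborel {1..R} h'" "set_integrable lborel {1..R} (\<lambda>r. r^2 * (h' r)^2)"
     "set_borel_measurable lborel {1..R} h'" "h 1 = 1" "h R = 1"
    using adm by (auto simp: adm_h_def)
  have B: "B \<ge> 0" using phi(3)[of 1] R by auto
  have bm: "set_integrable lborel {1..R} (\<lambda>r. (r^2 * \<phi>' r) * h' r)"
  proof (rule set_integrable_bounded_mult[OF ih(1), where B="R^2 * B"])
    show "set_borel_measurable lborel {1..R} (\<lambda>r. r^2 * \<phi>' r)"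
      by (intro set_borel_measurable_times set_borel_measurable_continuous_Icc phi continuous_intros)
    show "\<bar>x^2 * \<phi>' x\<bar> \<le> R^2 * B" if "x \<in> {1..R}" for x
      unfolding abs_mult using that phi(3)[OF that] by (intro mult_mono) (auto intro: power_mono)
  qed
  then show i1: "set_integrable lborel {1..R} (\<lambda>r. r^2 * h' r * \<phi>' r)"
    by (simp add: mult_ac)
  have i2: "set_integrable lborel {1..R} \<phi>'"
    using set_integrable_bounded_mult[OF set_integrable_continuous_Icc[OF continuous_on_const[of _ 1]] phi(2,3)] by simp
  have "set_integrable lborel {1..R} (\<lambda>r. (r^2 * \<phi>' r) * \<phi>' r)"
  proof (rule set_integrable_bounded_mult[OF i2, where B="R^2 * B"])
    show "set_borel_measurable lborel {1..R} (\<lambda>r. r^2 * \<phi>' r)"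
      by (intro set_borel_measurable_times set_borel_measurable_continuous_Icc phi continuous_intros)
    show "\<bar>x^2 * \<phi>' x\<bar> \<le> R^2 * B" if "x \<in> {1..R}" for x
      unfolding abs_mult using that phi(3)[OF that] by (intro mult_mono) (auto intro: power_mono)
  qed
  then have i3: "set_integrable lborel {1..R} (\<lambda>r. r^2 * (\<phi>' r)^2)"
    by (simp add: power2_eq_square mult_ac)
  define c0 where "c0 r = (r^2 * (h' r)^2) * (1/2) + (3 * (h r)^2 + r^2 * bulkF t (h r))" for r
  define c1 where "c1 r = r^2 * h' r * \<phi>' r + (6 + r^2 * bulkq t (h r)) * h r * \<phi> r" for r
  define c2 where "c2 r = (r^2 * (\<phi>' r)^2) * (1/2) + (3 * (\<phi> r)^2 + r^2 * (t / 8 * (6 * (h r)^2 - 2) * (\<phi> r)^2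
      + hplus t / 8 * (18 * (h r)^2 - 12 * h r) * (\<phi> r)^2))" for r
  define c3 where "c3 r = r^2 * (t / 2 * h r + hplus t / 8 * (12 * h r - 4)) * (\<phi> r)^3" for r
  define c4 where "c4 r = r^2 * (t / 8 + 3 * hplus t / 8) * (\<phi> r)^4" for r
  note ci = set_integrable_continuous_Icc
  have I0: "set_integrable lborel {1..R} c0"
    unfolding c0_def bulkF_def by (intro set_integral_add(1) set_integrable_mult_left impI ih ci continuous_intros h phi)
  have J1: "set_integrable lborel {1..R} (\<lambda>r. (6 + r^2 * bulkq t (h r)) * h r * \<phi> r)"
    unfolding bulkq_def by (intro ci continuous_intros h phi)
  have I1: "set_integrable lborel {1..R} c1"
    unfolding c1_def by (intro set_integral_add(1) i1 J1)
  have I2: "set_integrable lborel {1..R} c2"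
    unfolding c2_def by (intro set_integral_add(1) set_integrable_mult_left impI i3 ci continuous_intros h phi)
  have I3: "set_integrable lborel {1..R} c3"
    unfolding c3_def by (intro ci continuous_intros h phi)
  have I4: "set_integrable lborel {1..R} c4"
    unfolding c4_def by (intro ci continuous_intros h phi)
  define J where "J f = (LINT r:{1..R}|lborel. f r)" for f :: "real \<Rightarrow> real"
  have expand: "r^2 / 2 * (h' r + s * \<phi>' r)^2 + 3 * (h r + s * \<phi> r)^2
      + r^2 * (t / 8 * (1 - (h r + s * \<phi> r)^2)^2 + hplus t / 8 * (1 + 3 * (h r + s * \<phi> r)^4 - 4 * (h r + s * \<phi> r)^3))
      = c0 r + s * c1 r + s^2 * c2 r + s^3 * c3 r + s^4 * c4 r" for r s
    unfolding c0_def c1_def c2_def c3_def c4_def bulkF_def bulkq_def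
    by (simp add: power2_eq_square power3_eq_cube power4_eq_xxxx field_simps)
  have E: "Erad t R (\<lambda>r. h r + s * \<phi> r) (\<lambda>r. h' r + s * \<phi>' r)
      = J c0 + s * J c1 + s^2 * J c2 + s^3 * J c3 + s^4 * J c4" for s
    unfolding Erad_def expand J_def
    using I0 I1 I2 I3 I4 by (simp add: set_integral_add)
  have "J c1 = 0"
  proof (rule poly4_min_at_0[of "J c0" _ "J c2" "J c3" "J c4"])
    fix s
    have "adm_h R (\<lambda>r. h r + s * \<phi> r) (\<lambda>r. h' r + s * \<phi>' r)"
    proof (rule adm_hI)
      show ig: "set_integrable lborel {1..R} (\<lambda>r. h' r + s * \<phi>' r)"
        using ih(1) i2 by (simp add: set_integral_add)
      then show "set_borel_measurable lborel {1..R} (\<lambda>r. h' r + s * \<phi>' r)"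
        by (auto simp: set_borel_measurable_def set_integrable_def)
      have "set_integrable lborel {1..R} (\<lambda>r. r^2 * (h' r)^2 + (2 * s) * (r^2 * h' r * \<phi>' r) + s^2 * (r^2 * (\<phi>' r)^2))"
        using ih(2) i1 i3 by (simp add: set_integral_add)
      then show "set_integrable lborel {1..R} (\<lambda>r. r^2 * (h' r + s * \<phi>' r)^2)"
        by (simp add: power2_eq_square algebra_simps)
      show "continuous_on {1..R} (\<lambda>r. h r + s * \<phi> r)" by (intro continuous_intros h phi)
      show "((\<lambda>r. h' r + s * \<phi>' r) has_integral h r + s * \<phi> r - (h 1 + s * \<phi> 1)) {1..r}"
        if "1 \<le> r" "r \<le> R" for r
        using has_integral_add[OF adm_h_has_integral[OF adm, of 1 r] has_integral_mult_right[OF phi(4)[OF that], of s]] that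
        by (simp add: phi algebra_simps)
    qed (use ih phi in auto)
    from min[OF this] E[of s] E[of 0]
    show "J c0 \<le> J c0 + s * J c1 + s^2 * J c2 + s^3 * J c3 + s^4 * J c4" by simp
  qed
  then show "(LINT r:{1..R}|lborel. r^2 * h' r * \<phi>' r) + (LINT r:{1..R}|lborel. (6 + r^2 * bulkq t (h r)) * h r * \<phi> r) = 0"
    unfolding J_def c1_def by (simp add: set_integral_add[OF i1 J1])
qed

text \<open>Testing the first variation with the Green function \<open>\<phi>\<close> of \<open>(r\<^sup>2 u')'\<close> with pole at \<open>\<rho>\<close> turns
  \<open>\<integral> r\<^sup>2 h' \<phi>'\<close> into \<open>h \<rho> - 1\<close>; the resulting integral equation gives regularity without du Bois-Reymond.\<close>

lemma radial_minimizer_Green: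
  assumes adm: "adm_h R h h'" and R: "1 < R"
    and min: "\<And>g g'. adm_h R g g' \<Longrightarrow> Erad t R h h' \<le> Erad t R g g'"
    and rho: "\<rho> \<in> {1..R}"
  defines "g \<equiv> \<lambda>r. (6 + r^2 * bulkq t (h r)) * h r"
  shows "h \<rho> = 1 - (integral {1..\<rho>} (\<lambda>r. g r * (1 - 1 / r)) + (1 - 1 / \<rho>) * integral {\<rho>..R} g
      - (1 - 1 / \<rho>) / (1 - 1 / R) * integral {1..R} (\<lambda>r. g r * (1 - 1 / r)))"
proof -
  have h: "continuous_on {1..R} h" by (rule adm_h_continuous[OF adm])
  have g: "continuous_on {1..R} g"
    unfolding g_def bulkq_def by (intro continuous_intros h)
  \<comment> \<open>Chosen so that \<phi> vanishes at \<open>R\<close>; it vanishes at 1 for any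
    value of \<kappa>.\<close>
  define \<kappa> where "\<kappa> = (1 - 1 / \<rho>) / (1 - 1 / R)"
  define \<phi> where "\<phi> r = (1 - 1 / min r \<rho>) - \<kappa> * (1 - 1 / r)" for r
  \<comment> \<open>Thus r^2 \<phi>' is the indicator of r <= \<rho> minus \<kappa>, and the
    integral of r^2 h' \<phi>' collapses to (h \<rho> - h 1) - \<kappa> (h R - h 1).\<close>
  define \<phi>' where "\<phi>' r = ((if r \<le> \<rho> then 1 else 0) - \<kappa>) / r^2" for r
  have \<phi>R: "\<phi> R = 0" using R rho by (auto simp: \<phi>_def \<kappa>_def min_def)
  have \<phi>1: "\<phi> 1 = 0" using rho by (auto simp: \<phi>_def)
  have cphi: "continuous_on {1..R} \<phi>"
    unfolding \<phi>_def using rho by (intro continuous_intros) auto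
  have FTC: "(\<phi>' has_integral \<phi> r) {1..r}" if r: "1 \<le> r" "r \<le> R" for r
  proof -
    have "(\<phi>' has_integral (\<phi> r - \<phi> 1)) {1..r}"
    proof (rule fundamental_theorem_of_calculus_interior_strong[of "{\<rho>}"])
      show "continuous_on {1..r} \<phi>" using cphi r by (auto intro: continuous_on_subset)
      fix x assume x: "x \<in> {1<..<r} - {\<rho>}"
      have "(\<phi> has_real_derivative \<phi>' x) (at x)"
      proof (cases "x < \<rho>")
        case True
        have "((\<lambda>r. (1 - 1 / r) - \<kappa> * (1 - 1 / r)) has_real_derivative \<phi>' x) (at x)"
          using x True unfolding \<phi>'_def by (auto intro!: derivative_eq_intros simp: field_simps power2_eq_square)
        then show ?thesis
          by (rule has_field_derivative_transform_within_open[of _ _ _ "{..<\<rho>}"]) (use True in \<open>auto simp: \<phi>_def\<close>)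
      next
        case False
        have "((\<lambda>r. (1 - 1 / \<rho>) - \<kappa> * (1 - 1 / r)) has_real_derivative \<phi>' x) (at x)"
          using x False unfolding \<phi>'_def by (auto intro!: derivative_eq_intros simp: field_simps power2_eq_square)
        then show ?thesis
          by (rule has_field_derivative_transform_within_open[of _ _ _ "{\<rho><..}"]) (use False x in \<open>auto simp: \<phi>_def\<close>)
      qed
      then show "(\<phi> has_vector_derivative \<phi>' x) (at x)"
        by (simp add: has_real_derivative_iff_has_vector_derivative)
    qed (use r in auto)
    then show ?thesis by (simp add: \<phi>1)
  qed
  have mphi: "set_borel_measurable lborel {1..R} \<phi>'"
    unfolding set_borel_measurable_def \<phi>'_def by measurable
  have bphi: "\<bar>\<phi>' x\<bar> \<le> 1 + \<bar>\<kappa>\<bar>" if "x \<in> {1..R}" for x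
  proof -
    have "\<bar>\<phi>' x\<bar> = \<bar>(if x \<le> \<rho> then 1 else 0) - \<kappa>\<bar> / x^2"
      by (simp add: \<phi>'_def)
    also have "\<dots> \<le> \<bar>(if x \<le> \<rho> then 1 else 0) - \<kappa>\<bar> / 1"
      using that by (intro divide_left_mono) auto
    also have "\<dots> \<le> 1 + \<bar>\<kappa>\<bar>" by auto
    finally show ?thesis .
  qed
  note V = Erad_variation[OF adm R cphi mphi bphi FTC \<phi>1 \<phi>R min]
  have "(h' has_integral (h \<rho> - h 1)) {1..\<rho>}"
    using adm_h_has_integral[OF adm, of 1 \<rho>] rho by simp
  then have "((\<lambda>r. if r \<in> {1..\<rho>} then h' r else 0) has_integral (h \<rho> - h 1)) {1..R}"
    by (subst has_integral_restrict) (use rho in auto)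
  moreover have "(h' has_integral (h R - h 1)) {1..R}"
    using adm_h_has_integral[OF adm, of 1 R] R by simp
  ultimately have "((\<lambda>r. (if r \<in> {1..\<rho>} then h' r else 0) - \<kappa> * h' r) has_integral (h \<rho> - h 1) - \<kappa> * (h R - h 1)) {1..R}"
    by (intro has_integral_diff has_integral_mult_right)
  then have "((\<lambda>r. r^2 * h' r * \<phi>' r) has_integral (h \<rho> - h 1) - \<kappa> * (h R - h 1)) {1..R}"
    by (rule has_integral_eq[rotated]) (auto simp: \<phi>'_def field_simps)
  then have "(LINT r:{1..R}|lborel. r^2 * h' r * \<phi>' r) = h \<rho> - 1"
    using set_borel_integral_eq_integral(2)[OF V(1)] adm by (simp add: integral_unique adm_h_def)
  moreover have "(LINT r:{1..R}|lborel. g r * \<phi> r) = integral {1..R} (\<lambda>r. g r * \<phi> r)"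
    by (intro set_borel_integral_eq_integral(2) set_integrable_continuous_Icc continuous_intros g cphi)
  ultimately have 1: "h \<rho> = 1 - integral {1..R} (\<lambda>r. g r * \<phi> r)"
    using V(2) unfolding g_def by simp
  have cg: "continuous_on {1..R} (\<lambda>r. g r * (1 - 1 / r))"
    by (intro continuous_intros g) auto
  have i: "(\<lambda>r. g r * (1 - 1 / min r \<rho>)) integrable_on {1..R}"
    by (intro integrable_continuous_interval continuous_intros g) (use rho in auto)
  have "integral {1..R} (\<lambda>r. g r * \<phi> r)
     = integral {1..R} (\<lambda>r. g r * (1 - 1 / min r \<rho>) - \<kappa> * (g r * (1 - 1 / r)))"
    by (intro integral_cong) (simp add: \<phi>_def algebra_simps)
  also have "\<dots> = integral {1..R} (\<lambda>r. g r * (1 - 1 / min r \<rho>)) - \<kappa> * integral {1..R} (\<lambda>r. g r * (1 - 1 / r))"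
    by (subst integral_diff[OF i]) (auto intro!: integrable_continuous_interval continuous_on_mult_left cg)
  also have "integral {1..R} (\<lambda>r. g r * (1 - 1 / min r \<rho>))
      = integral {1..\<rho>} (\<lambda>r. g r * (1 - 1 / min r \<rho>)) + integral {\<rho>..R} (\<lambda>r. g r * (1 - 1 / min r \<rho>))"
    by (rule Henstock_Kurzweil_Integration.integral_combine[symmetric, OF _ _ i]) (use rho in auto)
  also have "integral {1..\<rho>} (\<lambda>r. g r * (1 - 1 / min r \<rho>)) = integral {1..\<rho>} (\<lambda>r. g r * (1 - 1 / r))"
    by (intro integral_cong) (auto simp: min_def)
  also have "integral {\<rho>..R} (\<lambda>r. g r * (1 - 1 / min r \<rho>)) = integral {\<rho>..R} (\<lambda>r. (1 - 1 / \<rho>) * g r)"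
    by (intro integral_cong) (auto simp: min_def)
  also have "\<dots> = (1 - 1 / \<rho>) * integral {\<rho>..R} g" by simp
  finally show ?thesis using 1 by (simp add: \<kappa>_def)
qed

text \<open>In the Green representation \<open>h\<close> occurs on the right only inside integrals
  of continuous functions, which makes it C^1, and then C^2, on the closed interval. The derivatives
  are one-sided at the two end points.\<close>

lemma radial_minimizer_regular:
  assumes adm: "adm_h R h h'" and R: "1 < R"
    and min: "\<And>g g'. adm_h R g g' \<Longrightarrow> Erad t R h h' \<le> Erad t R g g'"
  obtains h1 where
    "\<And>r. r \<in> {1..R} \<Longrightarrow> (h has_real_derivative h1 r) (at r within {1..R})"
    "\<And>r. r \<in> {1..R} \<Longrightarrow> (h1 has_real_derivative ((6 / r^2 + bulkq t (h r)) * h r - 2 * h1 r / r)) (at r within {1..R})"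
proof -
  define g where "g r = (6 + r^2 * bulkq t (h r)) * h r" for r
  define A where "A \<rho> = integral {1..\<rho>} (\<lambda>r. g r * (1 - 1 / r))" for \<rho>
  define B where "B \<rho> = integral {1..\<rho>} g" for \<rho>
  have h: "continuous_on {1..R} h" by (rule adm_h_continuous[OF adm])
  have g: "continuous_on {1..R} g"
    unfolding g_def bulkq_def by (intro continuous_intros h)
  have cg: "continuous_on {1..R} (\<lambda>r. g r * (1 - 1 / r))"
    by (intro continuous_intros g) auto
  have dA: "(A has_real_derivative g r * (1 - 1 / r)) (at r within {1..R})" if "r \<in> {1..R}" for r
    unfolding A_def by (rule integral_has_real_derivative[OF cg that])
  have dB: "(B has_real_derivative g r) (at r within {1..R})" if "r \<in> {1..R}" for r
    unfolding B_def by (rule integral_has_real_derivative[OF g that])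
  define C where "C = A R / (1 - 1 / R)"
  have rep: "h r = 1 - (A r + (1 - 1 / r) * (B R - B r) - (1 - 1 / r) * C)" if r: "r \<in> {1..R}" for r
  proof -
    have "B r + integral {r..R} g = B R"
      unfolding B_def by (rule Henstock_Kurzweil_Integration.integral_combine)
        (use r integrable_continuous_interval[OF g] in auto)
    then show ?thesis
      using radial_minimizer_Green[OF adm R min r, folded g_def] unfolding A_def C_def by simp
  qed
  \<comment> \<open>In the derivative of the representation the two terms containing
    \<open>g\<close> cancel. What is left gives r^2 h1 = B r + C - B R with derivative
    \<open>g\<close>, the divergence form of the equation.\<close>
  define h1 where "h1 r = (B r + C - B R) / r^2" for r
  have "(h has_real_derivative h1 r) (at r within {1..R})" if r: "r \<in> {1..R}" for r
  proof (rule has_field_derivative_transform_within[OF _ zero_less_one r])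
    show "((\<lambda>r. 1 - (A r + (1 - 1 / r) * (B R - B r) - (1 - 1 / r) * C)) has_real_derivative h1 r) (at r within {1..R})"
      using r unfolding h1_def
      by (auto intro!: derivative_eq_intros dA dB simp: field_simps power2_eq_square)
  qed (use rep in auto)
  moreover have "(h1 has_real_derivative ((6 / r^2 + bulkq t (h r)) * h r - 2 * h1 r / r)) (at r within {1..R})"
    if r: "r \<in> {1..R}" for r
    unfolding h1_def using r
    by (auto intro!: derivative_eq_intros dB) (simp add: g_def field_simps power2_eq_square power4_eq_xxxx)
  ultimately show ?thesis using that by blast
qed

text \<open>If D were negative, \<open>f1\<close> would be negative just to the right of
  \<open>c\<close>, and the mean value theorem would push \<open>f\<close> below its minimum. Only
  the derivative of \<open>f1\<close> at \<open>c\<close> itself is used, so no continuity of a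
  second derivative has to be supplied.\<close>

lemma second_derivative_at_min:
  fixes f f1 :: "real \<Rightarrow> real"
  assumes f: "\<And>r. r \<in> {a..b} \<Longrightarrow> (f has_real_derivative f1 r) (at r within {a..b})"
    and f1: "(f1 has_real_derivative D) (at c within {a..b})"
    and c: "a < c" "c < b" and min: "\<And>r. r \<in> {a..b} \<Longrightarrow> f c \<le> f r"
  shows "f1 c = 0" "D \<ge> 0"
proof -
  have f': "(f has_real_derivative f1 r) (at r)" if "a < r" "r < b" for r
    using f[of r] that by (simp add: at_within_Icc_at)
  show 0: "f1 c = 0"
    by (rule DERIV_local_min[OF f'[OF c], of "min (c - a) (b - c)"]) (use c min in \<open>auto simp: abs_if split: if_splits\<close>)
  show "D \<ge> 0"
  proof (rule ccontr)
    assume "\<not> D \<ge> 0"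
    then obtain d where d: "d > 0" "\<And>e. 0 < e \<Longrightarrow> e < d \<Longrightarrow> f1 (c + e) < f1 c"
      using DERIV_neg_dec_right[of f1 D c] f1 c by (auto simp: at_within_Icc_at)
    define e where "e = min (d / 2) ((b - c) / 2)"
    have e: "0 < e" "e < d" "c + e < b" using d(1) c by (auto simp: e_def min_def field_simps)
    obtain z where z: "c < z" "z < c + e" "f (c + e) - f c = (c + e - c) * f1 z"
      using MVT2[of c "c + e" f f1] f' e c by force
    have "f1 z < 0" using d(2)[of "z - c"] z e 0 by simp
    then have "f (c + e) < f c" using z(3) e(1) by (smt (verit) mult_pos_neg)
    then show False using min[of "c + e"] e c by simp
  qed
qed

text \<open>Reflecting \<open>h\<close> on a maximal interval where it is negative changes the energy by
  \<open>\<integral> r\<^sup>2 hplus t h\<^sup>3 < 0\<close>.\<close>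

lemma radial_minimizer_nonneg:
  assumes adm: "adm_h R h h'" and R: "1 < R" and t: "t \<ge> 0"
    and min: "\<And>g g'. adm_h R g g' \<Longrightarrow> Erad t R h h' \<le> Erad t R g g'"
    and r: "r \<in> {1..R}"
  shows "h r \<ge> 0"
proof (rule ccontr)
  assume neg: "\<not> h r \<ge> 0"
  have h: "continuous_on {1..R} h" by (rule adm_h_continuous[OF adm])
  have ih: "set_integrable lborel {1..R} h'" "set_integrable lborel {1..R} (\<lambda>r. r^2 * (h' r)^2)"
     "set_borel_measurable lborel {1..R} h'" "h 1 = 1" "h R = 1"
    using adm by (auto simp: adm_h_def)
  define Z where "Z = {x \<in> {1..R}. h x = 0}"
  have "compact Z"
  proof -
    have "closed ({1..R} \<inter> h -` {0})"
      by (rule continuous_closed_preimage[OF h]) auto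
    moreover have "{1..R} \<inter> h -` {0} = Z" by (auto simp: Z_def)
    ultimately show ?thesis
      using compact_Icc[of 1 R] by (metis Z_def compact_Int_closed inf.absorb_iff2 inf_commute mem_Collect_eq subsetI)
  qed
  obtain z1 where z1: "1 \<le> z1" "z1 \<le> r" "h z1 = 0"
    using IVT2'[of h r 0 1] neg ih(4) r continuous_on_subset[OF h, of "{1..r}"] by auto
  obtain z2 where z2: "r \<le> z2" "z2 \<le> R" "h z2 = 0"
    using IVT'[of h r 0 R] neg ih(5) r continuous_on_subset[OF h, of "{r..R}"] by auto
  have "z1 \<in> Z \<inter> {1..r}" "z2 \<in> Z \<inter> {r..R}"
    using z1 z2 r by (auto simp: Z_def)
  then have "Z \<inter> {1..r} \<noteq> {}" "Z \<inter> {r..R} \<noteq> {}" by blast+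
  \<comment> \<open>The last zero of \<open>h\<close> before \<open>r\<close> and the first one
    after it; both exist because the zero set is compact and \<open>h\<close> equals 1 at both ends
    of the interval.\<close>
  then obtain a b where a: "a \<in> Z \<inter> {1..r}" "\<And>x. x \<in> Z \<inter> {1..r} \<Longrightarrow> x \<le> a"
    and b: "b \<in> Z \<inter> {r..R}" "\<And>x. x \<in> Z \<inter> {r..R} \<Longrightarrow> b \<le> x"
    using compact_attains_sup[OF compact_Int_closed[OF \<open>compact Z\<close> closed_atLeastAtMost]]
      compact_attains_inf[OF compact_Int_closed[OF \<open>compact Z\<close> closed_atLeastAtMost]]
    by metis
  have ab: "1 \<le> a" "a < r" "r < b" "b \<le> R" "h a = 0" "h b = 0"
    using a(1) b(1) neg by (auto simp: Z_def less_le)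
  have hneg: "h x < 0" if x: "a < x" "x < b" for x
  proof (rule ccontr)
    assume "\<not> h x < 0"
    show False
    proof (cases "x \<le> r")
      case True
      obtain y where "x \<le> y" "y \<le> r" "h y = 0"
        using IVT2'[of h r 0 x] neg \<open>\<not> h x < 0\<close> True ab x continuous_on_subset[OF h, of "{x..r}"] r by auto
      then show False using a(2)[of y] x ab r by (auto simp: Z_def)
    next
      case False
      obtain y where "r \<le> y" "y \<le> x" "h y = 0"
        using IVT'[of h r 0 x] neg \<open>\<not> h x < 0\<close> False ab x continuous_on_subset[OF h, of "{r..x}"] r by auto
      then show False using b(2)[of y] x ab r by (auto simp: Z_def)
    qed
  qed
  \<comment> \<open>Since \<open>h\<close> vanishes at \<open>a\<close> and at \<open>b\<close>,
    flipping its sign in between creates no jump.\<close>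
  define \<sigma> where "\<sigma> x = (if x \<in> {a..b} then - 1 else 1 :: real)" for x
  have sb: "set_borel_measurable lborel {1..R} \<sigma>"
    unfolding set_borel_measurable_def \<sigma>_def by measurable
  have sq: "(\<sigma> x)\<^sup>2 = 1" for x by (simp add: \<sigma>_def)
  have A: "adm_h R (\<lambda>x. \<sigma> x * h x) (\<lambda>x. \<sigma> x * h' x)"
  proof (rule adm_hI)
    show "set_borel_measurable lborel {1..R} (\<lambda>x. \<sigma> x * h' x)"
      by (rule set_borel_measurable_times[OF sb ih(3)])
    show "set_integrable lborel {1..R} (\<lambda>x. \<sigma> x * h' x)"
      by (rule set_integrable_bounded_mult[OF ih(1) sb, of 1]) (simp add: \<sigma>_def)
    show "set_integrable lborel {1..R} (\<lambda>r. r\<^sup>2 * (\<sigma> r * h' r)\<^sup>2)"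
      using ih(2) by (simp add: power_mult_distrib sq)
    have "(\<sigma> 1 * h 1 = 1) \<and> (\<sigma> R * h R = 1)"
      using ih(4,5) ab less_le[of 1 a] less_le[of b R] by (auto simp: \<sigma>_def)
    then show "\<sigma> 1 * h 1 = 1" "\<sigma> R * h R = 1" by auto
    show FTC: "((\<lambda>x. \<sigma> x * h' x) has_integral \<sigma> c * h c - \<sigma> 1 * h 1) {1..c}" if c: "1 \<le> c" "c \<le> R" for c
    proof -
      have H: "(h' has_integral (h c - h 1)) {1..c}"
        using adm_h_has_integral[OF adm, of 1 c] c by simp
      have s1: "\<sigma> 1 * h 1 = h 1" using \<open>_ \<and> _\<close> ih by simp
      show ?thesis
      proof (cases "c < a")
        case True
        then show ?thesis
          unfolding s1 by (intro has_integral_eq[OF _ H, THEN has_integral_eq_rhs]) (auto simp: \<sigma>_def)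
      next
        case False
        have "(h' has_integral (h (min c b) - h a)) {a..min c b}"
          using adm_h_has_integral[OF adm, of a "min c b"] False ab c by auto
        then have "((\<lambda>x. if x \<in> {a..min c b} then h' x else 0) has_integral (h (min c b) - h a)) {1..c}"
          by (subst has_integral_restrict) (use ab in auto)
        then have "((\<lambda>x. h' x - 2 * (if x \<in> {a..min c b} then h' x else 0)) has_integral (h c - h 1) - 2 * (h (min c b) - h a)) {1..c}"
          by (intro has_integral_diff has_integral_mult_right H)
        then have "((\<lambda>x. \<sigma> x * h' x) has_integral (h c - h 1) - 2 * (h (min c b) - h a)) {1..c}"
          by (rule has_integral_eq[rotated]) (auto simp: \<sigma>_def)
        moreover have "(h c - h 1) - 2 * (h (min c b) - h a) = \<sigma> c * h c - \<sigma> 1 * h 1"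
          unfolding s1 using False ab by (auto simp: \<sigma>_def min_def)
        ultimately show ?thesis by simp
      qed
    qed
    have io: "(\<lambda>x. \<sigma> x * h' x) integrable_on {1..R}" using FTC[of R] R by (auto simp: integrable_on_def)
    \<comment> \<open>Continuity is read off from the indefinite integral, so nothing has to be
      glued at \<open>a\<close> and \<open>b\<close>.\<close>
    show "continuous_on {1..R} (\<lambda>x. \<sigma> x * h x)"
    proof (rule continuous_on_eq)
      show "continuous_on {1..R} (\<lambda>c. \<sigma> 1 * h 1 + integral {1..c} (\<lambda>x. \<sigma> x * h' x))"
        by (intro continuous_on_add continuous_on_const indefinite_integral_continuous_1[OF io])
      show "\<sigma> 1 * h 1 + integral {1..c} (\<lambda>x. \<sigma> x * h' x) = \<sigma> c * h c" if "c \<in> {1..R}" for c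
        using integral_unique[OF FTC[of c]] that by simp
    qed
  qed
  define D where "D x = (if x \<in> {a..b} then x^2 * hplus t * (h x)^3 else 0)" for x
  have iab: "set_integrable lborel {a..b} (\<lambda>x. x^2 * hplus t * (h x)^3)"
    by (intro set_integrable_continuous_Icc continuous_intros continuous_on_subset[OF h]) (use ab in auto)
  have indD: "indicator {1..R} x *\<^sub>R D x = indicator {a..b} x *\<^sub>R (x^2 * hplus t * (h x)^3)" for x
    using ab by (auto simp: D_def indicator_def)
  have iD: "set_integrable lborel {1..R} D"
    using iab unfolding set_integrable_def indD .
  define e where "e x = (x^2 * (h' x)^2) * (1/2) + (3 * (h x)^2 + x^2 * bulkF t (h x))" for x
  have ie: "set_integrable lborel {1..R} e"
    unfolding e_def bulkF_def
    by (intro set_integral_add(1) set_integrable_mult_left impI ih set_integrable_continuous_Icc continuous_intros h)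
  have "Erad t R (\<lambda>x. \<sigma> x * h x) (\<lambda>x. \<sigma> x * h' x) = (LINT x:{1..R}|lborel. e x + D x)"
    unfolding Erad_def
  proof (intro arg_cong[where f="\<lambda>f. set_lebesgue_integral lborel {1..R} f"] ext)
    fix x
    show "x\<^sup>2 / 2 * (\<sigma> x * h' x)\<^sup>2 + 3 * (\<sigma> x * h x)\<^sup>2 +
         x\<^sup>2 * (t / 8 * (1 - (\<sigma> x * h x)\<^sup>2)\<^sup>2 + hplus t / 8 * (1 + 3 * (\<sigma> x * h x) ^ 4 - 4 * (\<sigma> x * h x) ^ 3)) = e x + D x"
      by (simp add: \<sigma>_def D_def e_def bulkF_def power_mult_distrib algebra_simps)
  qed
  moreover have "Erad t R h h' = (LINT x:{1..R}|lborel. e x)"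
    unfolding Erad_def e_def bulkF_def by (simp add: add_ac mult_ac)
  ultimately have "Erad t R (\<lambda>x. \<sigma> x * h x) (\<lambda>x. \<sigma> x * h' x) = Erad t R h h' + (LINT x:{1..R}|lborel. D x)"
    using ie iD by (simp add: set_integral_add)
  with min[OF A] have "0 \<le> (LINT x:{1..R}|lborel. D x)" by simp
  also have "(LINT x:{1..R}|lborel. D x) = integral {a..b} (\<lambda>x. x^2 * hplus t * (h x)^3)"
    using set_borel_integral_eq_integral(2)[OF iab] unfolding set_lebesgue_integral_def indD .
  also have "\<dots> < integral {a..b} (\<lambda>x. 0)"
  proof (rule integral_less_real)
    show "continuous_on {a..b} (\<lambda>x. x^2 * hplus t * (h x)^3)"
      by (intro continuous_intros continuous_on_subset[OF h]) (use ab in auto)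
    show "{a<..<b} \<noteq> {}" using ab by auto
    show "x^2 * hplus t * (h x)^3 < 0" if "x \<in> {a<..<b}" for x
      using hneg[of x] that ab hplus_ge[OF t] by (auto intro!: mult_pos_neg mult_pos_pos simp: power_less_zero_eq)
  qed auto
  finally show False by simp
qed

lemma bulkq_mono:
  assumes "t \<ge> 0" "1 / 2 \<le> x" "x \<le> y"
  shows "bulkq t x \<le> bulkq t y"
proof -
  have "x^2 \<le> y^2" using assms by (intro power_mono) auto
  moreover have "x^2 - x \<le> y^2 - y"
  proof -
    have "0 \<le> (y - x) * (x + y - 1)" using assms by (intro mult_nonneg_nonneg) auto
    then show ?thesis by (simp add: power2_eq_square algebra_simps)
  qed
  ultimately show ?thesis
    using assms hplus_ge[OF assms(1)] unfolding bulkq_def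
    by (intro add_mono mult_left_mono) auto
qed

lemma bulkq_pos:
  assumes "t \<ge> 0" "x > 1" shows "bulkq t x \<ge> 0"
  using bulkq_mono[OF assms(1), of 1 x] assms by (simp add: bulkq_def)

lemma bulkq_nonpos:
  assumes "t \<ge> 0" "0 \<le> x" "x \<le> 1" shows "bulkq t x \<le> 0"
proof -
  have "x^2 \<le> x" "x^2 \<le> 1" using assms by (auto simp: power2_eq_square mult_left_le_one_le mult_le_one)
  then show ?thesis using assms hplus_ge[OF assms(1)]
    unfolding bulkq_def by (intro add_nonpos_nonpos mult_nonneg_nonpos) auto
qed

lemma eta_boundary: "1 < R \<Longrightarrow> eta R 1 = 1" "1 < R \<Longrightarrow> eta R R = 1"
proof -
  assume R: "1 < R"
  have "1 < R^5" by (rule one_less_power[OF R]) simp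
  then have D: "R^5 - 1 \<noteq> 0" by linarith
  have "(R^3 - 1) + (R^2 - 1) * R^3 = R^5 - 1" "(R^3 - 1) * R^2 + (R^2 - 1) = R^5 - 1"
    by (simp_all add: algebra_simps flip: power_add)
  then show "eta R 1 = 1" "eta R R = 1"
    using D R by (simp_all add: eta_def)
qed

text \<open>Three maximum principles, each read off from the equation at an interior extremum. An
  interior maximum above 1 is impossible, since there \<open>bulkq\<close> is nonnegative and the
  equation makes h'' positive. Together with nonnegativity this yields
  \<open>bulkq t (h r) <= 0\<close>, the sign on which the comparison with \<open>eta\<close> rests;
  the lower bound for \<open>bulkq\<close> comes last because its monotonicity requires h >=
  1/2.\<close>

lemma radial_minimizer_bounds:
  assumes min: "radial_minimizer t R h" and R: "1 < R" and t: "t \<ge> 0"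
    and eta: "\<And>r. r \<in> {1..R} \<Longrightarrow> eta R r \<ge> 2 / 3"
  obtains h1 where "\<And>r. r \<in> {1..R} \<Longrightarrow> (h has_real_derivative h1 r) (at r within {1..R})"
    "continuous_on {1..R} h1"
    "\<And>r. r \<in> {1..R} \<Longrightarrow> 2 / 3 \<le> h r \<and> h r \<le> 1 \<and> - 6 \<le> bulkq t (h r)"
proof -
  obtain h' where adm: "adm_h R h h'" and mn: "\<And>g g'. adm_h R g g' \<Longrightarrow> Erad t R h h' \<le> Erad t R g g'"
    using min unfolding radial_minimizer_def by blast
  obtain h1 where d1: "\<And>r. r \<in> {1..R} \<Longrightarrow> (h has_real_derivative h1 r) (at r within {1..R})"
    and d2: "\<And>r. r \<in> {1..R} \<Longrightarrow> (h1 has_real_derivative ((6 / r^2 + bulkq t (h r)) * h r - 2 * h1 r / r)) (at r within {1..R})"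
    using radial_minimizer_regular[OF adm R mn] by metis
  have h: "continuous_on {1..R} h" by (rule adm_h_continuous[OF adm])
  have bd: "h 1 = 1" "h R = 1" using adm by (auto simp: adm_h_def)
  have ne: "{1..R} \<noteq> {}" using R by auto
  have nonneg: "h r \<ge> 0" if "r \<in> {1..R}" for r
    by (rule radial_minimizer_nonneg[OF adm R t mn that])
  have le1: "h r \<le> 1" if r: "r \<in> {1..R}" for r
  proof -
    obtain c where c: "c \<in> {1..R}" "\<And>r. r \<in> {1..R} \<Longrightarrow> h r \<le> h c"
      using continuous_attains_sup[OF compact_Icc ne h] by blast
    have "h c \<le> 1"
    proof (rule ccontr)
      assume hc: "\<not> h c \<le> 1"
      then have c': "1 < c" "c < R" using c(1) bd by (auto simp: less_le)
      have D: "- h1 c = 0" "0 \<le> - ((6 / c^2 + bulkq t (h c)) * h c - 2 * h1 c / c)"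
        by (rule second_derivative_at_min[of 1 R "\<lambda>r. - h r" "\<lambda>r. - h1 r", OF DERIV_minus[OF d1] DERIV_minus[OF d2[OF c(1)]] c'];
            use c in auto)+
      have "6 / c^2 + bulkq t (h c) > 0"
        using bulkq_pos[OF t, of "h c"] hc c' by (intro add_pos_nonneg) auto
      then have "(6 / c^2 + bulkq t (h c)) * h c > 0"
        using hc by (intro mult_pos_pos) auto
      then show False using D by simp
    qed
    then show ?thesis using c(2)[OF r] by simp
  qed
  \<comment> \<open>r^2 and 1/r^3 span the solutions of f'' + 2 f'/r = 6 f/r^2; \<open>eta R\<close>
    is the combination equal to 1 at both ends.\<close>
  define \<alpha> \<beta> where "\<alpha> = (R^3 - 1) / (R^5 - 1)" and "\<beta> = (R^2 - 1) * R^3 / (R^5 - 1)"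
  have eta_eq: "eta R r = \<alpha> * r^2 + \<beta> / r^3" for r
    by (simp add: eta_def \<alpha>_def \<beta>_def power_divide distrib_left)
  have ge: "h r \<ge> eta R r" if r: "r \<in> {1..R}" for r
  proof -
    let ?w = "\<lambda>r. h r - (\<alpha> * r^2 + \<beta> / r^3)"
    let ?w1 = "\<lambda>r. h1 r - (2 * \<alpha> * r - 3 * \<beta> / r^4)"
    have "continuous_on {1..R} ?w" by (intro continuous_intros h) auto
    then obtain c where c: "c \<in> {1..R}" "\<And>r. r \<in> {1..R} \<Longrightarrow> ?w c \<le> ?w r"
      using continuous_attains_inf[OF compact_Icc ne] by blast
    have "?w c \<ge> 0"
    proof (rule ccontr)
      assume wc: "\<not> ?w c \<ge> 0"
      \<comment> \<open>\<open>h\<close> and \<open>eta R\<close> agree at 1 and at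
        \<open>R\<close>, so a negative minimum of the difference is interior.\<close>
      have c': "1 < c" "c < R" using c(1) bd wc eta_boundary[OF R] unfolding eta_eq[symmetric] by (auto simp: less_le)
      have W: "(?w has_real_derivative ?w1 r) (at r within {1..R})" if "r \<in> {1..R}" for r
        using that by (auto intro!: derivative_eq_intros d1 simp: field_simps power2_eq_square power3_eq_cube power4_eq_xxxx)
      have e: "((\<lambda>r. 2 * \<alpha> * r - 3 * \<beta> / r^4) has_real_derivative (2 * \<alpha> + 12 * \<beta> / c^5)) (at c within {1..R})"
        using c' by (auto intro!: derivative_eq_intros) (simp add: field_simps power3_eq_cube power4_eq_xxxx power_numeral_reduce)
      note D = second_derivative_at_min[OF W DERIV_diff[OF d2[OF c(1)] e] c' c(2)]
      \<comment> \<open>The difference of the two equations: w'' = 6/c^2 w +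
        \<open>bulkq t (h c) * h c\<close> - 2/c w'. At the minimum w' = 0, while the first term is
        negative and the second nonpositive.\<close>
      have "((6 / c^2 + bulkq t (h c)) * h c - 2 * h1 c / c) - (2 * \<alpha> + 12 * \<beta> / c^5)
          = 6 / c^2 * ?w c + bulkq t (h c) * h c - 2 / c * ?w1 c"
        using c' by (simp add: field_simps power2_eq_square power3_eq_cube power4_eq_xxxx power_numeral_reduce)
      moreover have "6 / c^2 * ?w c < 0"
        using wc c' by (intro mult_pos_neg) auto
      moreover have "bulkq t (h c) * h c \<le> 0"
        using bulkq_nonpos[OF t nonneg[OF c(1)] le1[OF c(1)]] nonneg[OF c(1)] by (rule mult_nonpos_nonneg)
      ultimately show False using D by simp
    qed
    then show ?thesis using c(2)[OF r] by (simp add: eta_eq)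
  qed
  have q: "- 6 \<le> bulkq t (h r)" if r: "r \<in> {1..R}" for r
  proof -
    obtain c where c: "c \<in> {1..R}" "\<And>r. r \<in> {1..R} \<Longrightarrow> h c \<le> h r"
      using continuous_attains_inf[OF compact_Icc ne h] by blast
    have hc: "h c \<ge> 2 / 3" using ge[OF c(1)] eta[OF c(1)] by simp
    have "- 6 \<le> bulkq t (h c)"
    proof (cases "c = 1 \<or> c = R")
      case True
      then have "h c = 1" using bd by auto
      then show ?thesis by (simp add: bulkq_def)
    next
      case False
      then have c': "1 < c" "c < R" using c(1) by auto
      note D = second_derivative_at_min[OF d1 d2[OF c(1)] c' c(2)]
      have "0 \<le> (6 / c^2 + bulkq t (h c)) * h c" using D by simp
      then have "0 \<le> 6 / c^2 + bulkq t (h c)" using hc by (simp add: zero_le_mult_iff)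
      moreover have "6 / c^2 \<le> 6" using c' by (simp add: divide_le_eq)
      ultimately show ?thesis by simp
    qed
    also have "\<dots> \<le> bulkq t (h r)"
      using bulkq_mono[OF t _ c(2)[OF r]] hc by simp
    finally show ?thesis .
  qed
  have "continuous_on {1..R} h1"
    using d2 by (intro DERIV_continuous_on)
  moreover have "2 / 3 \<le> h r \<and> h r \<le> 1 \<and> - 6 \<le> bulkq t (h r)" if "r \<in> {1..R}" for r
    using q[OF that] le1[OF that] ge[OF that] eta[OF that] by simp
  ultimately show ?thesis using that d1 by blast
qed

section \<open>Pointwise algebra of the bulk density and its second variation\<close>

lemma sqn_eq_norm: "sqn Q = (norm Q)\<^sup>2"
  unfolding sqn_def power2_norm_eq_inner inner_vec_def by (simp add: power2_eq_square)

lemma sqg_eq_norm: "sqg G = (norm G)\<^sup>2"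
  unfolding sqg_def power2_norm_eq_inner inner_vec_def by (simp add: power2_eq_square)

definition tensor :: "pt \<Rightarrow> pt \<Rightarrow> qmat" where
  "tensor a b = (\<chi> i j. a $ i * b $ j)"

lemma tensor_inner: "tensor a b \<bullet> tensor c d = (a \<bullet> c) * (b \<bullet> d)"
  by (simp add: tensor_def inner_vec_def sum_product mult_ac)

lemma inner_tensor: "A \<bullet> tensor a b = a \<bullet> (A *v b)"
  by (simp add: tensor_def inner_vec_def matrix_vector_mult_def sum_distrib_left mult_ac)

lemma inner_mat1: "(A::qmat) \<bullet> mat 1 = trace A"
  by (simp add: mat_def inner_vec_def trace_def sum_3)

lemma mat1_inner_mat1: "mat 1 \<bullet> (mat 1 :: qmat) = 3"
  unfolding inner_mat1 by (simp add: trace_def mat_def)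

lemma tensor_inner_mat1: "tensor a b \<bullet> mat 1 = a \<bullet> b" "mat 1 \<bullet> tensor a b = a \<bullet> b"
  by (simp_all add: inner_tensor inner_commute[of "tensor a b" "mat 1"])

lemma trace_mult_eq_inner: "trace ((A::qmat) ** B) = transpose A \<bullet> B"
  by (simp add: trace_def matrix_matrix_mult_def inner_vec_def transpose_def sum_3)

text \<open>Cyclicity of the trace merges the three positions of a single factor into one term,
  although the matrices need not commute.\<close>

lemma trace3_add_scaleR:
  fixes H V :: qmat
  shows "trace ((H + s *\<^sub>R V) ** (H + s *\<^sub>R V) ** (H + s *\<^sub>R V))
    = trace (H ** H ** H) + s * (3 * trace (H ** H ** V)) + s^2 * (3 * trace (H ** V ** V)) + s^3 * trace (V ** V ** V)"
  by (simp add: trace_def matrix_matrix_mult_def sum_3 algebra_simps power2_eq_square power3_eq_cube)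

text \<open>The coefficient of s^2 is half the bulk density of the second variation; it is the one
  that must be written out, to be bounded from below.\<close>

lemma bulk_expand:
  fixes H V :: qmat
  shows "bulk t (H + s *\<^sub>R V) = bulk t H
    + s * (- t / 2 * (1 - H \<bullet> H) * (H \<bullet> V) + hplus t / 8 * (12 * (H \<bullet> H) * (H \<bullet> V) - 12 * sqrt 6 * trace (H ** H ** V)))
    + s^2 * (t / 8 * (4 * (H \<bullet> V)^2 - 2 * (1 - H \<bullet> H) * (V \<bullet> V))
        + hplus t / 8 * (3 * (4 * (H \<bullet> V)^2 + 2 * (H \<bullet> H) * (V \<bullet> V)) - 12 * sqrt 6 * trace (H ** V ** V)))
    + s^3 * (t / 2 * (H \<bullet> V) * (V \<bullet> V) + hplus t / 8 * (12 * (H \<bullet> V) * (V \<bullet> V) - 4 * sqrt 6 * trace (V ** V ** V)))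
    + s^4 * (t / 8 * (V \<bullet> V)^2 + 3 * hplus t / 8 * (V \<bullet> V)^2)"
proof -
  have n: "(norm (H + s *\<^sub>R V))^2 = H \<bullet> H + 2 * s * (H \<bullet> V) + s^2 * (V \<bullet> V)"
    unfolding power2_norm_eq_inner
    by (simp add: inner_add_left inner_add_right inner_commute[of V H] power2_eq_square distrib_left)
  show ?thesis
    unfolding bulk_def sqn_eq_norm trace3_add_scaleR n power2_norm_eq_inner[of H]
    by (simp add: power2_eq_square power3_eq_cube power4_eq_xxxx field_simps)
qed

text \<open>The difference of the two sides is half the squared norm of the matrix \<open>X\<close>, i.e. of the block of \<open>V\<close>
  orthogonal to \<open>n\<close> made traceless in the plane orthogonal to \<open>n\<close>.\<close>

lemma S0_matrix_vector_bound:
  assumes V: "V \<in> S0" and n: "norm n = 1"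
  shows "(norm (V *v n))^2 \<le> (norm V)^2 / 2 + (n \<bullet> (V *v n))^2 / 4"
proof -
  define w where "w = V *v n"
  define p where "p = n \<bullet> w"
  have tr: "trace V = 0" and sym: "transpose V = V" using V by (auto simp: S0_def)
  have nn: "n \<bullet> n = 1" using n by (simp add: norm_eq_1)
  have nVw: "n \<bullet> (V *v w) = w \<bullet> w"
    by (metis dot_lmul_matrix sym transpose_matrix_vector w_def)
  have 1: "V \<bullet> tensor n w = w \<bullet> w" "V \<bullet> tensor w n = w \<bullet> w" "V \<bullet> tensor n n = p" "V \<bullet> mat 1 = 0"
    "tensor n w \<bullet> mat 1 = p" "tensor w n \<bullet> mat 1 = p" "tensor n n \<bullet> mat 1 = 1" "mat 1 \<bullet> (mat 1 :: qmat) = 3"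
    using tr nn nVw
    by (simp_all add: inner_tensor tensor_inner_mat1 mat1_inner_mat1 inner_mat1[of V] w_def[symmetric] p_def inner_commute[of w n])
  define X where "X = V - tensor n w - tensor w n + (p / 2) *\<^sub>R tensor n n + (p / 2) *\<^sub>R mat 1"
  have "X \<bullet> X = V \<bullet> V - 2 * (w \<bullet> w) + p^2 / 2"
    unfolding X_def
    by (simp add: inner_add_left inner_add_right inner_diff_left inner_diff_right 1 1[THEN trans[OF inner_commute]]
        tensor_inner nn p_def[symmetric] inner_commute[of w n] field_simps power2_eq_square)
  moreover have "X \<bullet> X \<ge> 0" by simp
  ultimately show ?thesis
    unfolding w_def[symmetric] p_def[symmetric] power2_norm_eq_inner by linarith
qed

text \<open>With w = V n and p = n . w, the right side exceeds
  \<open>bulkq t g * (V \<bullet> V)\<close> by the sum of (3/2) t g^2 p^2, 9 \<open>hplus t\<close>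
  g (|V|^2/2 + p^2/4 - |w|^2) and (9/2) \<open>hplus t\<close> g (g - 1/2) p^2. The middle term is
  nonnegative by \<open>S0_matrix_vector_bound\<close>. The p^2/4 borrowed for it is paid out of the
  g^2 p^2 contribution, and this is where g >= 1/2 enters.\<close>

lemma hedgehog_second_variation_density:
  assumes V: "V \<in> S0" and n: "norm n = 1" and g: "g \<ge> 1 / 2" and t: "t \<ge> 0"
    and H: "H = sqrt (3/2) *\<^sub>R (g *\<^sub>R (outer n - (1/3) *\<^sub>R mat 1))"
  shows "norm H = g"
    "bulkq t g * (V \<bullet> V) \<le> 2 * (t / 8 * (4 * (H \<bullet> V)^2 - 2 * (1 - H \<bullet> H) * (V \<bullet> V))
        + hplus t / 8 * (3 * (4 * (H \<bullet> V)^2 + 2 * (H \<bullet> H) * (V \<bullet> V)) - 12 * sqrt 6 * trace (H ** V ** V)))"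
proof -
  define w where "w = V *v n"
  define p where "p = n \<bullet> w"
  have tr: "trace V = 0" and sym: "transpose V = V" using V by (auto simp: S0_def)
  have nn: "n \<bullet> n = 1" using n by (simp add: norm_eq_1)
  have o: "outer n = tensor n n" by (simp add: outer_def tensor_def)
  have 0: "mat 1 \<bullet> (mat 1 :: qmat) = 3" "tensor n n \<bullet> mat 1 = 1" "mat 1 \<bullet> tensor n n = 1"
    using nn by (simp_all add: tensor_inner_mat1 mat1_inner_mat1)
  have s2: "sqrt (3/2) * (sqrt (3/2) * x) = 3/2 * x" for x
    by (simp flip: mult.assoc)
  have HH: "H \<bullet> H = g^2"
    unfolding H o using nn
    by (simp add: s2 inner_diff_left inner_diff_right 0 tensor_inner power2_eq_square)
  then show nH: "norm H = g"
    using g by (simp add: norm_eq_sqrt_inner)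
  have HV: "H \<bullet> V = sqrt (3/2) * g * p"
    unfolding H o
    by (simp add: inner_commute[of _ V] inner_diff_right inner_tensor inner_mat1 tr w_def[symmetric] p_def)
  have HV2: "(H \<bullet> V)^2 = 3/2 * g^2 * p^2"
    unfolding HV by (simp add: power_mult_distrib)
  have "transpose H = H"
    unfolding H by (simp add: outer_def mat_def transpose_def vec_eq_iff mult.commute)
  then have "trace (H ** V ** V) = H \<bullet> (V ** V)"
    by (simp add: trace_mult_eq_inner flip: matrix_mul_assoc)
  also have "\<dots> = sqrt (3/2) * g * (n \<bullet> ((V ** V) *v n) - 1 / 3 * trace (V ** V))"
    unfolding H o
    by (simp add: inner_commute[of _ "V ** V"] inner_diff_right inner_tensor inner_mat1)
  also have "trace (V ** V) = V \<bullet> V" by (simp add: trace_mult_eq_inner sym)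
  also have "n \<bullet> ((V ** V) *v n) = w \<bullet> w"
    by (metis dot_lmul_matrix matrix_vector_mul_assoc sym transpose_matrix_vector w_def)
  finally have T: "sqrt 6 * trace (H ** V ** V) = (sqrt 6 * sqrt (3/2)) * (g * (w \<bullet> w - 1 / 3 * (V \<bullet> V)))"
    by (simp add: mult_ac)
  have "sqrt 6 * sqrt (3/2) = sqrt (3^2)" unfolding real_sqrt_mult[symmetric] by simp
  also have "\<dots> = 3" by (rule real_sqrt_unique) auto
  finally have T': "sqrt 6 * trace (H ** V ** V) = 3 * g * (w \<bullet> w) - g * (V \<bullet> V)"
    unfolding T by (simp add: algebra_simps)
  have W: "w \<bullet> w \<le> (V \<bullet> V) / 2 + p^2 / 4"
    using S0_matrix_vector_bound[OF V n] by (simp add: w_def[symmetric] p_def power2_norm_eq_inner)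
  have "0 \<le> t * (3 / 2 * g^2 * p^2)" using t by simp
  moreover have "0 \<le> hplus t * (9 * g * ((V \<bullet> V) / 2 + p^2 / 4 - w \<bullet> w))"
    using hplus_ge[OF t] g W by (intro mult_nonneg_nonneg) auto
  moreover have "0 \<le> hplus t * (9 / 2 * g * (g - 1 / 2) * p^2)"
    using hplus_ge[OF t] g by (intro mult_nonneg_nonneg) auto
  moreover have "2 * (t / 8 * (4 * (H \<bullet> V)^2 - 2 * (1 - H \<bullet> H) * (V \<bullet> V))
        + hplus t / 8 * (3 * (4 * (H \<bullet> V)^2 + 2 * (H \<bullet> H) * (V \<bullet> V)) - 12 * sqrt 6 * trace (H ** V ** V)))
     = bulkq t g * (V \<bullet> V) + t * (3 / 2 * g^2 * p^2) + hplus t * (9 * g * ((V \<bullet> V) / 2 + p^2 / 4 - w \<bullet> w))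
      + hplus t * (9 / 2 * g * (g - 1 / 2) * p^2)"
    unfolding HV2 HH mult.assoc[of 12 "sqrt 6"] T' bulkq_def
    by (simp add: field_simps power2_eq_square)
  ultimately show "bulkq t g * (V \<bullet> V) \<le> 2 * (t / 8 * (4 * (H \<bullet> V)^2 - 2 * (1 - H \<bullet> H) * (V \<bullet> V))
        + hplus t / 8 * (3 * (4 * (H \<bullet> V)^2 + 2 * (H \<bullet> H) * (V \<bullet> V)) - 12 * sqrt 6 * trace (H ** V ** V)))"
    by linarith
qed

lemma trace3_bound: "\<bar>trace ((A::qmat) ** (B::qmat) ** (C::qmat))\<bar> \<le> 27 * (norm A * norm B * norm C)"
proof -
  have c: "\<bar>A $ i $ j\<bar> \<le> norm A" for A :: qmat and i j
    by (meson component_le_norm_cart Finite_Cartesian_Product.norm_nth_le order_trans)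
  have "\<bar>A $ i $ j * B $ j $ k * C $ k $ i\<bar> \<le> norm A * norm B * norm C" for i j k
    unfolding abs_mult by (intro mult_mono c) auto
  then have "(\<Sum>i\<in>(UNIV::3 set). \<Sum>k\<in>(UNIV::3 set). \<Sum>j\<in>(UNIV::3 set). \<bar>A $ i $ j * B $ j $ k * C $ k $ i\<bar>)
      \<le> (\<Sum>i\<in>(UNIV::3 set). \<Sum>k\<in>(UNIV::3 set). \<Sum>j\<in>(UNIV::3 set). norm A * norm B * norm C)"
    by (intro sum_mono)
  moreover have "\<bar>trace (A ** B ** C)\<bar> \<le> (\<Sum>i\<in>(UNIV::3 set). \<Sum>k\<in>(UNIV::3 set). \<Sum>j\<in>(UNIV::3 set). \<bar>A $ i $ j * B $ j $ k * C $ k $ i\<bar>)"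
    unfolding trace_def matrix_matrix_mult_def
    by (simp add: sum_distrib_right) (intro order_trans[OF sum_abs] sum_mono order.refl)
  ultimately show ?thesis by simp
qed

text \<open>What counts is the quartic growth, which makes the bulk energy of an L^4 field finite;
  the constants are generous.\<close>

lemma bulk_bound: "t \<ge> 0 \<Longrightarrow> \<bar>bulk t Q\<bar> \<le> (t + 200 * hplus t) * (1 + (norm Q)^4)"
proof -
  assume t: "t \<ge> 0"
  let ?y = "norm Q"
  have y: "?y^2 \<le> 1 + ?y^4" "?y^3 \<le> 1 + ?y^4"
  proof -
    have "0 \<le> (?y^2 - 1)^2" by simp
    then have 1: "2 * ?y^2 \<le> 1 + ?y^4" by (simp add: power2_diff power2_eq_square power4_eq_xxxx algebra_simps)
    then show "?y^2 \<le> 1 + ?y^4" using zero_le_power2[of ?y] by linarith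
    have "0 \<le> (?y^2 - ?y)^2" by simp
    then have "2 * ?y^3 \<le> ?y^4 + ?y^2" by (simp add: power2_diff power2_eq_square power3_eq_cube power4_eq_xxxx algebra_simps)
    moreover have "0 \<le> ?y^3" by simp
    moreover have "0 \<le> ?y^4" by simp
    ultimately show "?y^3 \<le> 1 + ?y^4" using 1 zero_le_power2[of ?y] by linarith
  qed
  have hp: "hplus t \<ge> 0" using hplus_ge[OF t] by simp
  have s6: "sqrt 6 \<le> 3" by (rule real_le_lsqrt) auto
  have T: "\<bar>trace (Q ** Q ** Q)\<bar> \<le> 27 * ?y^3"
    using trace3_bound[of Q Q Q] by (simp add: power3_eq_cube)
  have "\<bar>sqrt 6 * trace (Q ** Q ** Q)\<bar> \<le> 3 * (27 * ?y^3)"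
    unfolding abs_mult using s6 T by (intro mult_mono) auto
  then have T6: "\<bar>sqrt 6 * trace (Q ** Q ** Q)\<bar> \<le> 81 * (1 + ?y^4)"
    by (rule order_trans) (use y in simp)
  have 1: "\<bar>(1 - ?y^2)^2\<bar> \<le> 3 * (1 + ?y^4)"
  proof -
    define a b where "a = ?y^2" and "b = ?y^4"
    have ab: "0 \<le> a" "0 \<le> b" by (simp_all add: a_def b_def)
    have "(1 - ?y^2)^2 = 1 - 2 * a + b"
      by (simp add: a_def b_def power2_diff power2_eq_square power4_eq_xxxx algebra_simps)
    also have "\<dots> \<le> 3 + 3 * b"
      using ab by linarith
    finally have "(1 - ?y^2)^2 \<le> 3 * (1 + ?y^4)" by (simp add: b_def)
    then show ?thesis by simp
  qed
  have 2: "\<bar>1 + 3 * ((norm Q)^2)^2 - 4 * sqrt 6 * trace (Q ** Q ** Q)\<bar> \<le> 1600 * (1 + ?y^4)"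
  proof -
    define b T where "b = ?y^4" and "T = sqrt 6 * trace (Q ** Q ** Q)"
    have "0 \<le> b" "\<bar>T\<bar> \<le> 81 + 81 * b" using T6 by (simp_all add: b_def T_def)
    then have "\<bar>1 + 3 * b - 4 * T\<bar> \<le> 1600 + 1600 * b" by linarith
    then show ?thesis by (simp add: b_def T_def mult.assoc)
  qed
  have "\<bar>bulk t Q\<bar> \<le> t / 8 * \<bar>(1 - ?y^2)^2\<bar> + hplus t / 8 * \<bar>1 + 3 * ((norm Q)^2)^2 - 4 * sqrt 6 * trace (Q ** Q ** Q)\<bar>"
    unfolding bulk_def sqn_eq_norm using t hp by (intro order_trans[OF abs_triangle_ineq]) (simp add: abs_mult)
  also have "\<dots> \<le> t / 8 * (3 * (1 + ?y^4)) + hplus t / 8 * (1600 * (1 + ?y^4))"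
    using t hp 1 2 by (intro add_mono mult_left_mono) auto
  also have "\<dots> \<le> (t + 200 * hplus t) * (1 + ?y^4)"
  proof -
    have "0 \<le> t * (1 + ?y^4)" using t by simp
    then show ?thesis by (simp add: algebra_simps)
  qed
  finally show ?thesis .
qed

lemma continuous_bulk: "continuous_on UNIV (bulk t)"
  unfolding bulk_def sqn_def trace_def matrix_matrix_mult_def
  by (simp, intro continuous_intros) auto

section \<open>Weak gradients on the closed shell\<close>

lemma compact_Omega: "compact (Omega R)"
proof -
  have "Omega R = cball 0 R - ball 0 1" by (auto simp: Omega_def)
  then show ?thesis by (simp add: compact_diff)
qed

lemma sets_Omega: "Omega R \<in> sets lebesgue"
  using lmeasurable_compact[OF compact_Omega] by (rule fmeasurableD)

lemma shell_subset_Omega: "shell R \<subseteq> Omega R"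
  by (auto simp: shell_def Omega_def)

lemma interior_Omega: "interior (Omega R) = shell R"
proof -
  have "Omega R = cball 0 R \<inter> - ball 0 1" by (auto simp: Omega_def)
  then show ?thesis
    by (auto simp: interior_complement shell_def)
qed

lemma finite_measure_Omega: "finite_measure (lebesgue_on (Omega R))"
  by (rule finite_measure_lebesgue_on[OF lmeasurable_compact[OF compact_Omega]])

lemma LINT_Omega:
  fixes f :: "pt \<Rightarrow> real"
  shows "(LINT x:Omega R|lebesgue. f x) = (\<integral>x. f x \<partial>lebesgue_on (Omega R))"
  using sets_Omega[of R] by (simp add: integral_restrict_space set_lebesgue_integral_def)

lemma set_integrable_Omega:
  fixes f :: "pt \<Rightarrow> real"
  shows "set_integrable lebesgue (Omega R) f \<longleftrightarrow> integrable (lebesgue_on (Omega R)) f"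
  using sets_Omega[of R] by (simp add: integrable_restrict_space set_integrable_def)

lemma set_borel_measurable_Omega:
  fixes f :: "pt \<Rightarrow> 'a::real_normed_vector"
  shows "set_borel_measurable lebesgue (Omega R) f \<longleftrightarrow> f \<in> borel_measurable (lebesgue_on (Omega R))"
  using sets_Omega[of R] by (simp add: borel_measurable_restrict_space_iff set_borel_measurable_def)

lemma weak_grad_iff:
  "weak_grad (Omega R) Q G \<longleftrightarrow>
    Q \<in> borel_measurable (lebesgue_on (Omega R)) \<and> G \<in> borel_measurable (lebesgue_on (Omega R)) \<and>
    integrable (lebesgue_on (Omega R)) (\<lambda>x. (norm (Q x))\<^sup>2) \<and> integrable (lebesgue_on (Omega R)) (\<lambda>x. (norm (G x))\<^sup>2) \<and>
    (\<forall>\<phi> d. C1c (shell R) \<phi> d \<longrightarrow> (\<forall>i j k. (\<integral>x. Q x $ i $ j * d x $ k \<partial>lebesgue_on (Omega R))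
       = - (\<integral>x. G x $ i $ j $ k * \<phi> x \<partial>lebesgue_on (Omega R))))"
  unfolding weak_grad_def sqn_eq_norm sqg_eq_norm LINT_Omega set_integrable_Omega set_borel_measurable_Omega interior_Omega ..

lemma borel_measurable_lebesgue_on_continuous:
  fixes g :: "pt \<Rightarrow> 'a::real_normed_vector"
  assumes "continuous_on UNIV g"
  shows "g \<in> borel_measurable (lebesgue_on S)"
  using borel_measurable_continuous_onI[OF assms]
  by (intro measurable_restrict_space1 measurable_completion) simp

lemma integrable_lebesgue_on_if_lborel:
  fixes g :: "pt \<Rightarrow> real"
  assumes "integrable lborel g"
  shows "integrable (lebesgue_on (Omega R)) g"
proof -
  have "integrable lebesgue g" using assms by (simp add: integrable_completion)
  then show ?thesis
    using integrable_mult_indicator[OF sets_Omega, of g R] sets_Omega[of R] by (simp add: integrable_restrict_space)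
qed

lemma integral_lebesgue_on_eq_lborel:
  fixes g :: "pt \<Rightarrow> real"
  assumes "integrable lborel g" "\<And>x. x \<notin> Omega R \<Longrightarrow> g x = 0"
  shows "(\<integral>x. g x \<partial>lebesgue_on (Omega R)) = (\<integral>x. g x \<partial>lborel)"
proof -
  have "(\<integral>x. g x \<partial>lebesgue_on (Omega R)) = (\<integral>x. indicator (Omega R) x *\<^sub>R g x \<partial>lebesgue)"
    using sets_Omega[of R] by (simp add: integral_restrict_space)
  also have "(\<lambda>x. indicator (Omega R) x *\<^sub>R g x) = g"
    using assms(2) by (auto simp: fun_eq_iff indicator_def)
  also have "(\<integral>x. g x \<partial>lebesgue) = (\<integral>x. g x \<partial>lborel)"
    using assms(1) by (intro integral_completion) simp
  finally show ?thesis .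
qed

lemma integrable_mult_if_square_integrable:
  fixes f g :: "'a \<Rightarrow> real"
  assumes "f \<in> borel_measurable M" "g \<in> borel_measurable M"
    "integrable M (\<lambda>x. (f x)\<^sup>2)" "integrable M (\<lambda>x. (g x)\<^sup>2)"
  shows "integrable M (\<lambda>x. f x * g x)"
proof (rule Bochner_Integration.integrable_bound[OF Bochner_Integration.integrable_add[OF assms(3,4)]])
  show "(\<lambda>x. f x * g x) \<in> borel_measurable M" by (rule borel_measurable_times[OF assms(1,2)])
  have "\<bar>a * b\<bar> \<le> a\<^sup>2 + b\<^sup>2" for a b :: real
  proof -
    have "2 * (\<bar>a\<bar> * \<bar>b\<bar>) \<le> a\<^sup>2 + b\<^sup>2"
      using sum_squares_bound[of "\<bar>a\<bar>" "\<bar>b\<bar>"] by (simp add: mult.assoc)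
    moreover have "0 \<le> \<bar>a\<bar> * \<bar>b\<bar>" by simp
    ultimately show ?thesis unfolding abs_mult by linarith
  qed
  then show "AE x in M. norm (f x * g x) \<le> norm ((f x)\<^sup>2 + (g x)\<^sup>2)" by auto
qed

lemma integrable_square_if_bounded_by:
  fixes f :: "'a \<Rightarrow> real"
  assumes "integrable M (\<lambda>x. (norm (g x))\<^sup>2)" "f \<in> borel_measurable M" "\<And>x. \<bar>f x\<bar> \<le> norm (g x)"
  shows "integrable M (\<lambda>x. (f x)\<^sup>2)"
proof (rule Bochner_Integration.integrable_bound[OF assms(1)])
  show "(\<lambda>x. (f x)\<^sup>2) \<in> borel_measurable M" using assms(2) by simp
  show "AE x in M. norm ((f x)\<^sup>2) \<le> norm ((norm (g x))\<^sup>2)"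
    using assms(3) by (auto intro!: AE_I2 simp: abs_le_square_iff[symmetric])
qed

lemma abs_nth2_le: "\<bar>(A :: real^'n^'m) $ i $ j\<bar> \<le> norm A"
  by (meson component_le_norm_cart Finite_Cartesian_Product.norm_nth_le order_trans)

lemma abs_nth3_le: "\<bar>(A :: real^'n^'m^'l) $ i $ j $ k\<bar> \<le> norm A"
  by (meson abs_nth2_le Finite_Cartesian_Product.norm_nth_le order_trans)

lemma C1c_integrable:
  assumes "C1c U \<phi> d"
  shows "integrable lborel (\<lambda>x. (\<phi> x)\<^sup>2)" "integrable lborel (\<lambda>x. (d x $ k)\<^sup>2)" "integrable lborel (\<lambda>x. (norm (d x))\<^sup>2)"
    "continuous_on UNIV \<phi>" "continuous_on UNIV d"
proof -
  obtain K where K: "compact K" "K \<subseteq> U" "\<And>x. x \<notin> K \<Longrightarrow> \<phi> x = 0" "\<And>x. x \<notin> K \<Longrightarrow> d x = 0"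
    using C1c_support[OF assms] by metis
  show c: "continuous_on UNIV \<phi>" "continuous_on UNIV d"
    using C1_continuous C1_continuous_grad C1c_C1[OF assms] by auto
  show "integrable lborel (\<lambda>x. (\<phi> x)\<^sup>2)"
    by (rule continuous_compact_support_integrable[OF _ K(1)]) (auto intro!: continuous_intros c simp: K)
  show "integrable lborel (\<lambda>x. (d x $ k)\<^sup>2)"
    by (rule continuous_compact_support_integrable[OF _ K(1)]) (auto intro!: continuous_intros c simp: K)
  show "integrable lborel (\<lambda>x. (norm (d x))\<^sup>2)"
    by (rule continuous_compact_support_integrable[OF _ K(1)]) (auto intro!: continuous_intros c simp: K)
qed

lemma weak_grad_integrable:
  assumes W: "weak_grad (Omega R) Q G" and phi: "C1c U \<phi> d"
  shows "integrable (lebesgue_on (Omega R)) (\<lambda>x. Q x $ i $ j * d x $ k)"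
    "integrable (lebesgue_on (Omega R)) (\<lambda>x. G x $ i $ j $ k * \<phi> x)"
proof -
  have Q [measurable]: "Q \<in> borel_measurable (lebesgue_on (Omega R))" "G \<in> borel_measurable (lebesgue_on (Omega R))"
    and i: "integrable (lebesgue_on (Omega R)) (\<lambda>x. (norm (Q x))\<^sup>2)" "integrable (lebesgue_on (Omega R)) (\<lambda>x. (norm (G x))\<^sup>2)"
    using W unfolding weak_grad_iff by auto
  note p = C1c_integrable[OF phi]
  have [measurable]: "\<phi> \<in> borel_measurable (lebesgue_on (Omega R))" "d \<in> borel_measurable (lebesgue_on (Omega R))"
    using p by (auto intro: borel_measurable_lebesgue_on_continuous)
  show "integrable (lebesgue_on (Omega R)) (\<lambda>x. Q x $ i $ j * d x $ k)"
    by (intro integrable_mult_if_square_integrable integrable_square_if_bounded_by[OF i(1)]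
        integrable_lebesgue_on_if_lborel p abs_nth2_le) measurable
  show "integrable (lebesgue_on (Omega R)) (\<lambda>x. G x $ i $ j $ k * \<phi> x)"
    by (intro integrable_mult_if_square_integrable integrable_square_if_bounded_by[OF i(2)]
        integrable_lebesgue_on_if_lborel p abs_nth3_le) measurable
qed

text \<open>Test functions see only the open shell; the two bounding spheres are null sets.\<close>

lemma AE_Omega_if_AE_shell:
  assumes "AE x in lebesgue. x \<in> shell R \<longrightarrow> P x"
  shows "AE x in lebesgue_on (Omega R). P x"
proof -
  have "negligible (sphere (0::pt) 1 \<union> sphere 0 R)"
    by (simp add: negligible_sphere)
  then have "AE x in lebesgue. x \<notin> sphere (0::pt) 1 \<union> sphere 0 R"
    using AE_not_in negligible_iff_null_sets by blast
  with assms have "AE x in lebesgue. x \<in> Omega R \<longrightarrow> P x"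
    by eventually_elim (auto simp: shell_def Omega_def less_le)
  then show ?thesis
    using sets_Omega[of R] by (subst AE_restrict_space_iff) auto
qed

text \<open>Each entry of the difference of two weak gradients is orthogonal to all test functions.
  This frees \<open>LdG\<close> from the choice made by \<open>SOME\<close>.\<close>

lemma weak_grad_unique:
  assumes "weak_grad (Omega R) Q G" "weak_grad (Omega R) Q G'"
  shows "AE x in lebesgue_on (Omega R). G x = G' x"
proof -
  let ?M = "lebesgue_on (Omega R)"
  have "AE x in ?M. G x $ i $ j $ k = G' x $ i $ j $ k" for i j k
  proof (rule AE_Omega_if_AE_shell)
    interpret finite_measure ?M by (rule finite_measure_Omega)
    have int: "integrable ?M (\<lambda>x. A x $ i $ j $ k)" if "weak_grad (Omega R) Q A" for A
    proof -
      have [measurable]: "A \<in> borel_measurable ?M" and "integrable ?M (\<lambda>x. (norm (A x))\<^sup>2)"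
        using that unfolding weak_grad_iff by auto
      then have "integrable ?M (\<lambda>x. A x $ i $ j $ k * 1)"
        by (intro integrable_mult_if_square_integrable integrable_square_if_bounded_by[OF _ _ abs_nth3_le]) auto
      then show ?thesis by simp
    qed
    define w where "w x = G x $ i $ j $ k - G' x $ i $ j $ k" for x
    have iw: "integrable ?M w"
      unfolding w_def using int assms by auto
    have W: "integrable lebesgue (\<lambda>x. indicator (Omega R) x * w x)"
      using iw sets_Omega[of R] by (simp add: integrable_restrict_space)
    have "AE x in lebesgue. x \<in> shell R \<longrightarrow> indicator (Omega R) x * w x = 0"
    proof (rule AE_zero_if_C1c_orthogonal[OF open_shell W])
      fix \<phi> d assume phi: "C1c (shell R) \<phi> d"
      have "(\<integral>x. indicator (Omega R) x * w x * \<phi> x \<partial>lebesgue) = (\<integral>x. w x * \<phi> x \<partial>?M)"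
        using sets_Omega[of R] by (simp add: integral_restrict_space mult.assoc)
      also have "\<dots> = (\<integral>x. G x $ i $ j $ k * \<phi> x \<partial>?M) - (\<integral>x. G' x $ i $ j $ k * \<phi> x \<partial>?M)"
        unfolding w_def left_diff_distrib
        by (rule Bochner_Integration.integral_diff) (rule weak_grad_integrable(2)[OF _ phi], rule assms)+
      also have "\<dots> = 0"
      proof -
        have "(\<integral>x. Q x $ i $ j * d x $ k \<partial>?M) = - (\<integral>x. G x $ i $ j $ k * \<phi> x \<partial>?M)"
          "(\<integral>x. Q x $ i $ j * d x $ k \<partial>?M) = - (\<integral>x. G' x $ i $ j $ k * \<phi> x \<partial>?M)"
          using assms phi unfolding weak_grad_iff by blast+
        then show ?thesis by simp
      qed
      finally show "(\<integral>x. indicator (Omega R) x * w x * \<phi> x \<partial>lebesgue) = 0" .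
    qed
    then show "AE x in lebesgue. x \<in> shell R \<longrightarrow> G x $ i $ j $ k = G' x $ i $ j $ k"
      by eventually_elim (use shell_subset_Omega[of R] in \<open>auto simp: w_def\<close>)
  qed
  then have "AE x in ?M. \<forall>i\<in>UNIV. \<forall>j\<in>UNIV. \<forall>k\<in>UNIV. G x $ i $ j $ k = G' x $ i $ j $ k"
    by (intro AE_finite_allI) auto
  then show ?thesis
    by eventually_elim (simp add: vec_eq_iff)
qed

lemma weak_grad_add_scaleR:
  assumes A: "weak_grad (Omega R) Q G" and B: "weak_grad (Omega R) V F"
  shows "weak_grad (Omega R) (\<lambda>x. Q x + s *\<^sub>R V x) (\<lambda>x. G x + s *\<^sub>R F x)"
  unfolding weak_grad_iff
proof (intro conjI allI impI)
  let ?M = "lebesgue_on (Omega R)"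
  have [measurable]: "Q \<in> borel_measurable ?M" "G \<in> borel_measurable ?M" "V \<in> borel_measurable ?M" "F \<in> borel_measurable ?M"
    using A B unfolding weak_grad_iff by auto
  show "(\<lambda>x. Q x + s *\<^sub>R V x) \<in> borel_measurable ?M" "(\<lambda>x. G x + s *\<^sub>R F x) \<in> borel_measurable ?M"
    by measurable
  have sq: "(norm (a + s *\<^sub>R b))\<^sup>2 \<le> 2 * (norm a)\<^sup>2 + 2 * s\<^sup>2 * (norm b)\<^sup>2" for a b :: "'z::real_inner"
  proof -
    have "0 \<le> (a - s *\<^sub>R b) \<bullet> (a - s *\<^sub>R b)" by simp
    then show ?thesis
      unfolding power2_norm_eq_inner by (simp add: inner_add_left inner_add_right inner_diff_left inner_diff_right power2_eq_square inner_commute)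
  qed
  show "integrable ?M (\<lambda>x. (norm (Q x + s *\<^sub>R V x))\<^sup>2)"
    by (rule Bochner_Integration.integrable_bound[of _ "\<lambda>x. 2 * (norm (Q x))\<^sup>2 + 2 * s\<^sup>2 * (norm (V x))\<^sup>2"])
       (use A B sq in \<open>auto simp: weak_grad_iff intro!: AE_I2 order_trans[OF _ abs_ge_self]\<close>)
  show "integrable ?M (\<lambda>x. (norm (G x + s *\<^sub>R F x))\<^sup>2)"
    by (rule Bochner_Integration.integrable_bound[of _ "\<lambda>x. 2 * (norm (G x))\<^sup>2 + 2 * s\<^sup>2 * (norm (F x))\<^sup>2"])
       (use A B sq in \<open>auto simp: weak_grad_iff intro!: AE_I2 order_trans[OF _ abs_ge_self]\<close>)
  fix \<phi> d i j k assume phi: "C1c (shell R) \<phi> d"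
  have a: "(\<integral>x. Q x $ i $ j * d x $ k \<partial>?M) = - (\<integral>x. G x $ i $ j $ k * \<phi> x \<partial>?M)"
    "(\<integral>x. V x $ i $ j * d x $ k \<partial>?M) = - (\<integral>x. F x $ i $ j $ k * \<phi> x \<partial>?M)"
    using A B phi unfolding weak_grad_iff by blast+
  have "(\<integral>x. (Q x + s *\<^sub>R V x) $ i $ j * d x $ k \<partial>?M)
      = (\<integral>x. Q x $ i $ j * d x $ k + s * (V x $ i $ j * d x $ k) \<partial>?M)"
    by (intro Bochner_Integration.integral_cong refl) (simp add: algebra_simps)
  also have "\<dots> = (\<integral>x. Q x $ i $ j * d x $ k \<partial>?M) + s * (\<integral>x. V x $ i $ j * d x $ k \<partial>?M)"
    by (subst Bochner_Integration.integral_add) (auto intro!: weak_grad_integrable[OF A phi] weak_grad_integrable[OF B phi])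
  also have "\<dots> = - ((\<integral>x. G x $ i $ j $ k * \<phi> x \<partial>?M) + s * (\<integral>x. F x $ i $ j $ k * \<phi> x \<partial>?M))"
    by (simp add: a)
  also have "\<dots> = - (\<integral>x. G x $ i $ j $ k * \<phi> x + s * (F x $ i $ j $ k * \<phi> x) \<partial>?M)"
    by (subst Bochner_Integration.integral_add) (auto intro!: weak_grad_integrable[OF A phi] weak_grad_integrable[OF B phi])
  also have "\<dots> = - (\<integral>x. (G x + s *\<^sub>R F x) $ i $ j $ k * \<phi> x \<partial>?M)"
    by (intro arg_cong[where f=uminus] Bochner_Integration.integral_cong refl) (simp add: algebra_simps)
  finally show "(\<integral>x. (Q x + s *\<^sub>R V x) $ i $ j * d x $ k \<partial>?M) = - (\<integral>x. (G x + s *\<^sub>R F x) $ i $ j $ k * \<phi> x \<partial>?M)" .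
qed

lemma continuous_Omega_integrable:
  fixes g :: "pt \<Rightarrow> real"
  assumes "continuous_on (Omega R) g"
  shows "integrable (lebesgue_on (Omega R)) g"
proof -
  have "integrable lborel (\<lambda>x. indicator (Omega R) x *\<^sub>R g x)"
    by (rule borel_integrable_compact[OF compact_Omega assms])
  then have "set_integrable lebesgue (Omega R) g"
    by (simp add: set_integrable_def integrable_completion)
  then show ?thesis by (simp add: set_integrable_Omega)
qed

text \<open>Inside the shell the hedgehog is C^1. Its product with a test function is therefore a
  compactly supported C^1 function, whose partial derivatives integrate to zero: exactly the weak
  gradient identity. Continuity of the gradient formula up to the boundary gives square
  integrability.\<close>

lemma hedgehog_weak_grad:
  assumes R: "1 < R"
    and h: "\<And>r. r \<in> {1..R} \<Longrightarrow> (h has_real_derivative h1 r) (at r within {1..R})"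
    and h1: "continuous_on {1..R} h1"
  obtains GH where "weak_grad (Omega R) (hedgehog h) GH" "continuous_on (Omega R) (hedgehog h)"
proof -
  let ?M = "lebesgue_on (Omega R)"
  have ch: "continuous_on {1..R} h" using h by (intro DERIV_continuous_on)
  have hat: "(h has_real_derivative h1 r) (at r)" if "1 < r" "r < R" for r
    using h[of r] that by (simp add: at_within_Icc_at)
  \<comment> \<open>Absorbing 1/r^2 into the profile turns the normalized tensor into the polynomial
    x_i x_j, so that only products and radial functions have to be differentiated.\<close>
  define f where "f r = h r / r^2" for r
  define f1 where "f1 r = h1 r / r^2 - 2 * h r / r^3" for r
  have fat: "(f has_real_derivative f1 r) (at r)" if "1 < r" "r < R" for r
    unfolding f_def f1_def using that
    by (auto intro!: derivative_eq_intros hat simp: field_simps power2_eq_square power3_eq_cube)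
  define \<delta> where "\<delta> i j = (if i = j then 1 else 0 :: real)" for i j :: 3
  define q where "q i j x = sqrt (3/2) * (f (norm x) * (x $ i * x $ j) - \<delta> i j / 3 * h (norm x))" for i j :: 3 and x :: pt
  define e where "e i j x = sqrt (3/2) *\<^sub>R ((f (norm x) *\<^sub>R (x $ i *\<^sub>R axis j 1 + x $ j *\<^sub>R axis i 1)
      + (x $ i * x $ j) *\<^sub>R ((f1 (norm x) / norm x) *\<^sub>R x)) - (\<delta> i j / 3) *\<^sub>R ((h1 (norm x) / norm x) *\<^sub>R x))" for i j :: 3 and x :: pt
  have q: "hedgehog h x $ i $ j = q i j x" if "x \<in> Omega R" for i j x
    using that by (auto simp: hedgehog_def q_def f_def \<delta>_def outer_def mat_def Omega_def field_simps power2_eq_square)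
  have nz: "x \<noteq> 0" if "x \<in> Omega R" for x using that by (auto simp: Omega_def)
  have cn: "continuous_on (Omega R) (\<lambda>x. k (norm x))" if "continuous_on {1..R} k" for k :: "real \<Rightarrow> real"
    by (rule continuous_on_compose2[OF that continuous_on_norm_id]) (auto simp: Omega_def)
  have cf: "continuous_on {1..R} f" "continuous_on {1..R} f1"
    unfolding f_def f1_def by (intro continuous_intros ch h1; auto)+
  note cc = cn[OF ch] cn[OF h1] cn[OF cf(1)] cn[OF cf(2)]
  have cq: "continuous_on (Omega R) (q i j)" for i j
    unfolding q_def by (intro continuous_intros cc)
  have ce: "continuous_on (Omega R) (e i j)" for i j
    unfolding e_def using nz by (intro continuous_intros cc) auto
  have dq: "(q i j has_derivative (\<lambda>v. e i j x \<bullet> v)) (at x)" if x: "x \<in> shell R" for i j x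
  proof -
    have x': "1 < norm x" "norm x < R" "x \<noteq> 0" using x by (auto simp: shell_def)
    show ?thesis
      unfolding q_def e_def
      by (rule has_derivative_eq_rhs[OF has_derivative_mult_right[OF has_derivative_diff[OF
          has_derivative_mult[OF has_derivative_radial[OF fat[OF x'(1,2)] x'(3)]
            C1_has_derivative[OF C1_mult[OF C1_component C1_component]]]
          has_derivative_mult_right[OF has_derivative_radial[OF hat[OF x'(1,2)] x'(3)]]]]])
        (simp add: fun_eq_iff inner_add_left inner_diff_left algebra_simps)
  qed
  define GH where "GH x = (\<chi> i j. e i j x)" for x
  have cH: "continuous_on (Omega R) (hedgehog h)"
  proof (rule continuous_on_eq)
    show "continuous_on (Omega R) (\<lambda>x. \<chi> i j. q i j x)" by (intro continuous_intros cq)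
  qed (simp add: vec_eq_iff q)
  have cG: "continuous_on (Omega R) GH"
    unfolding GH_def by (intro continuous_intros ce)
  have "weak_grad (Omega R) (hedgehog h) GH"
    unfolding weak_grad_iff
  proof (intro conjI allI impI)
    show "hedgehog h \<in> borel_measurable ?M" "GH \<in> borel_measurable ?M"
      by (intro continuous_imp_measurable_on_sets_lebesgue cH cG sets_Omega)+
    show "integrable ?M (\<lambda>x. (norm (hedgehog h x))\<^sup>2)" "integrable ?M (\<lambda>x. (norm (GH x))\<^sup>2)"
      by (intro continuous_Omega_integrable continuous_intros cH cG)+
    fix \<phi> d i j k assume phi: "C1c (shell R) \<phi> d"
    have F: "C1c (shell R) (\<lambda>x. q i j x * \<phi> x) (\<lambda>x. q i j x *\<^sub>R d x + \<phi> x *\<^sub>R e i j x)"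
      by (rule C1c_mult_local[OF phi open_shell dq continuous_on_subset[OF ce shell_subset_Omega]])
    obtain K where K: "K \<subseteq> shell R" "\<And>x. x \<notin> K \<Longrightarrow> q i j x *\<^sub>R d x + \<phi> x *\<^sub>R e i j x = 0"
      using C1c_support[OF F] by metis
    have "(\<integral>x. (q i j x *\<^sub>R d x + \<phi> x *\<^sub>R e i j x) $ k \<partial>?M) = 0"
    proof (subst integral_lebesgue_on_eq_lborel[OF C1c_grad_integrable[OF F]])
      fix x :: pt assume "x \<notin> Omega R"
      then have "x \<notin> K" using K(1) shell_subset_Omega by blast
      then show "(q i j x *\<^sub>R d x + \<phi> x *\<^sub>R e i j x) $ k = 0" using K(2) by simp
    qed (rule C1c_grad_integral_zero[OF F])
    moreover have "(\<integral>x. (q i j x *\<^sub>R d x + \<phi> x *\<^sub>R e i j x) $ k \<partial>?M)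
        = (\<integral>x. q i j x * d x $ k + GH x $ i $ j $ k * \<phi> x \<partial>?M)"
      by (simp add: GH_def mult.commute)
    moreover have "\<dots> = (\<integral>x. q i j x * d x $ k \<partial>?M) + (\<integral>x. GH x $ i $ j $ k * \<phi> x \<partial>?M)"
    proof (rule Bochner_Integration.integral_add)
      have c: "continuous_on (Omega R) \<phi>" "continuous_on (Omega R) d"
        using C1c_integrable(4,5)[OF phi] continuous_on_subset by blast+
      show "integrable ?M (\<lambda>x. q i j x * d x $ k)" "integrable ?M (\<lambda>x. GH x $ i $ j $ k * \<phi> x)"
        by (intro continuous_Omega_integrable continuous_intros cq c cG)+
    qed
    moreover have "(\<integral>x. q i j x * d x $ k \<partial>?M) = (\<integral>x. hedgehog h x $ i $ j * d x $ k \<partial>?M)"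
      by (intro Bochner_Integration.integral_cong refl) (simp add: q)
    ultimately show "(\<integral>x. hedgehog h x $ i $ j * d x $ k \<partial>?M) = - (\<integral>x. GH x $ i $ j $ k * \<phi> x \<partial>?M)"
      by simp
  qed
  then show ?thesis using that cH by blast
qed

section \<open>Limits of test functions: integrability of the fourth power and Poincare's
  inequality\<close>

text \<open>Factor x^2 - y^2, bound both factors through z = |a - b|, and split 2 y z by Young's
  inequality with weight \<epsilon>. Integrated, this shows that L^2 norms are continuous without
  Minkowski's inequality.\<close>

lemma norm_square_diff_bound:
  fixes a b :: "'a::real_normed_vector"
  assumes "\<epsilon> > 0"
  shows "\<bar>(norm a)\<^sup>2 - (norm b)\<^sup>2\<bar> \<le> \<epsilon> * (norm b)\<^sup>2 + (1 + 1 / \<epsilon>) * (norm (a - b))\<^sup>2"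
proof -
  define x y z where "x = norm a" and "y = norm b" and "z = norm (a - b)"
  have z: "\<bar>x - y\<bar> \<le> z" "0 \<le> x" "0 \<le> y" "0 \<le> z"
    unfolding x_def y_def z_def by (auto intro: norm_triangle_ineq3)
  have "\<bar>x\<^sup>2 - y\<^sup>2\<bar> = \<bar>x - y\<bar> * (x + y)"
    using z by (simp add: power2_eq_square square_diff_square_factored abs_mult mult.commute)
  also have "\<dots> \<le> z * (2 * y + z)"
    using z by (intro mult_mono) auto
  also have "\<dots> = 2 * y * z + z\<^sup>2" by (simp add: power2_eq_square algebra_simps)
  also have "2 * y * z \<le> \<epsilon> * y\<^sup>2 + z\<^sup>2 / \<epsilon>"
  proof -
    have "0 \<le> (\<epsilon> * y - z)\<^sup>2 / \<epsilon>" using assms by simp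
    also have "\<dots> = \<epsilon> * y\<^sup>2 + z\<^sup>2 / \<epsilon> - 2 * y * z"
      using assms by (simp add: power2_eq_square field_simps)
    finally show ?thesis by simp
  qed
  finally show ?thesis
    by (simp add: x_def y_def z_def algebra_simps)
qed

lemma L2_norm_tendsto:
  fixes f :: "nat \<Rightarrow> 'a \<Rightarrow> 'b::{real_normed_vector, second_countable_topology}"
  assumes g: "integrable M (\<lambda>x. (norm (g x))\<^sup>2)" and f: "\<And>n. integrable M (\<lambda>x. (norm (f n x))\<^sup>2)"
    and fg: "\<And>n. integrable M (\<lambda>x. (norm (f n x - g x))\<^sup>2)"
    and lim: "(\<lambda>n. \<integral>x. (norm (f n x - g x))\<^sup>2 \<partial>M) \<longlonglongrightarrow> 0"
  shows "(\<lambda>n. \<integral>x. (norm (f n x))\<^sup>2 \<partial>M) \<longlonglongrightarrow> (\<integral>x. (norm (g x))\<^sup>2 \<partial>M)"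
proof (rule LIMSEQ_I)
  fix e :: real assume e: "e > 0"
  define J where "J = (\<integral>x. (norm (g x))\<^sup>2 \<partial>M)"
  have J: "J \<ge> 0" by (simp add: J_def)
  \<comment> \<open>Makes \<epsilon> J < e/2; the summand 1 covers the case J = 0.\<close>
  define \<epsilon> where "\<epsilon> = e / (2 * (J + 1))"
  have eps: "\<epsilon> > 0" using e J by (simp add: \<epsilon>_def)
  have "e * J < e * (J + 1)" using e by simp
  then have epsJ: "\<epsilon> * J < e / 2" using J by (simp add: \<epsilon>_def field_simps)
  have "0 < e / 2 / (1 + 1 / \<epsilon>)" using e eps by (intro divide_pos_pos add_pos_pos) auto
  then obtain N where N: "\<And>n. n \<ge> N \<Longrightarrow> (\<integral>x. (norm (f n x - g x))\<^sup>2 \<partial>M) < e / 2 / (1 + 1 / \<epsilon>)"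
    using order_tendstoD(2)[OF lim] unfolding eventually_sequentially by blast
  have "norm ((\<integral>x. (norm (f n x))\<^sup>2 \<partial>M) - J) < e" if "n \<ge> N" for n
  proof -
    have "norm ((\<integral>x. (norm (f n x))\<^sup>2 \<partial>M) - J) = norm (\<integral>x. (norm (f n x))\<^sup>2 - (norm (g x))\<^sup>2 \<partial>M)"
      unfolding J_def by (subst Bochner_Integration.integral_diff[OF f g]) simp
    also have "\<dots> \<le> (\<integral>x. \<bar>(norm (f n x))\<^sup>2 - (norm (g x))\<^sup>2\<bar> \<partial>M)"
      using integral_norm_bound[of M "\<lambda>x. (norm (f n x))\<^sup>2 - (norm (g x))\<^sup>2"] by simp
    also have "\<dots> \<le> (\<integral>x. \<epsilon> * (norm (g x))\<^sup>2 + (1 + 1 / \<epsilon>) * (norm (f n x - g x))\<^sup>2 \<partial>M)"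
      by (intro integral_mono norm_square_diff_bound[OF eps] integrable_abs Bochner_Integration.integrable_diff f g
          Bochner_Integration.integrable_add integrable_mult_right fg)
    also have "\<dots> = \<epsilon> * J + (1 + 1 / \<epsilon>) * (\<integral>x. (norm (f n x - g x))\<^sup>2 \<partial>M)"
      unfolding J_def by (subst Bochner_Integration.integral_add) (auto intro!: g fg)
    also have "\<dots> < e / 2 + e / 2"
    proof (rule add_strict_mono[OF epsJ])
      have "1 + 1 / \<epsilon> > 0" using eps by (simp add: add_pos_pos)
      then show "(1 + 1 / \<epsilon>) * (\<integral>x. (norm (f n x - g x))\<^sup>2 \<partial>M) < e / 2"
        using N[OF that] unfolding pos_less_divide_eq[OF \<open>1 + 1 / \<epsilon> > 0\<close>] by (simp only: mult.commute)
    qed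
    finally show ?thesis by simp
  qed
  then show "\<exists>no. \<forall>n\<ge>no. norm ((\<integral>x. (norm (f n x))\<^sup>2 \<partial>M) - (\<integral>x. (norm (g x))\<^sup>2 \<partial>M)) < e"
    unfolding J_def by blast
qed

text \<open>Ladyzhenskaya's inequality bounds the integrals of u_n^4 uniformly, and Fatou's lemma
  along an almost everywhere convergent subsequence hands the bound to the limit.\<close>

lemma L4_if_L2_limit_of_C1c:
  fixes v :: "pt \<Rightarrow> real"
  assumes u: "\<And>n. C1c (shell R) (u n) (d n)"
    and v: "v \<in> borel_measurable (lebesgue_on (Omega R))"
    and B: "\<And>n. (\<integral>x. (u n x)\<^sup>2 \<partial>lebesgue_on (Omega R)) + (\<integral>x. (norm (d n x))\<^sup>2 \<partial>lebesgue_on (Omega R)) \<le> B"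
    and i: "\<And>n. integrable (lebesgue_on (Omega R)) (\<lambda>x. (u n x - v x)\<^sup>2)"
    and lim: "(\<lambda>n. \<integral>x. (u n x - v x)\<^sup>2 \<partial>lebesgue_on (Omega R)) \<longlonglongrightarrow> 0"
  shows "integrable (lebesgue_on (Omega R)) (\<lambda>x. v x ^ 4)"
proof -
  let ?M = "lebesgue_on (Omega R)"
  have um: "u n \<in> borel_measurable ?M" for n
    by (rule borel_measurable_lebesgue_on_continuous[OF C1c_integrable(4)[OF u]])
  note [measurable] = um v
  have n4: "(\<integral>\<^sup>+x. ennreal (u n x ^ 4) \<partial>?M) \<le> ennreal (4 * B * B)" for n
  proof -
    obtain K where K: "K \<subseteq> shell R" "\<And>x. x \<notin> K \<Longrightarrow> u n x = 0" "\<And>x. x \<notin> K \<Longrightarrow> d n x = 0"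
      using C1c_support[OF u] by metis
    have z: "u n x = 0" "d n x = 0" if "x \<notin> Omega R" for x
      using that K shell_subset_Omega by blast+
    note c = C1c_integrable[OF u]
    have e: "(\<integral>x. (u n x)\<^sup>2 \<partial>lborel) = (\<integral>x. (u n x)\<^sup>2 \<partial>?M)" "(\<integral>x. (norm (d n x))\<^sup>2 \<partial>lborel) = (\<integral>x. (norm (d n x))\<^sup>2 \<partial>?M)"
      by (rule integral_lebesgue_on_eq_lborel[symmetric], rule c, simp add: z)+
    have B0: "(\<integral>x. (u n x)\<^sup>2 \<partial>?M) \<ge> 0" "(\<integral>x. (norm (d n x))\<^sup>2 \<partial>?M) \<ge> 0" by simp_all
    have B1: "(\<integral>x. (norm (d n x))\<^sup>2 \<partial>?M) \<le> B" "0 \<le> B" using B[of n] B0 by linarith+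
    have "(\<integral>\<^sup>+x. ennreal (u n x ^ 4) \<partial>?M) = (\<integral>\<^sup>+x. ennreal (u n x ^ 4) * indicator (Omega R) x \<partial>lebesgue)"
      using sets_Omega[of R] by (simp add: nn_integral_restrict_space)
    also have "\<dots> \<le> (\<integral>\<^sup>+x. ennreal (u n x ^ 4) \<partial>lebesgue)"
      by (intro nn_integral_mono) (simp add: indicator_def)
    also have "\<dots> = (\<integral>\<^sup>+x. ennreal (u n x ^ 4) \<partial>lborel)"
      by (rule nn_integral_completion)
    also have "\<dots> \<le> 4 * (\<integral>\<^sup>+x. ennreal ((u n x)\<^sup>2 + (norm (d n x))\<^sup>2) \<partial>lborel) * (\<integral>\<^sup>+x. ennreal ((norm (d n x))\<^sup>2) \<partial>lborel)"
      by (rule ladyzhenskaya[OF u])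
    also have "(\<integral>\<^sup>+x. ennreal ((u n x)\<^sup>2 + (norm (d n x))\<^sup>2) \<partial>lborel)
       = ennreal ((\<integral>x. (u n x)\<^sup>2 \<partial>?M) + (\<integral>x. (norm (d n x))\<^sup>2 \<partial>?M))"
      by (subst nn_integral_eq_integral) (auto intro!: c simp: e Bochner_Integration.integral_add[OF c(1,3)])
    also have "(\<integral>\<^sup>+x. ennreal ((norm (d n x))\<^sup>2) \<partial>lborel) = ennreal (\<integral>x. (norm (d n x))\<^sup>2 \<partial>?M)"
      by (subst nn_integral_eq_integral) (auto intro!: c simp: e)
    also have "4 * ennreal ((\<integral>x. (u n x)\<^sup>2 \<partial>?M) + (\<integral>x. (norm (d n x))\<^sup>2 \<partial>?M)) * ennreal (\<integral>x. (norm (d n x))\<^sup>2 \<partial>?M)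
        \<le> 4 * ennreal B * ennreal B"
      using B[of n] B1 by (intro mult_mono ennreal_leI) auto
    also have "\<dots> = ennreal (4 * B * B)"
      using B1 by (simp add: ennreal_mult)
    finally show ?thesis .
  qed
  \<comment> \<open>The squared differences tend to zero in L^1, so a subsequence of them tends to
    zero almost everywhere.\<close>
  obtain r where r: "strict_mono r" "AE x in ?M. (\<lambda>n. (u (r n) x - v x)\<^sup>2) \<longlonglongrightarrow> 0"
    using tendsto_L1_AE_subseq[of ?M "\<lambda>n x. (u n x - v x)\<^sup>2", OF i] lim
    unfolding real_norm_def abs_power2 by blast
  have "AE x in ?M. liminf (\<lambda>n. ennreal (u (r n) x ^ 4)) = ennreal (v x ^ 4)"
    using r(2)
  proof eventually_elim
    fix x assume "(\<lambda>n. (u (r n) x - v x)\<^sup>2) \<longlonglongrightarrow> 0"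
    then have "(\<lambda>n. sqrt ((u (r n) x - v x)\<^sup>2)) \<longlonglongrightarrow> sqrt 0" by (rule tendsto_real_sqrt)
    then have "(\<lambda>n. u (r n) x - v x) \<longlonglongrightarrow> 0" by (simp add: tendsto_rabs_zero_iff)
    then have "(\<lambda>n. u (r n) x) \<longlonglongrightarrow> v x" by (simp add: LIM_zero_iff)
    then have "(\<lambda>n. ennreal (u (r n) x ^ 4)) \<longlonglongrightarrow> ennreal (v x ^ 4)"
      by (intro tendsto_ennrealI tendsto_power)
    then show "liminf (\<lambda>n. ennreal (u (r n) x ^ 4)) = ennreal (v x ^ 4)"
      by (intro lim_imp_Liminf) auto
  qed
  then have "(\<integral>\<^sup>+x. ennreal (v x ^ 4) \<partial>?M) = (\<integral>\<^sup>+x. liminf (\<lambda>n. ennreal (u (r n) x ^ 4)) \<partial>?M)"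
    by (intro nn_integral_cong_AE) auto
  also have "\<dots> \<le> liminf (\<lambda>n. \<integral>\<^sup>+x. ennreal (u (r n) x ^ 4) \<partial>?M)"
    by (rule nn_integral_liminf) measurable
  also have "\<dots> \<le> ennreal (4 * B * B)"
    by (rule Liminf_le) (auto intro!: always_eventually n4)
  finally have "(\<integral>\<^sup>+x. ennreal (v x ^ 4) \<partial>?M) < \<infinity>"
    using ennreal_less_top le_less_trans by (metis infinity_ennreal_def)
  then show ?thesis by (intro integrableI_nonneg) auto
qed

lemma norm_square_sum_components:
  fixes A :: "('a::real_inner)^3^3"
  shows "(norm A)\<^sup>2 = (\<Sum>i\<in>UNIV. \<Sum>j\<in>UNIV. (norm (A $ i $ j))\<^sup>2)"
  unfolding power2_norm_eq_inner by (simp add: inner_vec_def)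

lemma norm_power4_le_components: "(norm (A::qmat))^4 \<le> 9 * (\<Sum>i\<in>UNIV. \<Sum>j\<in>UNIV. (A $ i $ j)^4)"
proof -
  let ?I = "UNIV \<times> UNIV :: (3 \<times> 3) set"
  have "(norm A)^4 = ((norm A)\<^sup>2)\<^sup>2" by simp
  also have "\<dots> = (\<Sum>p\<in>?I. (A $ fst p $ snd p)\<^sup>2)\<^sup>2"
    unfolding norm_square_sum_components sum.cartesian_product by (simp add: split_def)
  also have "\<dots> \<le> (\<Sum>p\<in>?I. ((A $ fst p $ snd p)\<^sup>2)\<^sup>2) * real (card ?I)"
    by (rule sum_squared_le_sum_of_squares)
  also have "\<dots> = 9 * (\<Sum>i\<in>UNIV. \<Sum>j\<in>UNIV. (A $ i $ j)^4)"
    unfolding sum.cartesian_product by (simp add: split_def card_cartesian_product)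
  finally show ?thesis .
qed

text \<open>The approximating fields are not assumed symmetric or traceless, so both scalar
  inequalities are applied to each matrix entry separately. Summing the entries and using
  convergence of the L^2 norms gives Poincare's inequality for V with the same constant.\<close>

lemma W12_0_estimates:
  assumes R: "1 < R" and V: "W12_0 (Omega R) V"
  obtains G where "weak_grad (Omega R) V G" "integrable (lebesgue_on (Omega R)) (\<lambda>x. (norm (V x))^4)"
    "(pi / (R - 1))\<^sup>2 * (\<integral>x. (norm (V x))\<^sup>2 \<partial>lebesgue_on (Omega R)) \<le> (\<integral>x. (norm (G x))\<^sup>2 \<partial>lebesgue_on (Omega R))"
proof -
  let ?M = "lebesgue_on (Omega R)"
  obtain G \<Phi> d\<Phi> where W: "weak_grad (Omega R) V G"
    and C: "\<And>n i j. C1c (shell R) (\<lambda>x. \<Phi> n x $ i $ j) (\<lambda>x. d\<Phi> n x $ i $ j)"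
    and l: "(\<lambda>n::nat. \<integral>x. (norm (\<Phi> n x - V x))\<^sup>2 \<partial>?M) \<longlonglongrightarrow> 0" "(\<lambda>n::nat. \<integral>x. (norm (d\<Phi> n x - G x))\<^sup>2 \<partial>?M) \<longlonglongrightarrow> 0"
    using V unfolding W12_0_def sqn_eq_norm sqg_eq_norm LINT_Omega interior_Omega by blast
  have Vm: "V \<in> borel_measurable ?M" "G \<in> borel_measurable ?M"
    and iV: "integrable ?M (\<lambda>x. (norm (V x))\<^sup>2)" "integrable ?M (\<lambda>x. (norm (G x))\<^sup>2)"
    using W unfolding weak_grad_iff by auto
  have cont: "continuous_on UNIV (\<Phi> n)" "continuous_on UNIV (d\<Phi> n)" for n
  proof -
    have "continuous_on UNIV (\<lambda>x. \<chi> i j. \<Phi> n x $ i $ j)" "continuous_on UNIV (\<lambda>x. \<chi> i j. d\<Phi> n x $ i $ j)"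
      by (intro continuous_intros C1c_integrable(4,5)[OF C])+
    then show "continuous_on UNIV (\<Phi> n)" "continuous_on UNIV (d\<Phi> n)" by simp_all
  qed
  have Pm: "\<Phi> n \<in> borel_measurable ?M" "d\<Phi> n \<in> borel_measurable ?M" for n
    by (intro borel_measurable_lebesgue_on_continuous cont)+
  note [measurable] = Vm Pm
  have iP: "integrable ?M (\<lambda>x. (norm (\<Phi> n x))\<^sup>2)" "integrable ?M (\<lambda>x. (norm (d\<Phi> n x))\<^sup>2)" for n
    by (intro continuous_Omega_integrable continuous_intros continuous_on_subset[OF cont(1)] continuous_on_subset[OF cont(2)] subset_UNIV)+
  have sq: "(norm (a - b))\<^sup>2 \<le> 2 * (norm a)\<^sup>2 + 2 * (norm b)\<^sup>2" for a b :: "'z::real_inner"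
  proof -
    have "0 \<le> (a + b) \<bullet> (a + b)" by simp
    then show ?thesis
      unfolding power2_norm_eq_inner by (simp add: inner_add_left inner_add_right inner_diff_left inner_diff_right inner_commute)
  qed
  have iD: "integrable ?M (\<lambda>x. (norm (\<Phi> n x - V x))\<^sup>2)" "integrable ?M (\<lambda>x. (norm (d\<Phi> n x - G x))\<^sup>2)" for n
  proof -
    show "integrable ?M (\<lambda>x. (norm (\<Phi> n x - V x))\<^sup>2)"
      by (rule Bochner_Integration.integrable_bound[of _ "\<lambda>x. 2 * (norm (\<Phi> n x))\<^sup>2 + 2 * (norm (V x))\<^sup>2"])
         (use iP iV sq in \<open>auto intro!: AE_I2 order_trans[OF _ abs_ge_self]\<close>)
    show "integrable ?M (\<lambda>x. (norm (d\<Phi> n x - G x))\<^sup>2)"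
      by (rule Bochner_Integration.integrable_bound[of _ "\<lambda>x. 2 * (norm (d\<Phi> n x))\<^sup>2 + 2 * (norm (G x))\<^sup>2"])
         (use iP iV sq in \<open>auto intro!: AE_I2 order_trans[OF _ abs_ge_self]\<close>)
  qed
  have t: "(\<lambda>n. \<integral>x. (norm (\<Phi> n x))\<^sup>2 \<partial>?M) \<longlonglongrightarrow> (\<integral>x. (norm (V x))\<^sup>2 \<partial>?M)"
    "(\<lambda>n. \<integral>x. (norm (d\<Phi> n x))\<^sup>2 \<partial>?M) \<longlonglongrightarrow> (\<integral>x. (norm (G x))\<^sup>2 \<partial>?M)"
    by (rule L2_norm_tendsto; fact iV iP iD l)+
  have ic: "integrable ?M (\<lambda>x. (\<Phi> n x $ i $ j)\<^sup>2)" "integrable ?M (\<lambda>x. (norm (d\<Phi> n x $ i $ j))\<^sup>2)" for n i j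
    by (intro integrable_lebesgue_on_if_lborel C1c_integrable[OF C])+
  have zero: "\<Phi> n x $ i $ j = 0" "d\<Phi> n x $ i $ j = 0" if "x \<notin> Omega R" for n i j x
  proof -
    obtain K where "K \<subseteq> shell R" "\<And>x. x \<notin> K \<Longrightarrow> \<Phi> n x $ i $ j = 0" "\<And>x. x \<notin> K \<Longrightarrow> d\<Phi> n x $ i $ j = 0"
      using C1c_support[OF C] by metis
    then show "\<Phi> n x $ i $ j = 0" "d\<Phi> n x $ i $ j = 0" using that shell_subset_Omega by blast+
  qed
  have P: "(pi / (R - 1))\<^sup>2 * (\<integral>x. (norm (\<Phi> n x))\<^sup>2 \<partial>?M) \<le> (\<integral>x. (norm (d\<Phi> n x))\<^sup>2 \<partial>?M)" for n
  proof -
    have "(\<integral>x. (norm (\<Phi> n x))\<^sup>2 \<partial>?M) = (\<Sum>i\<in>UNIV. \<Sum>j\<in>UNIV. \<integral>x. (\<Phi> n x $ i $ j)\<^sup>2 \<partial>?M)"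
      unfolding norm_square_sum_components by (simp add: Bochner_Integration.integral_sum ic)
    moreover have "(\<integral>x. (norm (d\<Phi> n x))\<^sup>2 \<partial>?M) = (\<Sum>i\<in>UNIV. \<Sum>j\<in>UNIV. \<integral>x. (norm (d\<Phi> n x $ i $ j))\<^sup>2 \<partial>?M)"
      unfolding norm_square_sum_components by (simp add: Bochner_Integration.integral_sum ic)
    moreover have "(pi / (R - 1))\<^sup>2 * (\<integral>x. (\<Phi> n x $ i $ j)\<^sup>2 \<partial>?M) \<le> (\<integral>x. (norm (d\<Phi> n x $ i $ j))\<^sup>2 \<partial>?M)" for i j
    proof -
      have "(\<integral>x. (\<Phi> n x $ i $ j)\<^sup>2 \<partial>?M) = (\<integral>x. (\<Phi> n x $ i $ j)\<^sup>2 \<partial>lborel)"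
        "(\<integral>x. (norm (d\<Phi> n x $ i $ j))\<^sup>2 \<partial>?M) = (\<integral>x. (norm (d\<Phi> n x $ i $ j))\<^sup>2 \<partial>lborel)"
        by (rule integral_lebesgue_on_eq_lborel, rule C1c_integrable[OF C], simp add: zero)+
      then show ?thesis using poincare_shell[OF R refl C] by simp
    qed
    ultimately show ?thesis by (simp add: sum_distrib_left) (intro sum_mono)
  qed
  have poincare: "(pi / (R - 1))\<^sup>2 * (\<integral>x. (norm (V x))\<^sup>2 \<partial>?M) \<le> (\<integral>x. (norm (G x))\<^sup>2 \<partial>?M)"
    by (rule LIMSEQ_le[OF tendsto_mult_left[OF t(1)] t(2)]) (use P in auto)
  \<comment> \<open>The norms of the approximants converge, hence are bounded; this is the uniform
    bound that the fourth powers need.\<close>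
  obtain B where B: "\<And>n. (\<integral>x. (norm (\<Phi> n x))\<^sup>2 \<partial>?M) + (\<integral>x. (norm (d\<Phi> n x))\<^sup>2 \<partial>?M) \<le> B"
  proof -
    have "Bseq (\<lambda>n. (\<integral>x. (norm (\<Phi> n x))\<^sup>2 \<partial>?M) + (\<integral>x. (norm (d\<Phi> n x))\<^sup>2 \<partial>?M))"
      by (rule convergent_imp_Bseq[OF convergentI[OF tendsto_add[OF t]]])
    then obtain K where "\<forall>n. norm ((\<integral>x. (norm (\<Phi> n x))\<^sup>2 \<partial>?M) + (\<integral>x. (norm (d\<Phi> n x))\<^sup>2 \<partial>?M)) \<le> K"
      by (rule BseqE)
    then show ?thesis
      using that[of K] abs_le_D1 unfolding real_norm_def by blast
  qed
  have V4: "integrable ?M (\<lambda>x. (V x $ i $ j)^4)" for i j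
  proof (rule L4_if_L2_limit_of_C1c[OF C[of _ i j]])
    show "(\<lambda>x. V x $ i $ j) \<in> borel_measurable ?M" by measurable
    have n: "\<bar>A $ i $ j\<bar> \<le> norm A" for A :: qmat by (rule abs_nth2_le)
    have n': "norm (A $ i $ j) \<le> norm A" for A :: qgrad
      by (meson Finite_Cartesian_Product.norm_nth_le order_trans)
    show "(\<integral>x. (\<Phi> n x $ i $ j)\<^sup>2 \<partial>?M) + (\<integral>x. (norm (d\<Phi> n x $ i $ j))\<^sup>2 \<partial>?M) \<le> B" for n
    proof -
      have "(\<integral>x. (\<Phi> n x $ i $ j)\<^sup>2 \<partial>?M) \<le> (\<integral>x. (norm (\<Phi> n x))\<^sup>2 \<partial>?M)"
        by (intro integral_mono ic iP) (simp add: n abs_le_square_iff[symmetric])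
      moreover have "(\<integral>x. (norm (d\<Phi> n x $ i $ j))\<^sup>2 \<partial>?M) \<le> (\<integral>x. (norm (d\<Phi> n x))\<^sup>2 \<partial>?M)"
        by (intro integral_mono ic iP power_mono n') auto
      ultimately show ?thesis using B[of n] by linarith
    qed
    show ii: "integrable ?M (\<lambda>x. (\<Phi> n x $ i $ j - V x $ i $ j)\<^sup>2)" for n
      by (rule integrable_square_if_bounded_by[OF iD(1)[of n]]) (use n[of "\<Phi> n _ - V _"] in auto)
    show "(\<lambda>n. \<integral>x. (\<Phi> n x $ i $ j - V x $ i $ j)\<^sup>2 \<partial>?M) \<longlonglongrightarrow> 0"
    proof (rule tendsto_sandwich[OF _ _ tendsto_const l(1)])
      show "\<forall>\<^sub>F n in sequentially. (\<integral>x. (\<Phi> n x $ i $ j - V x $ i $ j)\<^sup>2 \<partial>?M) \<le> (\<integral>x. (norm (\<Phi> n x - V x))\<^sup>2 \<partial>?M)"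
        using n[of "\<Phi> _ _ - V _"]
        by (intro always_eventually allI integral_mono ii iD) (simp add: abs_le_square_iff[symmetric])
    qed auto
  qed
  have "integrable ?M (\<lambda>x. (norm (V x))^4)"
  proof (rule Bochner_Integration.integrable_bound)
    show "integrable ?M (\<lambda>x. 9 * (\<Sum>i\<in>UNIV. \<Sum>j\<in>UNIV. (V x $ i $ j)^4))"
      by (intro integrable_mult_right Bochner_Integration.integrable_sum V4)
    show "AE x in ?M. norm ((norm (V x))^4) \<le> norm (9 * (\<Sum>i\<in>UNIV. \<Sum>j\<in>UNIV. (V x $ i $ j)^4))"
      using norm_power4_le_components by (auto intro!: AE_I2 order_trans[OF _ abs_ge_self])
  qed measurable
  then show ?thesis using that W poincare by blast
qed

text \<open>The coefficients are linear combinations of the values at \<open>s = 0, \<plusminus>1, \<plusminus>2\<close>.\<close>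

lemma quartic_coefficients_integrable:
  fixes b0 b1 b2 b3 b4 :: "'a \<Rightarrow> real"
  assumes P: "\<And>s. integrable M (\<lambda>x. b0 x + s * b1 x + s^2 * b2 x + s^3 * b3 x + s^4 * b4 x)"
  shows "integrable M b0" "integrable M b1" "integrable M b2" "integrable M b3" "integrable M b4"
proof -
  define p where "p s x = b0 x + s * b1 x + s^2 * b2 x + s^3 * b3 x + s^4 * b4 x" for s x
  have p: "integrable M (p s)" for s unfolding p_def by (rule P)
  have e4: "b4 = (\<lambda>x. (p 2 x + p (-2) x - 4 * (p 1 x + p (-1) x) + 6 * p 0 x) / 24)"
    and e3: "b3 = (\<lambda>x. (p 2 x - p (-2) x - 2 * (p 1 x - p (-1) x)) / 12)"
    and e0: "b0 = p 0"
    by (auto simp: p_def fun_eq_iff)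
  show 0: "integrable M b0" unfolding e0 by (rule p)
  show 4: "integrable M b4" unfolding e4 using p by simp
  show 3: "integrable M b3" unfolding e3 using p by simp
  have e2: "b2 = (\<lambda>x. (p 1 x + p (-1) x) / 2 - b0 x - b4 x)"
    and e1: "b1 = (\<lambda>x. (p 1 x - p (-1) x) / 2 - b3 x)"
    by (auto simp: p_def fun_eq_iff field_simps)
  have "integrable M (\<lambda>x. (p 1 x + p (-1) x) / 2 - b0 x - b4 x)"
    using p 0 4 by simp
  then show "integrable M b2" unfolding e2[symmetric] .
  have "integrable M (\<lambda>x. (p 1 x - p (-1) x) / 2 - b3 x)"
    using p 3 by simp
  then show "integrable M b1" unfolding e1[symmetric] .
qed

section \<open>The energy along H + sV and the sign of its second derivative\<close>

lemma LdG_eq: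
  assumes "weak_grad (Omega R) Q G"
  shows "LdG t R Q = (\<integral>x. 1/2 * (norm (G x))\<^sup>2 + bulk t (Q x) \<partial>lebesgue_on (Omega R))"
proof -
  define F where "F = (SOME G. weak_grad (Omega R) Q G)"
  have F: "weak_grad (Omega R) Q F"
    unfolding F_def by (rule someI[of "weak_grad (Omega R) Q"], rule assms)
  have [measurable]: "bulk t \<in> borel_measurable borel"
    by (rule borel_measurable_continuous_onI[OF continuous_bulk])
  have [measurable]: "Q \<in> borel_measurable (lebesgue_on (Omega R))" "G \<in> borel_measurable (lebesgue_on (Omega R))"
     "F \<in> borel_measurable (lebesgue_on (Omega R))"
    using F assms unfolding weak_grad_iff by auto
  have "LdG t R Q = (\<integral>x. 1/2 * (norm (F x))\<^sup>2 + bulk t (Q x) \<partial>lebesgue_on (Omega R))"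
    unfolding LdG_def Let_def F_def[symmetric] LINT_Omega sqg_eq_norm ..
  also have "\<dots> = (\<integral>x. 1/2 * (norm (G x))\<^sup>2 + bulk t (Q x) \<partial>lebesgue_on (Omega R))"
    using weak_grad_unique[OF F assms] by (intro integral_cong_AE) auto
  finally show ?thesis .
qed

theorem theorem3p3:
  fixes t R Rstar :: real and h :: "real \<Rightarrow> real"
  assumes "t \<ge> 0"
    and "Rstar > 1"
    and "\<forall>R'\<in>{1<..Rstar}. \<forall>r\<in>{1..R'}. eta R' r \<ge> 2/3"
    and "1 < R" and "R < Rstar" and "R < 1 + pi / sqrt 6"
    and "radial_minimizer t R h"
  shows "\<forall>V. W12_0 (Omega R) V \<and> \<not> (AE x in lebesgue. x \<in> Omega R \<longrightarrow> V x = 0) \<longrightarrow>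
           (\<exists>D2. second_variation_is t R (hedgehog h) V D2 \<and> D2 > 0)"
proof (intro allI impI)
  fix V assume "W12_0 (Omega R) V \<and> \<not> (AE x in lebesgue. x \<in> Omega R \<longrightarrow> V x = 0)"
  then have W: "W12_0 (Omega R) V" and V0: "\<not> (AE x in lebesgue. x \<in> Omega R \<longrightarrow> V x = 0)" by auto
  let ?M = "lebesgue_on (Omega R)"
  interpret finite_measure ?M by (rule finite_measure_Omega)
  obtain h1 where h1: "\<And>r. r \<in> {1..R} \<Longrightarrow> (h has_real_derivative h1 r) (at r within {1..R})"
    "continuous_on {1..R} h1"
    "\<And>r. r \<in> {1..R} \<Longrightarrow> 2 / 3 \<le> h r \<and> h r \<le> 1 \<and> - 6 \<le> bulkq t (h r)"
    using radial_minimizer_bounds[OF assms(7,4,1)] assms(3,4,5) by (metis greaterThanAtMost_iff less_imp_le)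
  define H where "H = hedgehog h"
  obtain GH where GH: "weak_grad (Omega R) H GH"
    unfolding H_def using hedgehog_weak_grad[OF assms(4) h1(1,2)] by blast
  obtain G where G: "weak_grad (Omega R) V G" and V4: "integrable ?M (\<lambda>x. (norm (V x))^4)"
    and poincare: "(pi / (R - 1))\<^sup>2 * (\<integral>x. (norm (V x))\<^sup>2 \<partial>?M) \<le> (\<integral>x. (norm (G x))\<^sup>2 \<partial>?M)"
    using W12_0_estimates[OF assms(4) W] by blast
  have [measurable]: "H \<in> borel_measurable ?M" "GH \<in> borel_measurable ?M" "V \<in> borel_measurable ?M" "G \<in> borel_measurable ?M"
    and iV: "integrable ?M (\<lambda>x. (norm (V x))\<^sup>2)" "integrable ?M (\<lambda>x. (norm (G x))\<^sup>2)"
    using GH G unfolding weak_grad_iff by auto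
  have [measurable]: "bulk t \<in> borel_measurable borel"
    by (rule borel_measurable_continuous_onI[OF continuous_bulk])
  \<comment> \<open>The s^2 coefficient of \<open>bulk_expand\<close>, the only one whose explicit
    form is used.\<close>
  define b2 where "b2 x = t / 8 * (4 * (H x \<bullet> V x)^2 - 2 * (1 - H x \<bullet> H x) * (V x \<bullet> V x))
        + hplus t / 8 * (3 * (4 * (H x \<bullet> V x)^2 + 2 * (H x \<bullet> H x) * (V x \<bullet> V x)) - 12 * sqrt 6 * trace (H x ** V x ** V x))" for x
  have pointwise: "norm (H x) \<le> 1 \<and> - 6 * (norm (V x))\<^sup>2 \<le> 2 * b2 x" if x: "x \<in> Omega R" for x
  proof -
    have r: "norm x \<in> {1..R}" and n: "norm (x /\<^sub>R norm x) = 1" using x by (auto simp: Omega_def field_simps)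
    have VS: "V x \<in> S0" using W x by (auto simp: W12_0_def)
    have g: "h (norm x) \<ge> 1 / 2" using h1(3)[OF r] by simp
    note D = hedgehog_second_variation_density[OF VS n g assms(1) hedgehog_def[of h x], folded H_def]
    have "- 6 * (V x \<bullet> V x) \<le> bulkq t (h (norm x)) * (V x \<bullet> V x)"
      using h1(3)[OF r] by (intro mult_right_mono) auto
    then show ?thesis
      using D h1(3)[OF r] by (simp add: b2_def power2_norm_eq_inner)
  qed
  \<comment> \<open>The majorant rests on |H| <= 1 and (a + b)^4 <= 8 (a^4 + b^4), obtained by
    applying (a + b)^2 <= 2 a^2 + 2 b^2 twice.\<close>
  have bulk_int: "integrable ?M (\<lambda>x. bulk t (H x + s *\<^sub>R V x))" for s
  proof (rule Bochner_Integration.integrable_bound)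
    show "integrable ?M (\<lambda>x. (t + 200 * hplus t) * (1 + 8 * (1 + s^4 * (norm (V x))^4)))"
      using V4 by simp
    show "AE x in ?M. norm (bulk t (H x + s *\<^sub>R V x)) \<le> norm ((t + 200 * hplus t) * (1 + 8 * (1 + s^4 * (norm (V x))^4)))"
    proof (rule AE_I2)
      fix x assume "x \<in> space ?M"
      then have x: "norm (H x) \<le> 1" using pointwise by (simp add: space_restrict_space)
      have hp: "t + 200 * hplus t \<ge> 0" using assms(1) hplus_ge[OF assms(1)] by simp
      have sq: "(a + b)\<^sup>2 \<le> 2 * a\<^sup>2 + 2 * b\<^sup>2" for a b :: real
        using sum_squares_bound[of a b] by (simp add: power2_sum)
      have "norm (H x + s *\<^sub>R V x) ^ 4 \<le> (1 + \<bar>s\<bar> * norm (V x)) ^ 4"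
        using x norm_triangle_ineq[of "H x" "s *\<^sub>R V x"] by (intro power_mono) auto
      also have "\<dots> = ((1 + \<bar>s\<bar> * norm (V x))\<^sup>2)\<^sup>2" by simp
      also have "\<dots> \<le> (2 * 1\<^sup>2 + 2 * (\<bar>s\<bar> * norm (V x))\<^sup>2)\<^sup>2"
        by (intro power_mono sq) auto
      also have "\<dots> \<le> 2 * (2 * 1\<^sup>2)\<^sup>2 + 2 * (2 * (\<bar>s\<bar> * norm (V x))\<^sup>2)\<^sup>2" by (rule sq)
      also have "\<dots> = 8 * (1 + s^4 * (norm (V x))^4)"
        by (simp add: power_mult_distrib)
      finally have "norm (H x + s *\<^sub>R V x) ^ 4 \<le> 8 * (1 + s^4 * (norm (V x))^4)" .
      then have "(t + 200 * hplus t) * (1 + norm (H x + s *\<^sub>R V x) ^ 4) \<le> (t + 200 * hplus t) * (1 + 8 * (1 + s^4 * (norm (V x))^4))"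
        using hp by (intro mult_left_mono) auto
      then show "norm (bulk t (H x + s *\<^sub>R V x)) \<le> norm ((t + 200 * hplus t) * (1 + 8 * (1 + s^4 * (norm (V x))^4)))"
        using bulk_bound[OF assms(1), of "H x + s *\<^sub>R V x"] unfolding real_norm_def
        by (meson abs_ge_self order_trans)
    qed
  qed measurable
  note WG = weak_grad_add_scaleR[OF GH G]
  have energy_int: "integrable ?M (\<lambda>x. 1/2 * (norm (GH x + s *\<^sub>R G x))\<^sup>2 + bulk t (H x + s *\<^sub>R V x))" for s
    using WG[of s] bulk_int[of s] unfolding weak_grad_iff by auto
  \<comment> \<open>The remaining coefficients matter only through their integrals, so their
    existence suffices. Their integrability follows from that of the energy density for every
    s.\<close>
  have "\<exists>b1 b3 b4. \<forall>x s. bulk t (H x + s *\<^sub>R V x) = bulk t (H x) + s * b1 x + s^2 * b2 x + s^3 * b3 x + s^4 * b4 x"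
    unfolding b2_def by (intro exI allI) (rule bulk_expand)
  then obtain b1 b3 b4 where bulk_eq:
    "\<And>x s. bulk t (H x + s *\<^sub>R V x) = bulk t (H x) + s * b1 x + s^2 * b2 x + s^3 * b3 x + s^4 * b4 x"
    by blast
  define c0 where "c0 x = 1/2 * (norm (GH x))\<^sup>2 + bulk t (H x)" for x
  define c1 where "c1 x = GH x \<bullet> G x + b1 x" for x
  define c2 where "c2 x = 1/2 * (norm (G x))\<^sup>2 + b2 x" for x
  have poly: "1/2 * (norm (GH x + s *\<^sub>R G x))\<^sup>2 + bulk t (H x + s *\<^sub>R V x)
      = c0 x + s * c1 x + s^2 * c2 x + s^3 * b3 x + s^4 * b4 x" for x s
    unfolding bulk_eq c0_def c1_def c2_def power2_norm_eq_inner
    by (simp add: inner_add_left inner_add_right inner_commute[of "G x" "GH x"] power2_eq_square algebra_simps)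
  note ci = quartic_coefficients_integrable[OF energy_int[unfolded poly]]
  define J where "J f = (\<integral>x. f x \<partial>?M)" for f :: "pt \<Rightarrow> real"
  have LdG: "LdG t R (\<lambda>x. H x + s *\<^sub>R V x) = J c0 + s * J c1 + s^2 * J c2 + s^3 * J b3 + s^4 * J b4" for s
    unfolding LdG_eq[OF WG] poly J_def by (simp add: ci)
  have "second_variation_is t R H V (2 * J c2)"
    unfolding second_variation_is_def LdG
  proof (intro exI conjI allI)
    show "((\<lambda>s. J c0 + s * J c1 + s^2 * J c2 + s^3 * J b3 + s^4 * J b4) has_real_derivative
        J c1 + 2 * s * J c2 + 3 * s^2 * J b3 + 4 * s^3 * J b4) (at s)" for s
      by (auto intro!: derivative_eq_intros simp: algebra_simps)
    show "((\<lambda>s. J c1 + 2 * s * J c2 + 3 * s^2 * J b3 + 4 * s^3 * J b4) has_real_derivative 2 * J c2) (at 0)"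
      by (auto intro!: derivative_eq_intros)
  qed
  moreover have "2 * J c2 > 0"
  proof -
    define N where "N = (\<integral>x. (norm (V x))\<^sup>2 \<partial>?M)"
    have "N \<noteq> 0"
    proof
      assume "N = 0"
      then have "AE x in ?M. (norm (V x))\<^sup>2 = 0"
        unfolding N_def using integral_nonneg_eq_0_iff_AE[OF iV(1)] by simp
      then have "AE x in lebesgue. x \<in> Omega R \<longrightarrow> V x = 0"
        using sets_Omega[of R] by (simp add: AE_restrict_space_iff)
      then show False using V0 by simp
    qed
    then have N: "N > 0" by (simp add: N_def less_le)
    \<comment> \<open>The bound on \<open>R\<close> is turned into 6 < (pi / (R - 1))^2; the
      strictness needs N > 0, that is, a nonzero V.\<close>
    have "R - 1 < pi / sqrt 6" using assms(6) by simp
    then have "sqrt 6 < pi / (R - 1)" using assms(4) by (simp add: field_simps)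
    then have "(sqrt 6)\<^sup>2 < (pi / (R - 1))\<^sup>2" by (intro power_strict_mono) auto
    then have "6 * N < (pi / (R - 1))\<^sup>2 * N" using N by simp
    also have "\<dots> \<le> (\<integral>x. (norm (G x))\<^sup>2 \<partial>?M)" using poincare by (simp add: N_def)
    finally have "0 < (\<integral>x. (norm (G x))\<^sup>2 \<partial>?M) - 6 * N" by simp
    also have "\<dots> = (\<integral>x. (norm (G x))\<^sup>2 + - 6 * (norm (V x))\<^sup>2 \<partial>?M)"
      unfolding N_def by (subst Bochner_Integration.integral_add) (use iV in auto)
    also have "\<dots> \<le> (\<integral>x. 2 * c2 x \<partial>?M)"
    proof (rule integral_mono_AE)
      show "AE x in ?M. (norm (G x))\<^sup>2 + - 6 * (norm (V x))\<^sup>2 \<le> 2 * c2 x"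
        using pointwise by (intro AE_I2) (auto simp: space_restrict_space c2_def)
    qed (use iV ci in auto)
    finally show ?thesis by (simp add: J_def)
  qed
  ultimately show "\<exists>D2. second_variation_is t R (hedgehog h) V D2 \<and> D2 > 0"
    unfolding H_def by blast
qed

end
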